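(* Let $E$ be a Polish space and let $d$ be a complete metric generating the topology of $E$. Let $(\mathscr{S},\mathscr{A})$, $\mathscr{A}=(A_\alpha)_{\alpha\in\Lambda}$, be a Markovian average scheme on $(C_b(E),\mathscr{M}(E))$ such that for every $f\in\mathrm{Lip}_b(E,d)$ the net $(A_\alpha f)_{\alpha\in\Lambda}$ clusters in $(C_b(E),\beta_0)$. Suppose that there exists an increasing cofinal sequence in $\Lambda$. Then the following assertions are equivalent. (i) $(\mathscr{S},\mathscr{A})$ is weakly ergodic and $\beta_0\text{-}\lim_\alpha A_\alpha f=Pf$ for all $f\in C_b(E)$, where $P$ is the ergodic projection. (ii) For every $x\in E$ the net $(A'_\alpha\delta_x)_{\alpha\in\Lambda}$ has a $\sigma'$-cluster point. (iii) $\mathrm{fix}(\mathscr{S}')$ separates $\mathrm{fix}(\mathscr{S})$. (iv) $\mathscr{M}(E)=\mathrm{fix}(\mathscr{S}')\oplus\overline{\mathrm{span}}^{\sigma'}\,\mathrm{rg}(I-\mathscr{S}')$.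
   Context: $C_b(E)$ is the space of bounded continuous (complex-valued) functions on $E$ with the supremum norm, $\mathscr{M}(E)$ the space of complex Borel measures on $E$ with the total variation norm, paired by $\langle f,\mu\rangle=\int_E f\,d\mu$. Put $X=C_b(E)$, $Y=\mathscr{M}(E)$, $\sigma=\sigma(X,Y)$ (on $X$) and $\sigma'=\sigma(Y,X)$ (on $Y$). $\mathscr{L}(X,\sigma)$ is the algebra of $\sigma$-continuous linear operators on $X$; such operators are norm-bounded and $S\in\mathscr{L}(X,\sigma)$ has a $\sigma$-adjoint $S'$ on $Y$ given by $\langle Sf,\mu\rangle=\langle f,S'\mu\rangle$. $\delta_x$ is the Dirac measure at $x$. $\mathrm{Lip}_b(E,d)$ is the space of bounded functions on $E$ that are Lipschitz continuous with respect to $d$. Strict topology: let $\mathscr{F}_0(E)$ be the space of all bounded functions $\varphi$ on $E$ that vanish at infinity, i.e. for every $\varepsilon>0$ there is a compact $K\subset E$ with $|\varphi(x)|<\varepsilon$ for all $x\notin K$. The strict topology $\beta_0$ on $C_b(E)$ is the locally convex topology generated by the seminorms $q_\varphi(f):=\|\varphi f\|_\infty$, $\varphi\in\mathscr{F}_0(E)$. For a family $\mathscr{S}$ of linear operators on a vector space $X$: $\mathrm{fix}(\mathscr{S}):=\bigcap_{S\in\mathscr{S}}\ker(I-S)$, $\mathrm{rg}(I-\mathscr{S}):=\{x-Sx: x\in X, S\in\mathscr{S}\}$, and $\mathrm{co}(\mathscr{S}x)$ is the convex hull of the orbit $\{Sx:S\in\mathscr{S}\}$. $\overline{\mathrm{span}}^{\tau}$,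 $\overline{\mathrm{co}}^{\tau}$ denote $\tau$-closures of the linear span and convex hull. A family containing the identity is a semigroup if it is closed under composition. An average scheme on $(X,Y)$ is a pair $(\mathscr{S},\mathscr{A})$, where $\mathscr{S}\subset\mathscr{L}(X,\sigma)$ is a semigroup with adjoint $\mathscr{S}':=\{S':S\in\mathscr{S}\}$ and $\mathscr{A}=(A_\alpha)_{\alpha\in\Lambda}\subset\mathscr{L}(X,\sigma)$ is a net such that: (AS1) there is $M>0$ with $\|A_\alpha\|\le M$ for all $\alpha\in\Lambda$; (AS2) $A_\alpha x\in\overline{\mathrm{co}}^{\sigma}(\mathscr{S}x)$ and $A'_\alpha y\in\overline{\mathrm{co}}^{\sigma'}(\mathscr{S}'y)$ for all $\alpha\in\Lambda$, $x\in X$, $y\in Y$; (AS3) for every $S\in\mathscr{S}$, $x\in X$, $y\in Y$: $\lim_\alpha A_\alpha(S-I)x=\lim_\alpha(S-I)A_\alpha x=0$ and $\lim_\alpha A'_\alpha(S'-I)y=\lim_\alpha(S'-I)A'_\alpha y=0$ in the norms of $X$ and $Y$ respectively. The average scheme is Markovian if every $S\in\mathscr{S}$ is positive and satisfies $S\mathbf{1}=\mathbf{1}$. It is weakly ergodic if $\sigma\text{-}\lim_\alpha A_\alpha x$ exists for every $x\in X$ and $\sigma'\text{-}\lim_\alpha A'_\alpha y$ exists for every $y\in Y$; in this case the ergodic projection is the operator $Px:=\sigma\text{-}\lim_\alpha A_\alpha x$. A net in a topological space clusters if every subnet of it has a cluster point, i.e. has a convergent subnet. $\mathrm{fix}(\mathscr{S}')$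 separates $\mathrm{fix}(\mathscr{S})$ if for every $0\ne x\in\mathrm{fix}(\mathscr{S})$ there is $y\in\mathrm{fix}(\mathscr{S}')$ with $\langle x,y\rangle\neq0$. *)

theory Defs
  imports "HOL-Analysis.Analysis"
begin

section \<open>Complex Borel measures\<close>

text \<open>
  A complex Borel measure is a countably additive complex set function on the Borel sets. As
  values outside the Borel sets are meaningless, they are normalised to 0, so that equality on
  the type is equality on Borel sets.
\<close>

definition complex_borel_measure :: "('a::topological_space set \<Rightarrow> complex) \<Rightarrow> bool" where
  "complex_borel_measure m \<longleftrightarrow>
     (\<forall>A. A \<notin> sets borel \<longrightarrow> m A = 0) \<and>
     (\<forall>A :: nat \<Rightarrow> 'a set. range A \<subseteq> sets borel \<longrightarrow> disjoint_family A \<longrightarrow>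
        (\<lambda>n. m (A n)) sums m (\<Union>n. A n))"

typedef (overloaded) ('a :: topological_space) cmeas =
  "{m :: 'a set \<Rightarrow> complex. complex_borel_measure m}"
  morphisms meas_of Cmeas
  by (rule exI[of _ "\<lambda>_. 0"]) (simp add: complex_borel_measure_def)

setup_lifting type_definition_cmeas

lemma meas_of_nonborel: "A \<notin> sets borel \<Longrightarrow> meas_of m A = 0"
  using meas_of[of m] by (simp add: complex_borel_measure_def)

lemma meas_of_sums:
  "range A \<subseteq> sets borel \<Longrightarrow> disjoint_family A \<Longrightarrow> (\<lambda>n. meas_of m (A n)) sums meas_of m (\<Union>n. A n)"
  using meas_of[of m] by (simp add: complex_borel_measure_def)

lemma meas_of_empty [simp]: "meas_of m {} = 0"
proof -
  have "(\<lambda>n::nat. meas_of m {}) sums meas_of m {}"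
    using meas_of_sums[of "\<lambda>_. {}" m] by (simp add: disjoint_family_on_def)
  hence "summable (\<lambda>n::nat. meas_of m {})"
    by (rule sums_summable)
  thus ?thesis by (simp add: summable_const_iff)
qed

lemma meas_of_Un:
  assumes "A \<in> sets borel" "B \<in> sets borel" "A \<inter> B = {}"
  shows "meas_of m (A \<union> B) = meas_of m A + meas_of m B"
proof -
  have r: "range (binaryset A B) \<subseteq> sets borel"
    using assms by (auto simp: range_binaryset_eq)
  have "disjoint_family (binaryset A B)"
    using assms by (auto simp: disjoint_family_on_def binaryset_def)
  from meas_of_sums[OF r this, of m]
  have "(\<lambda>n. meas_of m (binaryset A B n)) sums meas_of m (A \<union> B)"
    by (simp add: UN_binaryset_eq)
  moreover have "(\<lambda>n. meas_of m (binaryset A B n)) sums (meas_of m A + meas_of m B)"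
    by (rule binaryset_sums) simp
  ultimately show ?thesis using sums_unique2 by blast
qed

lemma meas_of_Diff:
  assumes "A \<in> sets borel" "B \<in> sets borel" "B \<subseteq> A"
  shows "meas_of m (A - B) = meas_of m A - meas_of m B"
proof -
  have "(A - B) \<union> B = A" "(A - B) \<inter> B = {}" "A - B \<in> sets borel" using assms by auto
  thus ?thesis using meas_of_Un[of "A - B" B m] assms by simp
qed

lemma meas_of_finite_Union:
  assumes "finite P" "P \<subseteq> sets borel" "disjoint P"
  shows "meas_of m (\<Union>P) = (\<Sum>A\<in>P. meas_of m A)"
  using assms
proof (induction P rule: finite_induct)
  case (insert A P)
  have "A \<inter> \<Union>P = {}"
    using insert.hyps(2) insert.prems(2) by (auto simp: disjoint_def)
  moreover have "\<Union>P \<in> sets borel"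
    using insert.hyps(1) insert.prems(1) by (intro sets.finite_Union) auto
  ultimately show ?case
    using insert by (simp add: meas_of_Un pairwise_insert)
qed simp

lemma meas_of_bounded: "\<exists>C. \<forall>A\<in>sets borel. norm (meas_of m A) \<le> C"
proof (rule ccontr)
  let ?n = "\<lambda>A. norm (meas_of m A)"
  define ub where "ub A \<longleftrightarrow> (\<forall>C. \<exists>B\<in>sets borel. B \<subseteq> A \<and> ?n B > C)" for A
  assume "\<not> ?thesis"
  hence ub0: "ub UNIV" by (auto simp: ub_def not_le)
  have step: "\<exists>B. B \<in> sets borel \<and> B \<subseteq> A \<and> ub B \<and> ?n (A - B) \<ge> 1"
    if A: "A \<in> sets borel" "ub A" for A
  proof -
    obtain B where B: "B \<in> sets borel" "B \<subseteq> A" "?n B > ?n A + 1"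
      using A(2) unfolding ub_def by blast
    have d: "meas_of m (A - B) = meas_of m A - meas_of m B"
      using A B by (intro meas_of_Diff)
    have nAB: "?n (A - B) \<ge> 1"
      using B(3) norm_triangle_ineq2[of "meas_of m B" "meas_of m A"]
      unfolding d by (simp add: norm_minus_commute)
    have nB: "?n B \<ge> 1" using B(3) norm_ge_zero[of "meas_of m A"] by linarith
    have "ub B \<or> ub (A - B)"
    proof (rule ccontr)
      assume "\<not> ?thesis"
      hence "\<not> ub B" "\<not> ub (A - B)" by simp_all
      then obtain C1 C2 where "\<forall>D\<in>sets borel. \<not> (D \<subseteq> B \<and> ?n D > C1)"
          "\<forall>D\<in>sets borel. \<not> (D \<subseteq> A - B \<and> ?n D > C2)"
        unfolding ub_def by meson
      hence C: "\<And>D. D \<in> sets borel \<Longrightarrow> D \<subseteq> B \<Longrightarrow> ?n D \<le> C1"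
        and C': "\<And>D. D \<in> sets borel \<Longrightarrow> D \<subseteq> A - B \<Longrightarrow> ?n D \<le> C2"
        by (meson not_le)+
      obtain D where D: "D \<in> sets borel" "D \<subseteq> A" "?n D > C1 + C2"
        using A(2) unfolding ub_def by blast
      have "D \<inter> B \<union> (D - B) = D" by auto
      hence "meas_of m D = meas_of m (D \<inter> B) + meas_of m (D - B)"
        using meas_of_Un[of "D \<inter> B" "D - B" m] D B by auto
      moreover have "?n (D \<inter> B) \<le> C1" "?n (D - B) \<le> C2"
        using C[of "D \<inter> B"] C'[of "D - B"] D B by auto
      ultimately show False
        using D(3) norm_triangle_ineq[of "meas_of m (D \<inter> B)" "meas_of m (D - B)"] by simp
    qed
    thus ?thesis
    proof
      assume "ub B" thus ?thesis using B nAB by blast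
    next
      assume "ub (A - B)"
      moreover have "A - (A - B) = B" using B by auto
      ultimately show ?thesis using A B nB by (metis Diff_subset sets.Diff)
    qed
  qed
  define nxt where "nxt A = (SOME B. B \<in> sets borel \<and> B \<subseteq> A \<and> ub B \<and> ?n (A - B) \<ge> 1)" for A
  have nxt: "nxt A \<in> sets borel \<and> nxt A \<subseteq> A \<and> ub (nxt A) \<and> ?n (A - nxt A) \<ge> 1"
    if "A \<in> sets borel" "ub A" for A
    unfolding nxt_def by (rule someI_ex[OF step[OF that]])
  define F where "F k = (nxt ^^ k) UNIV" for k
  have F: "F k \<in> sets borel \<and> ub (F k)" for k
    by (induction k) (use nxt ub0 in \<open>auto simp: F_def\<close>)
  have Fs: "F (Suc k) \<subseteq> F k" "?n (F k - F (Suc k)) \<ge> 1" for k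
    using nxt[of "F k"] F[of k] by (auto simp: F_def)
  have "decseq F" using Fs(1) by (rule decseq_SucI)
  define D where "D k = F k - F (Suc k)" for k
  have D1: "D i \<inter> D j = {}" if "i < j" for i j
    using decseqD[OF \<open>decseq F\<close>, of "Suc i" j] that by (auto simp: D_def)
  have "D i \<inter> D j = {}" if "i \<noteq> j" for i j
    using D1[of i j] D1[of j i] that by (cases i j rule: linorder_cases) auto
  hence "disjoint_family D"
    by (simp add: disjoint_family_on_def)
  moreover have "range D \<subseteq> sets borel" using F by (auto simp: D_def)
  ultimately have "summable (\<lambda>k. meas_of m (D k))"
    using meas_of_sums sums_summable by blast
  hence "(\<lambda>k. meas_of m (D k)) \<longlonglongrightarrow> 0" by (rule summable_LIMSEQ_zero)
  hence "\<forall>\<^sub>F k in sequentially. ?n (D k) < 1"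
    by (auto dest: tendstoD[where e = 1])
  thus False using Fs(2) by (auto simp: D_def eventually_sequentially not_less[symmetric])
qed


subsection \<open>The total variation norm\<close>

instantiation cmeas :: (topological_space) real_vector
begin

lift_definition zero_cmeas :: "'a cmeas" is "\<lambda>_. 0"
  by (simp add: complex_borel_measure_def)

lift_definition plus_cmeas :: "'a cmeas \<Rightarrow> 'a cmeas \<Rightarrow> 'a cmeas" is "\<lambda>m n A. m A + n A"
  by (simp add: complex_borel_measure_def sums_add)

lift_definition uminus_cmeas :: "'a cmeas \<Rightarrow> 'a cmeas" is "\<lambda>m A. - m A"
  by (simp add: complex_borel_measure_def sums_minus)

lift_definition minus_cmeas :: "'a cmeas \<Rightarrow> 'a cmeas \<Rightarrow> 'a cmeas" is "\<lambda>m n A. m A - n A"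
  by (simp add: complex_borel_measure_def sums_diff)

lift_definition scaleR_cmeas :: "real \<Rightarrow> 'a cmeas \<Rightarrow> 'a cmeas" is "\<lambda>r m A. r *\<^sub>R m A"
  by (simp add: complex_borel_measure_def sums_scaleR_right)

instance
  by standard (simp_all add: meas_of_inject[symmetric] fun_eq_iff zero_cmeas.rep_eq plus_cmeas.rep_eq
      uminus_cmeas.rep_eq minus_cmeas.rep_eq scaleR_cmeas.rep_eq algebra_simps)

end

text \<open>
  Finite disjoint families of Borel sets give the same supremum as finite or countable Borel
  partitions of the whole space.
\<close>

definition variation_sums :: "'a::topological_space cmeas \<Rightarrow> real set" where
  "variation_sums m = {(\<Sum>A\<in>P. norm (meas_of m A)) | P.
     finite P \<and> P \<subseteq> sets borel \<and> disjoint P}"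

lemma variation_sumsI:
  "finite P \<Longrightarrow> P \<subseteq> sets borel \<Longrightarrow> disjoint P \<Longrightarrow> (\<Sum>A\<in>P. norm (meas_of m A)) \<in> variation_sums m"
  unfolding variation_sums_def by blast

lemma zero_in_variation_sums: "0 \<in> variation_sums m"
  using variation_sumsI[of "{}" m] by simp

lemma sum_abs_le_of_subset_sums:
  fixes f :: "'b \<Rightarrow> real"
  assumes "finite P" "\<And>Q. Q \<subseteq> P \<Longrightarrow> \<bar>sum f Q\<bar> \<le> C"
  shows "(\<Sum>A\<in>P. \<bar>f A\<bar>) \<le> 2 * C"
proof -
  let ?p = "{A\<in>P. f A \<ge> 0}" and ?q = "{A\<in>P. \<not> f A \<ge> 0}"
  have "(\<Sum>A\<in>P. \<bar>f A\<bar>) = (\<Sum>A\<in>?p \<union> ?q. \<bar>f A\<bar>)"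
    by (rule sum.cong) auto
  also have "\<dots> = (\<Sum>A\<in>?p. \<bar>f A\<bar>) + (\<Sum>A\<in>?q. \<bar>f A\<bar>)"
    using assms(1) by (intro sum.union_disjoint) auto
  also have "(\<Sum>A\<in>?p. \<bar>f A\<bar>) = sum f ?p" by (intro sum.cong) auto
  also have "(\<Sum>A\<in>?q. \<bar>f A\<bar>) = - sum f ?q"
    unfolding sum_negf[symmetric] by (intro sum.cong) auto
  finally show ?thesis using assms(2)[of ?p] assms(2)[of ?q] by auto
qed

lemma variation_sums_bdd: "bdd_above (variation_sums m)"
proof -
  obtain C where C: "\<And>A. A \<in> sets borel \<Longrightarrow> norm (meas_of m A) \<le> C"
    using meas_of_bounded by blast
  have "(\<Sum>A\<in>P. norm (meas_of m A)) \<le> 4 * C"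
    if P: "finite P" "P \<subseteq> sets borel" "disjoint P" for P
  proof -
    have le: "norm (\<Sum>A\<in>Q. meas_of m A) \<le> C" if "Q \<subseteq> P" for Q
    proof -
      have Q: "finite Q" "Q \<subseteq> sets borel" "disjoint Q"
        using that P finite_subset[OF that P(1)] pairwise_subset[OF P(3) that] by auto
      hence "\<Union>Q \<in> sets borel" by (intro sets.finite_Union)
      thus ?thesis using C[of "\<Union>Q"] meas_of_finite_Union[OF Q, of m] by simp
    qed
    have "\<bar>\<Sum>A\<in>Q. Re (meas_of m A)\<bar> \<le> C" "\<bar>\<Sum>A\<in>Q. Im (meas_of m A)\<bar> \<le> C" if "Q \<subseteq> P" for Q
      using le[OF that] abs_Re_le_cmod[of "\<Sum>A\<in>Q. meas_of m A"]
        abs_Im_le_cmod[of "\<Sum>A\<in>Q. meas_of m A"] by simp_all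
    hence "(\<Sum>A\<in>P. \<bar>Re (meas_of m A)\<bar>) \<le> 2 * C" "(\<Sum>A\<in>P. \<bar>Im (meas_of m A)\<bar>) \<le> 2 * C"
      using P(1) by (auto intro!: sum_abs_le_of_subset_sums)
    moreover have "(\<Sum>A\<in>P. norm (meas_of m A)) \<le>
        (\<Sum>A\<in>P. \<bar>Re (meas_of m A)\<bar> + \<bar>Im (meas_of m A)\<bar>)"
      by (intro sum_mono cmod_le)
    ultimately show ?thesis by (simp add: sum.distrib)
  qed
  thus ?thesis by (auto simp: variation_sums_def bdd_above_def)
qed

instantiation cmeas :: (topological_space) real_normed_vector
begin

definition norm_cmeas :: "'a cmeas \<Rightarrow> real" where
  "norm_cmeas m = Sup (variation_sums m)"

definition dist_cmeas :: "'a cmeas \<Rightarrow> 'a cmeas \<Rightarrow> real" where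
  "dist_cmeas m n = norm (m - n)"

definition sgn_cmeas :: "'a cmeas \<Rightarrow> 'a cmeas" where
  "sgn_cmeas m = m /\<^sub>R norm m"

definition uniformity_cmeas :: "('a cmeas \<times> 'a cmeas) filter" where
  "uniformity_cmeas = (INF e\<in>{0 <..}. principal {(x, y). dist x y < e})"

definition open_cmeas :: "'a cmeas set \<Rightarrow> bool" where
  "open_cmeas S = (\<forall>x\<in>S. \<forall>\<^sub>F (x', y) in uniformity. x' = x \<longrightarrow> y \<in> S)"

instance
proof
  fix m n :: "'a cmeas" and r :: real
  have up: "(\<Sum>A\<in>P. norm (meas_of k A)) \<le> norm k"
    if "finite P" "P \<subseteq> sets borel" "disjoint P" for P and k :: "'a cmeas"
    unfolding norm_cmeas_def
    using variation_sumsI[OF that] variation_sums_bdd by (rule cSup_upper)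
  have least: "norm k \<le> C" if "\<And>P. finite P \<Longrightarrow> P \<subseteq> sets borel \<Longrightarrow> disjoint P \<Longrightarrow>
    (\<Sum>A\<in>P. norm (meas_of k A)) \<le> C" for C and k :: "'a cmeas"
    unfolding norm_cmeas_def
    using that zero_in_variation_sums[of k] by (intro cSup_least) (auto simp: variation_sums_def)
  show "norm m = 0 \<longleftrightarrow> m = 0"
  proof
    assume m: "norm m = 0"
    have "meas_of m A = 0" for A
      using up[of "{A}" m] m meas_of_nonborel[of A m] by (cases "A \<in> sets borel") auto
    thus "m = 0" by transfer auto
  next
    assume "m = 0"
    hence "\<And>A. meas_of m A = 0" by (simp add: zero_cmeas.rep_eq)
    hence "norm m \<le> 0" by (intro least) simp
    thus "norm m = 0" using up[of "{}" m] by simp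
  qed
  show "norm (m + n) \<le> norm m + norm n"
  proof (rule least)
    fix P :: "'a set set" assume P: "finite P" "P \<subseteq> sets borel" "disjoint P"
    have "(\<Sum>A\<in>P. norm (meas_of (m + n) A)) \<le>
        (\<Sum>A\<in>P. norm (meas_of m A) + norm (meas_of n A))"
      by (intro sum_mono) (simp add: plus_cmeas.rep_eq norm_triangle_ineq)
    thus "(\<Sum>A\<in>P. norm (meas_of (m + n) A)) \<le> norm m + norm n"
      using up[OF P, of m] up[OF P, of n] by (simp add: sum.distrib)
  qed
  have sc: "norm (s *\<^sub>R k) \<le> \<bar>s\<bar> * norm k" for s and k :: "'a cmeas"
  proof (rule least)
    fix P :: "'a set set" assume P: "finite P" "P \<subseteq> sets borel" "disjoint P"
    have "(\<Sum>A\<in>P. norm (meas_of (s *\<^sub>R k) A)) = \<bar>s\<bar> * (\<Sum>A\<in>P. norm (meas_of k A))"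
      by (simp add: scaleR_cmeas.rep_eq sum_distrib_left)
    thus "(\<Sum>A\<in>P. norm (meas_of (s *\<^sub>R k) A)) \<le> \<bar>s\<bar> * norm k"
      using up[OF P, of k] by (simp add: mult_left_mono)
  qed
  show "norm (r *\<^sub>R m) = \<bar>r\<bar> * norm m"
  proof (cases "r = 0")
    case True
    have "norm m \<ge> 0" using up[of "{}" m] by simp
    thus ?thesis using True sc[of 0 m] up[of "{}" "0 *\<^sub>R m"] by simp
  next
    case False
    have "norm m = norm (inverse r *\<^sub>R (r *\<^sub>R m))" using False by simp
    also have "\<dots> \<le> \<bar>inverse r\<bar> * norm (r *\<^sub>R m)" by (rule sc)
    finally have "\<bar>r\<bar> * norm m \<le> norm (r *\<^sub>R m)"
      using False by (simp add: field_simps)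
    thus ?thesis using sc[of r m] by simp
  qed
qed (rule dist_cmeas_def sgn_cmeas_def uniformity_cmeas_def open_cmeas_def)+

end


subsection \<open>Integration against a complex measure\<close>

text \<open>
  The positive part of a signed measure \<open>\<nu>\<close> in its Jordan decomposition is
  \<open>\<nu>\<^sup>+ A = sup {\<nu> B | B \<subseteq> A Borel}\<close>, and the negative part is the positive part of \<open>- \<nu>\<close>. Negative
  values are cut off by \<^term>\<open>ennreal\<close>, which is harmless as \<open>B = {}\<close> contributes 0.
\<close>

definition pos_part :: "('a::topological_space set \<Rightarrow> real) \<Rightarrow> 'a measure" where
  "pos_part \<nu> = measure_of UNIV (sets borel)
     (\<lambda>A. SUP B\<in>{B \<in> sets borel. B \<subseteq> A}. ennreal (\<nu> B))"

definition cmeas_integral :: "('a::topological_space \<Rightarrow> complex) \<Rightarrow> 'a cmeas \<Rightarrow> complex" where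
  "cmeas_integral f m =
     (LINT x|pos_part (\<lambda>A. Re (meas_of m A)). f x) - (LINT x|pos_part (\<lambda>A. - Re (meas_of m A)). f x)
     + \<i> * ((LINT x|pos_part (\<lambda>A. Im (meas_of m A)). f x)
            - (LINT x|pos_part (\<lambda>A. - Im (meas_of m A)). f x))"

lift_definition dirac :: "'a::topological_space \<Rightarrow> 'a cmeas" is
  "\<lambda>x A. if A \<in> sets borel then indicator A x else 0"
proof -
  fix x :: 'a
  have "(\<lambda>n. indicator (A n) x :: complex) sums indicator (\<Union>n. A n) x"
    if "disjoint_family A" for A :: "nat \<Rightarrow> 'a set"
  proof (cases "\<exists>k. x \<in> A k")
    case True
    then obtain k where k: "x \<in> A k" by blast
    have "x \<notin> A n" if "n \<noteq> k" for n
      using \<open>disjoint_family A\<close> k that by (auto simp: disjoint_family_on_def)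
    hence "(\<lambda>n. indicator (A n) x :: complex) = (\<lambda>n. if n = k then 1 else 0)"
      using k by (auto simp: fun_eq_iff)
    moreover have "indicator (\<Union>n. A n) x = (1 :: complex)"
      using k by (auto simp: indicator_def)
    ultimately show ?thesis using sums_single[of k "\<lambda>_. 1::complex"] by simp
  qed auto
  thus "complex_borel_measure (\<lambda>A. if A \<in> sets borel then indicator A x else 0 :: complex)"
    unfolding complex_borel_measure_def by (auto simp: subset_iff)
qed


section \<open>The pair of bounded continuous functions and complex measures\<close>

text \<open>The library has only the real vector space structure on bounded continuous functions.\<close>

definition scale_cb ::
  "complex \<Rightarrow> ('a::topological_space \<Rightarrow>\<^sub>C complex) \<Rightarrow> ('a \<Rightarrow>\<^sub>C complex)" where
  "scale_cb c f = Bcontfun (\<lambda>x. c * apply_bcontfun f x)"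

lemma apply_scale_cb [simp]: "apply_bcontfun (scale_cb c f) x = c * apply_bcontfun f x"
proof -
  obtain C where "\<forall>x. norm (apply_bcontfun f x) \<le> C"
    using bounded_apply_bcontfun[of f] by (auto simp: bounded_iff)
  hence "bounded (range (\<lambda>x. c * apply_bcontfun f x))"
    by (intro boundedI[of _ "norm c * C"]) (auto simp: norm_mult mult_left_mono)
  hence "(\<lambda>x. c * apply_bcontfun f x) \<in> bcontfun"
    by (auto simp: bcontfun_def intro!: continuous_intros)
  thus ?thesis by (simp add: scale_cb_def Bcontfun_inverse)
qed

lift_definition scale_cmeas :: "complex \<Rightarrow> 'a::topological_space cmeas \<Rightarrow> 'a cmeas"
  is "\<lambda>c m A. c * m A"
  by (simp add: complex_borel_measure_def sums_mult)

lemma vector_space_scale_cb: "vector_space scale_cb"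
  by standard (auto intro!: bcontfun_eqI simp: algebra_simps)

lemma vector_space_scale_cmeas: "vector_space scale_cmeas"
  by standard (simp_all add: meas_of_inject[symmetric] fun_eq_iff plus_cmeas.rep_eq
      scale_cmeas.rep_eq algebra_simps)

definition pairing :: "('a::topological_space \<Rightarrow>\<^sub>C complex) \<Rightarrow> 'a cmeas \<Rightarrow> complex" where
  "pairing f m = cmeas_integral (apply_bcontfun f) m"

definition weak_topology :: "('x \<Rightarrow> 'y \<Rightarrow> complex) \<Rightarrow> 'x topology" where
  "weak_topology b = topology_generated_by {{x. b x y \<in> U} | y U. open U}"

abbreviation sigma_fun :: "('a::topological_space \<Rightarrow>\<^sub>C complex) topology" where
  "sigma_fun \<equiv> weak_topology pairing"

abbreviation sigma_meas :: "'a::topological_space cmeas topology" where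
  "sigma_meas \<equiv> weak_topology (\<lambda>m f. pairing f m)"

definition vanishes_at_infinity :: "('a::topological_space \<Rightarrow> complex) \<Rightarrow> bool" where
  "vanishes_at_infinity \<phi> \<longleftrightarrow> (\<forall>\<epsilon>>0. \<exists>K. compact K \<and> (\<forall>x. x \<notin> K \<longrightarrow> norm (\<phi> x) < \<epsilon>))"

text \<open>The weights \<open>\<phi>\<close> are arbitrary bounded functions; they need not be continuous.\<close>

definition strict_weights :: "('a::topological_space \<Rightarrow> complex) set" where
  "strict_weights = {\<phi>. bounded (range \<phi>) \<and> vanishes_at_infinity \<phi>}"

definition strict_seminorm ::
  "('a::topological_space \<Rightarrow> complex) \<Rightarrow> ('a \<Rightarrow>\<^sub>C complex) \<Rightarrow> real" where
  "strict_seminorm \<phi> f = (SUP x. norm (\<phi> x * apply_bcontfun f x))"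

definition strict_topology :: "('a::topological_space \<Rightarrow>\<^sub>C complex) topology" where
  "strict_topology = topology_generated_by
     {{g. strict_seminorm \<phi> (g - f) < \<epsilon>} | \<phi> f \<epsilon>. \<phi> \<in> strict_weights \<and> \<epsilon> > 0}"

text \<open>
  The metric is the one of the type class. On a type of class \<^class>\<open>polish_space\<close> it is an
  arbitrary complete metric inducing the separable topology.
\<close>

definition Lip_b :: "('a::metric_space \<Rightarrow>\<^sub>C complex) set" where
  "Lip_b = {f. \<exists>L. L-lipschitz_on UNIV (apply_bcontfun f)}"

definition sigma_operators ::
  "(('a::topological_space \<Rightarrow>\<^sub>C complex) \<Rightarrow> ('a \<Rightarrow>\<^sub>C complex)) set" where
  "sigma_operators =
     {S. Vector_Spaces.linear scale_cb scale_cb S \<and> continuous_map sigma_fun sigma_fun S}"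

text \<open>
  Meant for members of \<open>sigma_operators\<close> only, for which the adjoint exists and is unique on
  metric spaces.
\<close>

definition sigma_adjoint ::
  "(('a::topological_space \<Rightarrow>\<^sub>C complex) \<Rightarrow> ('a \<Rightarrow>\<^sub>C complex)) \<Rightarrow> 'a cmeas \<Rightarrow> 'a cmeas" where
  "sigma_adjoint S m = (THE n. \<forall>f. pairing (S f) m = pairing f n)"


section \<open>Nets\<close>

definition directed_on :: "'i set \<Rightarrow> ('i \<Rightarrow> 'i \<Rightarrow> bool) \<Rightarrow> bool" where
  "directed_on \<Lambda> le \<longleftrightarrow> \<Lambda> \<noteq> {} \<and> (\<forall>a\<in>\<Lambda>. le a a) \<and>
     (\<forall>a\<in>\<Lambda>. \<forall>b\<in>\<Lambda>. \<forall>c\<in>\<Lambda>. le a b \<longrightarrow> le b c \<longrightarrow> le a c) \<and>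
     (\<forall>a\<in>\<Lambda>. \<forall>b\<in>\<Lambda>. \<exists>c\<in>\<Lambda>. le a c \<and> le b c)"

text \<open>Convergence of a net indexed by \<open>\<Lambda>\<close> is convergence along its filter of tails.\<close>

definition net_filter :: "'i set \<Rightarrow> ('i \<Rightarrow> 'i \<Rightarrow> bool) \<Rightarrow> 'i filter" where
  "net_filter \<Lambda> le = (INF a\<in>\<Lambda>. principal {b\<in>\<Lambda>. le a b})"

lemma eventually_net_filter:
  assumes "directed_on \<Lambda> le"
  shows "eventually P (net_filter \<Lambda> le) \<longleftrightarrow> (\<exists>a\<in>\<Lambda>. \<forall>b\<in>\<Lambda>. le a b \<longrightarrow> P b)"
proof -
  let ?G = "\<lambda>a. principal {b\<in>\<Lambda>. le a b}"
  have "\<exists>x\<in>\<Lambda>. ?G x \<le> inf (?G a) (?G b)" if ab: "a \<in> \<Lambda>" "b \<in> \<Lambda>" for a b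
  proof -
    obtain c where c: "c \<in> \<Lambda>" "le a c" "le b c"
      using assms ab unfolding directed_on_def by blast
    have "{d\<in>\<Lambda>. le c d} \<subseteq> {d\<in>\<Lambda>. le a d} \<inter> {d\<in>\<Lambda>. le b d}"
      using assms ab c unfolding directed_on_def by blast
    hence "?G c \<le> inf (?G a) (?G b)" by (simp only: inf_principal principal_le_iff)
    thus ?thesis using c(1) by blast
  qed
  moreover have "\<Lambda> \<noteq> {}" using assms by (simp add: directed_on_def)
  ultimately have "eventually P (net_filter \<Lambda> le) \<longleftrightarrow> (\<exists>a\<in>\<Lambda>. eventually P (?G a))"
    unfolding net_filter_def by (rule eventually_INF_base[rotated])
  thus ?thesis unfolding eventually_principal by blast
qed

definition net_cluster_point ::
  "'x topology \<Rightarrow> 'i set \<Rightarrow> ('i \<Rightarrow> 'i \<Rightarrow> bool) \<Rightarrow> ('i \<Rightarrow> 'x) \<Rightarrow> 'x \<Rightarrow> bool" where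
  "net_cluster_point T \<Lambda> le x p \<longleftrightarrow> p \<in> topspace T \<and>
     (\<forall>U. openin T U \<and> p \<in> U \<longrightarrow> (\<forall>a\<in>\<Lambda>. \<exists>b\<in>\<Lambda>. le a b \<and> x b \<in> U))"

definition subnet_map ::
  "'j set \<Rightarrow> ('j \<Rightarrow> 'j \<Rightarrow> bool) \<Rightarrow> 'i set \<Rightarrow> ('i \<Rightarrow> 'i \<Rightarrow> bool) \<Rightarrow> ('j \<Rightarrow> 'i) \<Rightarrow> bool" where
  "subnet_map M leM \<Lambda> le h \<longleftrightarrow> directed_on M leM \<and> h ` M \<subseteq> \<Lambda> \<and>
     (\<forall>a\<in>\<Lambda>. \<exists>i\<in>M. \<forall>j\<in>M. leM i j \<longrightarrow> le a (h j))"

text \<open>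
  A definition cannot quantify over the index type of a subnet. Index sets in the type
  \<open>'i \<times> 'i set\<close> suffice: for a subnet \<open>h : M \<rightarrow> \<Lambda>\<close> on any index type, let \<open>G\<close> be the filter on
  \<open>\<Lambda>\<close> generated by the images under \<open>h\<close> of the tails of \<open>M\<close>. Then \<open>{(i, B). i \<in> B \<and> B \<in> G}\<close>,
  ordered by reverse inclusion of the second components, with \<open>(i, B) \<mapsto> i\<close>, is a subnet
  with the same cluster points.
\<close>

definition net_clusters ::
  "'x topology \<Rightarrow> 'i set \<Rightarrow> ('i \<Rightarrow> 'i \<Rightarrow> bool) \<Rightarrow> ('i \<Rightarrow> 'x) \<Rightarrow> bool" where
  "net_clusters T \<Lambda> le x \<longleftrightarrow>
     (\<forall>(M :: ('i \<times> 'i set) set) leM h. subnet_map M leM \<Lambda> le h \<longrightarrow>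
        (\<exists>p. net_cluster_point T M leM (x \<circ> h) p))"


section \<open>Average schemes\<close>

definition fix_space :: "('x::ab_group_add \<Rightarrow> 'x) set \<Rightarrow> 'x set" where
  "fix_space \<S> = (\<Inter>S\<in>\<S>. {x. x - S x = 0})"

definition rg_diff :: "('x::ab_group_add \<Rightarrow> 'x) set \<Rightarrow> 'x set" where
  "rg_diff \<S> = {x - S x | x S. S \<in> \<S>}"

locale average_scheme =
  fixes \<S> :: "(('a::topological_space \<Rightarrow>\<^sub>C complex) \<Rightarrow> ('a \<Rightarrow>\<^sub>C complex)) set"
    and \<Lambda> :: "'i set" and le :: "'i \<Rightarrow> 'i \<Rightarrow> bool"
    and A :: "'i \<Rightarrow> ('a \<Rightarrow>\<^sub>C complex) \<Rightarrow> ('a \<Rightarrow>\<^sub>C complex)"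
  assumes S_operators: "\<S> \<subseteq> sigma_operators"
    and S_id: "id \<in> \<S>"
    and S_comp: "\<And>S T. S \<in> \<S> \<Longrightarrow> T \<in> \<S> \<Longrightarrow> S \<circ> T \<in> \<S>"
    and directed: "directed_on \<Lambda> le"
    and A_operators: "A ` \<Lambda> \<subseteq> sigma_operators"
    and AS1: "\<exists>M>0. \<forall>a\<in>\<Lambda>. \<forall>f. norm (A a f) \<le> M * norm f"
    and AS2: "\<And>a f. a \<in> \<Lambda> \<Longrightarrow> A a f \<in> sigma_fun closure_of (convex hull ((\<lambda>S. S f) ` \<S>))"
    and AS2': "\<And>a m. a \<in> \<Lambda> \<Longrightarrow> sigma_adjoint (A a) m
                 \<in> sigma_meas closure_of (convex hull ((\<lambda>S. sigma_adjoint S m) ` \<S>))"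
    and AS3_right: "\<And>S f. S \<in> \<S> \<Longrightarrow> ((\<lambda>a. A a (S f - f)) \<longlongrightarrow> 0) (net_filter \<Lambda> le)"
    and AS3_left: "\<And>S f. S \<in> \<S> \<Longrightarrow> ((\<lambda>a. S (A a f) - A a f) \<longlongrightarrow> 0) (net_filter \<Lambda> le)"
    and AS3'_right: "\<And>S m. S \<in> \<S> \<Longrightarrow>
      ((\<lambda>a. sigma_adjoint (A a) (sigma_adjoint S m - m)) \<longlongrightarrow> 0) (net_filter \<Lambda> le)"
    and AS3'_left: "\<And>S m. S \<in> \<S> \<Longrightarrow>
      ((\<lambda>a. sigma_adjoint S (sigma_adjoint (A a) m) - sigma_adjoint (A a) m) \<longlongrightarrow> 0) (net_filter \<Lambda> le)"

definition positive_operator ::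
  "(('a::topological_space \<Rightarrow>\<^sub>C complex) \<Rightarrow> ('a \<Rightarrow>\<^sub>C complex)) \<Rightarrow> bool" where
  "positive_operator S \<longleftrightarrow>
     (\<forall>f. (\<forall>x. apply_bcontfun f x \<in> \<real>\<^sub>\<ge>\<^sub>0) \<longrightarrow> (\<forall>x. apply_bcontfun (S f) x \<in> \<real>\<^sub>\<ge>\<^sub>0))"

locale markovian_average_scheme = average_scheme +
  assumes positive: "\<And>S. S \<in> \<S> \<Longrightarrow> positive_operator S"
    and unital: "\<And>S. S \<in> \<S> \<Longrightarrow> S (const_bcontfun 1) = const_bcontfun 1"

text \<open>
  The semigroup does not occur: weak ergodicity and the ergodic projection of an average scheme
  depend only on the net.
\<close>

definition weakly_ergodic ::
  "'i set \<Rightarrow> ('i \<Rightarrow> 'i \<Rightarrow> bool) \<Rightarrow>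
   ('i \<Rightarrow> ('a::topological_space \<Rightarrow>\<^sub>C complex) \<Rightarrow> ('a \<Rightarrow>\<^sub>C complex)) \<Rightarrow> bool" where
  "weakly_ergodic \<Lambda> le A \<longleftrightarrow>
     (\<forall>f. \<exists>g. limitin sigma_fun (\<lambda>a. A a f) g (net_filter \<Lambda> le)) \<and>
     (\<forall>m. \<exists>n. limitin sigma_meas (\<lambda>a. sigma_adjoint (A a) m) n (net_filter \<Lambda> le))"

definition ergodic_projection ::
  "'i set \<Rightarrow> ('i \<Rightarrow> 'i \<Rightarrow> bool) \<Rightarrow>
   ('i \<Rightarrow> ('a::topological_space \<Rightarrow>\<^sub>C complex) \<Rightarrow> ('a \<Rightarrow>\<^sub>C complex)) \<Rightarrow>
   ('a \<Rightarrow>\<^sub>C complex) \<Rightarrow> ('a \<Rightarrow>\<^sub>C complex)" where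
  "ergodic_projection \<Lambda> le A f = (THE g. limitin sigma_fun (\<lambda>a. A a f) g (net_filter \<Lambda> le))"

definition separates_fix ::
  "(('a::topological_space \<Rightarrow>\<^sub>C complex) \<Rightarrow> ('a \<Rightarrow>\<^sub>C complex)) set \<Rightarrow> bool" where
  "separates_fix \<S> \<longleftrightarrow> (\<forall>f\<in>fix_space \<S>. f \<noteq> 0 \<longrightarrow>
     (\<exists>m\<in>fix_space (sigma_adjoint ` \<S>). pairing f m \<noteq> 0))"

definition is_direct_sum :: "'x::ab_group_add set \<Rightarrow> 'x set \<Rightarrow> bool" where
  "is_direct_sum U V \<longleftrightarrow> (\<forall>x. \<exists>u\<in>U. \<exists>v\<in>V. x = u + v) \<and> U \<inter> V = {0}"

end

theory Submission
  imports Defs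
begin

text \<open>
  The heart of the proof is that fixed measures separating fixed functions force convergence. For
  Lipschitz \<open>f\<close> every cluster point of \<open>A\<^sub>\<alpha> f\<close> is a fixed function with prescribed pairings against
  all fixed measures, so there is only one and \<open>A\<^sub>\<alpha> f\<close> converges strictly. For a positive
  measure \<open>m\<close>, testing \<open>A'\<^sub>\<alpha> m\<close> along the cofinal sequence against Lipschitz functions gives a
  weakly Cauchy sequence of positive measures, and on a Polish space such a sequence has a limit
  measure. Squeezing a bounded continuous function between monotone sequences of Lipschitz
  functions then transfers the convergence to all of \<open>C\<^sub>b\<close>, uniformly on compact sets by Dini's
  argument.

  The limit measure is obtained without the Riesz or Prokhorov theorems. A Baire category argument in
  the compact space of Lipschitz functions with values in \<open>[0, 1]\<close>, under pointwise convergence,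
  shows that the sequence is uniformly concentrated near finite sets. Along a subsequence the masses
  of a countable tree of nested cells converge, their limits are realised as lengths of nested intervals,
  and the limit measure is an image of Lebesgue measure on the largest of them.
\<close>

section \<open>Uniform total boundedness of Lipschitz-convergent measures\<close>

text \<open>The obstacle is that clustering is known only for Lipschitz functions, which are in
  general not norm dense in the bounded continuous ones, so convergence cannot be extended by
  approximation in norm. Monotone approximation replaces density, but a monotone limit of continuous
  functions need not be continuous. It is continuous once the limits from below and from above
  agree, and this agreement is dominated convergence against a limit measure of
  \<open>sigma_adjoint (A a) (dirac x)\<close>; hence the need for that measure. The cofinal
  sequence enters because Baire's theorem and dominated convergence are countable statements. It
  only identifies limits: convergence along the whole net comes from the Lipschitz functions and the
  squeezing. Functions with a common bound and a common Lipschitz constant suit Baire's theorem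
  because pointwise convergence makes them a compact space on which integration against each single
  finite measure is still continuous.\<close>

lemma integrable_bounded_borel:
  fixes f :: "'a::topological_space \<Rightarrow> 'b::{banach,second_countable_topology}"
  assumes "finite_measure M" "sets M = sets borel" "f \<in> borel_measurable borel" "\<And>x. norm (f x) \<le> B"
  shows "integrable M f"
proof -
  have "f \<in> borel_measurable M"
    using assms(2,3) by (simp cong: measurable_cong_sets)
  thus ?thesis
    using assms(4) by (intro finite_measure.integrable_const_bound[OF assms(1), of _ B]) auto
qed

lemma lipschitz_borel_measurable:
  fixes u :: "'a::metric_space \<Rightarrow> real"
  shows "L-lipschitz_on UNIV u \<Longrightarrow> u \<in> borel_measurable borel"
  by (intro borel_measurable_continuous_onI lipschitz_on_continuous_on)

lemma infdist_finite_attained: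
  fixes F :: "'a::metric_space set"
  assumes "finite F" "F \<noteq> {}"
  obtains p where "p \<in> F" "infdist y F = dist y p"
proof -
  define p where "p = arg_min_on (dist y) F"
  have p: "p \<in> F" "\<And>q. q \<in> F \<Longrightarrow> dist y p \<le> dist y q"
    using arg_min_if_finite[OF assms, of "dist y"] by (auto simp: p_def not_less[symmetric])
  have "infdist y F = dist y p"
    using assms(2) p infdist_le[OF p(1), of y]
    by (intro antisym) (auto simp: infdist_notempty intro!: cINF_greatest)
  thus ?thesis using that p(1) by blast
qed

text \<open>By Baire, all late integrals agree up to \<epsilon>/8 on some nonempty open set of
  functions. Such a set restricts only finitely many values, so it contains two functions that
  differ by 1 away from a finite set, and their difference bounds the mass there for every late
  measure by means of one fixed measure.\<close>

lemma uniform_total_boundedness: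
  fixes \<mu> :: "nat \<Rightarrow> 'a::metric_space measure" and x :: "nat \<Rightarrow> 'a"
  assumes dense: "\<And>y e. e > 0 \<Longrightarrow> \<exists>i. dist (x i) y < e"
    and fin: "\<And>n. finite_measure (\<mu> n)" and sets: "\<And>n. sets (\<mu> n) = sets borel"
    and conv: "\<And>u L. L-lipschitz_on UNIV u \<Longrightarrow> bounded (range u) \<Longrightarrow>
       convergent (\<lambda>n. \<integral>y. u y \<partial>\<mu> n :: real)"
    and "\<epsilon> > 0" "\<delta> > 0"
  shows "\<exists>N. \<forall>n. measure (\<mu> n) {y. \<forall>i<N. dist (x i) y \<ge> \<delta>} \<le> \<epsilon>"
proof -
  \<comment> \<open>Half of \<open>\<delta>\<close> is the distance from the finite set
    \<open>G\<close> below; the other half pays for replacing the points of \<open>G\<close> by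
    nearby points \<open>x i\<close>.\<close>
  define r where "r = \<delta> / 2"
  have r: "r > 0" using \<open>\<delta> > 0\<close> by (simp add: r_def)
  define h where "h F y = min 1 (infdist y F / r)" for F and y :: 'a
  define I where "I n u = (\<integral>y. u y \<partial>\<mu> n :: real)" for n and u :: "'a \<Rightarrow> real"
  define Q :: "('a \<Rightarrow> real) set" where
    "Q = {u. (\<forall>y. 0 \<le> u y \<and> u y \<le> 1) \<and> (\<forall>y z. u y - u z \<le> dist y z / r)}"
  have hle: "0 \<le> h F y" "h F y \<le> 1" for F y
    using r by (auto simp: h_def infdist_nonneg)
  have hF: "h F y = 0" if "y \<in> F" for F y
    using that by (simp add: h_def)
  have hmono: "h G y \<le> h F y" if "F \<subseteq> G" "F \<noteq> {}" for F G y
    using infdist_mono[OF that, of y] r by (auto simp: h_def divide_right_mono min.coboundedI2 min_le_iff_disj)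
  have hQ: "h F \<in> Q" for F
  proof -
    have "h F y - h F z \<le> dist y z / r" for y z
    proof -
      have "infdist y F \<le> infdist z F + dist y z" by (rule infdist_triangle)
      hence "infdist y F / r \<le> infdist z F / r + dist y z / r"
        using r by (simp add: add_divide_distrib[symmetric] divide_right_mono)
      moreover have "0 \<le> dist y z / r" using r by simp
      ultimately show ?thesis by (auto simp: h_def min_def)
    qed
    thus ?thesis using hle by (simp add: Q_def)
  qed
  have Q01: "0 \<le> u y" "u y \<le> 1" if "u \<in> Q" for u y
    using that by (auto simp: Q_def)
  have QL: "u y - u z \<le> dist y z / r" if "u \<in> Q" for u y z
    using that by (auto simp: Q_def)
  have Qlip: "(1/r)-lipschitz_on UNIV u" if "u \<in> Q" for u
  proof (rule lipschitz_onI)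
    fix y z show "dist (u y) (u z) \<le> 1 / r * dist y z"
      using QL[OF that, of y z] QL[OF that, of z y] by (simp add: dist_real_def abs_le_iff dist_commute)
  qed (use r in simp)
  have Qbd: "bounded (range u)" if "u \<in> Q" for u
    using Q01[OF that] by (intro boundedI[of _ 1]) auto
  have Qint: "integrable (\<mu> n) u" if "u \<in> Q" for u n
    using Q01[OF that]
    by (intro integrable_bounded_borel[OF fin sets lipschitz_borel_measurable[OF Qlip[OF that]], of 1]) auto
  have h0: "(\<lambda>M. I n (h (x ` {..M}))) \<longlonglongrightarrow> 0" for n
  proof -
    have "(\<lambda>M. h (x ` {..M}) y) \<longlonglongrightarrow> 0" for y
    proof (rule LIMSEQ_I)
      fix e :: real assume e: "e > 0"
      then obtain i where i: "dist (x i) y < e * r" using dense[of "e * r" y] r by auto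
      have "norm (h (x ` {..M}) y - 0) < e" if "M \<ge> i" for M
      proof -
        have "infdist y (x ` {..M}) \<le> dist y (x i)"
          using that by (intro infdist_le) auto
        hence "infdist y (x ` {..M}) < e * r" using i by (simp add: dist_commute)
        hence "infdist y (x ` {..M}) / r < e" using r by (simp add: field_simps)
        thus ?thesis using hle(1)[of "x ` {..M}" y] by (auto simp: h_def)
      qed
      thus "\<exists>no. \<forall>n\<ge>no. norm (h (x ` {..n}) y - 0) < e" by blast
    qed
    moreover have "integrable (\<mu> n) (\<lambda>_. 1 :: real)"
      using fin[of n] by (simp add: finite_measure.integrable_const)
    ultimately have "(\<lambda>M. I n (h (x ` {..M}))) \<longlonglongrightarrow> (\<integral>y. 0 \<partial>\<mu> n)"
      unfolding I_def using hle Qint[OF hQ]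
      by (intro integral_dominated_convergence[where w = "\<lambda>_. 1"]) (auto dest: borel_measurable_integrable)
    thus ?thesis by simp
  qed
  have Imono: "I n u \<le> I n v" if "integrable (\<mu> n) u" "integrable (\<mu> n) v" "\<And>y. u y \<le> v y" for n u v
    unfolding I_def using that by (intro integral_mono) auto

  \<comment> \<open>\<open>Q\<close> carries the topology of pointwise convergence. Its members
    share the Lipschitz constant \<open>1 / r\<close>, so closeness on a finite set \<open>F\<close>
    extends to all points up to the error \<open>2 * h F\<close>, whose integral is small for a
    suitable \<open>F\<close>.\<close>
  have contI: "continuous_on Q (I n)" for n
    unfolding continuous_on_topological
  proof (intro ballI allI impI)
    fix u B assume u: "u \<in> Q" and B: "open B" "I n u \<in> B"
    then obtain e where e: "e > 0" "\<And>z. dist z (I n u) < e \<Longrightarrow> z \<in> B"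
      by (auto simp: open_dist)
    define m where "m = measure (\<mu> n) (space (\<mu> n))"
    have m: "m \<ge> 0" by (simp add: m_def)
    define e' where "e' = e / (2 * (m + 1))"
    have e': "e' > 0" using e m by (simp add: e'_def)
    have e'm: "e' * m < e / 2" using e m by (simp add: e'_def field_simps)
    have "\<forall>\<^sub>F M in sequentially. I n (h (x ` {..M})) < e / 4"
      using order_tendstoD(2)[OF h0[of n], of "e / 4"] e by simp
    then obtain M where M: "I n (h (x ` {..M})) < e / 4"
      by (auto simp: eventually_sequentially)
    define F where "F = x ` {..M}"
    define U where "U = (\<Inter>i\<in>F. {v :: 'a \<Rightarrow> real. dist (v i) (u i) < e'})"
    have "open U" unfolding U_def F_def
      by (intro open_INT ballI open_Collect_less continuous_intros) auto
    moreover have "u \<in> U" using e' by (simp add: U_def)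
    moreover have "I n v \<in> B" if v: "v \<in> Q" "v \<in> U" for v
    proof -
      have F: "finite F" "F \<noteq> {}" by (auto simp: F_def)
      have le: "\<bar>v y - u y\<bar> \<le> e' + 2 * h F y" for y
      proof -
        obtain i where i: "i \<in> F" "infdist y F = dist y i"
          using infdist_finite_attained[OF F, of y] by blast
        have "\<bar>v i - u i\<bar> < e'" using v(2) i(1) by (auto simp: U_def dist_real_def)
        moreover have "\<bar>v y - v i\<bar> \<le> dist y i / r" "\<bar>u y - u i\<bar> \<le> dist y i / r"
          using QL[OF v(1), of y i] QL[OF v(1), of i y] QL[OF u, of y i] QL[OF u, of i y]
          by (simp_all add: abs_le_iff dist_commute)
        moreover have "\<bar>v y - u y\<bar> \<le> 1"
          using Q01[OF v(1), of y] Q01[OF u, of y] by auto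
        ultimately show ?thesis using e' i(2) by (auto simp: h_def min_def)
      qed
      have "\<bar>I n v - I n u\<bar> \<le> (\<integral>y. \<bar>v y - u y\<bar> \<partial>\<mu> n)"
        unfolding I_def Bochner_Integration.integral_diff[OF Qint[OF v(1)] Qint[OF u], symmetric]
        by (rule integral_abs_bound)
      also have "\<dots> \<le> (\<integral>y. e' + 2 * h F y \<partial>\<mu> n)"
        using le Qint[OF v(1)] Qint[OF u] Qint[OF hQ] fin[of n]
        by (intro integral_mono) (auto simp: finite_measure.integrable_const)
      also have "\<dots> = e' * m + 2 * I n (h F)"
        using Qint[OF hQ] fin[of n] by (simp add: m_def I_def finite_measure.integrable_const mult.commute)
      also have "\<dots> < e" using M e'm by (simp add: F_def)
      finally show "I n v \<in> B" by (intro e(2)) (simp add: dist_real_def)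
    qed
    ultimately show "\<exists>A. open A \<and> u \<in> A \<and> (\<forall>y\<in>Q. y \<in> A \<longrightarrow> I n y \<in> B)" by blast
  qed

  define X where "X = top_of_set Q"
  have "compact Q"
  proof -
    have "compact (PiE UNIV (\<lambda>_::'a. {0..1::real}))"
      unfolding compactin_euclidean_iff[symmetric] euclidean_product_topology[symmetric] compactin_PiE by simp
    \<comment> \<open>The Lipschitz condition survives pointwise limits, so \<open>Q\<close> is a
      closed part of a Tychonoff cube.\<close>
    moreover have "Q = PiE UNIV (\<lambda>_. {0..1}) \<inter> (\<Inter>y. \<Inter>z. {u. u y - u z \<le> dist y z / r})"
      by (auto simp: Q_def PiE_def extensional_def)
    moreover have "closed (\<Inter>y. \<Inter>z. {u :: 'a \<Rightarrow> real. u y - u z \<le> dist y z / r})"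
      by (intro closed_INT ballI closed_Collect_le continuous_intros) auto
    ultimately show ?thesis by (simp only: compact_Int_closed)
  qed
  hence cX: "compact_space X" by (simp add: X_def compact_space_subtopology)
  have "Hausdorff_space X" unfolding X_def
    by (intro Hausdorff_space_subtopology) (simp only: euclidean_product_topology[symmetric] Hausdorff_space_product_topology, simp)
  hence lX: "locally_compact_space X \<and> regular_space X"
    using cX compact_imp_locally_compact_space compact_Hausdorff_imp_regular_space by blast
  define B where "B N = {u\<in>Q. \<forall>m\<ge>N. \<forall>n\<ge>N. \<bar>I m u - I n u\<bar> \<le> \<epsilon> / 8}" for N
  have clB: "closedin X (B N)" for N
  proof -
    have *: "B N = (\<Inter>m\<in>{N..}. \<Inter>n\<in>{N..}. Q \<inter> (\<lambda>u. \<bar>I m u - I n u\<bar>) -` {..\<epsilon> / 8})"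
      by (auto simp: B_def)
    have "closedin X (Q \<inter> (\<lambda>u. \<bar>I m u - I n u\<bar>) -` {..\<epsilon> / 8})" for m n
      unfolding X_def
      by (rule continuous_closedin_preimage[OF _ closed_atMost]) (intro continuous_intros contI)
    thus ?thesis unfolding * by (intro closedin_INT) auto
  qed
  have UB: "(\<Union>N. B N) = Q"
  proof
    show "Q \<subseteq> (\<Union>N. B N)"
    proof
      fix u assume u: "u \<in> Q"
      have "convergent (\<lambda>n. I n u)" unfolding I_def using Qlip[OF u] Qbd[OF u] by (rule conv)
      hence "Cauchy (\<lambda>n. I n u)" by (rule convergent_Cauchy)
      then obtain N where "\<forall>m\<ge>N. \<forall>n\<ge>N. dist (I m u) (I n u) < \<epsilon> / 8"
        using \<open>\<epsilon> > 0\<close> unfolding Cauchy_def by (meson divide_pos_pos zero_less_numeral)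
      hence "u \<in> B N" using u by (auto simp: B_def dist_real_def intro: less_imp_le)
      thus "u \<in> (\<Union>N. B N)" by blast
    qed
  qed (auto simp: B_def)
  have "\<exists>N. X interior_of B N \<noteq> {}"
  proof (rule ccontr)
    assume "\<not> ?thesis"
    hence "X interior_of (\<Union>(range B)) = {}"
      using clB lX by (intro Baire_category_alt) auto
    moreover have "X interior_of (\<Union>(range B)) = Q"
      using UB interior_of_topspace[of X] by (simp add: X_def)
    ultimately show False using hQ by blast
  qed
  then obtain N u0 where "u0 \<in> X interior_of B N" by blast
  then obtain T where T: "openin X T" "u0 \<in> T" "T \<subseteq> B N" by (auto simp: interior_of_def)
  then obtain T' where T': "open T'" "T = Q \<inter> T'" by (auto simp: X_def openin_open)
  have u0: "u0 \<in> Q" "u0 \<in> T'" using T T' by auto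
  have "openin (product_topology (\<lambda>_. euclidean) UNIV) T'"
    using T'(1) by (simp add: euclidean_product_topology)
  then obtain V where V: "finite {i. V i \<noteq> (UNIV :: real set)}" "u0 \<in> PiE UNIV V" "PiE UNIV V \<subseteq> T'"
    using u0(2) unfolding openin_product_topology_alt by auto
  define F where "F = {i. V i \<noteq> UNIV}"
  have inB: "v \<in> B N" if "v \<in> Q" "\<And>i. i \<in> F \<Longrightarrow> v i = u0 i" for v
  proof -
    have "v \<in> PiE UNIV V" using V(2) that(2) by (auto simp: F_def PiE_def Pi_def) (metis UNIV_I)
    thus ?thesis using V(3) T(3) T'(2) that(1) by blast
  qed
  have "\<forall>\<^sub>F M in sequentially. \<forall>n\<in>{..N}. I n (h (x ` {..M})) < \<epsilon> / 4"
    using \<open>\<epsilon> > 0\<close> h0 by (intro eventually_ball_finite ballI order_tendstoD(2)) auto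
  then obtain M where M: "\<And>n. n \<le> N \<Longrightarrow> I n (h (x ` {..M})) < \<epsilon> / 4"
    by (auto simp: eventually_sequentially)
  \<comment> \<open>Agreement with \<open>u0\<close> on \<open>F\<close> will keep functions inside
    \<open>B N\<close>. The added points make the integral of \<open>h G\<close> small for the
    finitely many n \<le> N, among them \<open>N\<close> itself, with which all later measures are
    compared.\<close>
  define G where "G = F \<union> x ` {..M}"
  have G: "finite G" "G \<noteq> {}" using V(1) by (auto simp: G_def F_def)
  have MG: "I n (h G) < \<epsilon> / 4" if "n \<le> N" for n
  proof -
    have "I n (h G) \<le> I n (h (x ` {..M}))"
      by (intro Imono Qint hQ hmono) (auto simp: G_def)
    thus ?thesis using M[OF that] by simp
  qed
  \<comment> \<open>\<open>g1\<close> and \<open>g2\<close> agree with \<open>u0\<close> on \<open>F\<close>, hence lie in \<open>B N\<close>, but differ by 1 at distance \<open>r\<close> from \<open>G\<close>.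
    So \<open>\<mu> n\<close> and \<open>\<mu> N\<close> almost agree on a function bounding the mass far from \<open>G\<close>.\<close>
  define g1 where "g1 y = max (u0 y) (h G y)" for y
  define g2 where "g2 y = min (u0 y) (1 - h G y)" for y
  have g1: "g1 \<in> Q"
  proof -
    have "g1 y - g1 z \<le> dist y z / r" for y z
      using QL[OF u0(1), of y z] QL[OF hQ[of G], of y z] by (auto simp: g1_def max_def)
    thus ?thesis using Q01[OF u0(1)] hle[of G] by (auto simp: Q_def g1_def max_def)
  qed
  have g2: "g2 \<in> Q"
  proof -
    have "g2 y - g2 z \<le> dist y z / r" for y z
      using QL[OF u0(1), of y z] QL[OF hQ[of G], of z y] by (auto simp: g2_def min_def dist_commute)
    thus ?thesis using Q01[OF u0(1)] hle[of G] by (auto simp: Q_def g2_def min_le_iff_disj)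
  qed
  have gF: "g1 i = u0 i" "g2 i = u0 i" if "i \<in> F" for i
    using that Q01[OF u0(1), of i] hF[of i G] by (auto simp: g1_def g2_def G_def)
  have gB: "g1 \<in> B N" "g2 \<in> B N" using inB g1 g2 gF by auto
  have g12: "g1 y - g2 y \<le> 2 * h G y" for y
    using Q01[OF u0(1), of y] hle[of G y] by (auto simp: g1_def g2_def)
  have g0: "0 \<le> g1 y - g2 y" for y
    by (auto simp: g1_def g2_def)
  have gt: "g1 y - g2 y = 1" if "h G y = 1" for y
    using that Q01[OF u0(1), of y] by (auto simp: g1_def g2_def)
  have Id: "I n (\<lambda>y. g1 y - g2 y) = I n g1 - I n g2" for n
    unfolding I_def by (intro Bochner_Integration.integral_diff Qint g1 g2)
  have *: "measure (\<mu> n) {y. h G y = 1} \<le> I n w"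
    if "integrable (\<mu> n) w" "\<And>y. 0 \<le> w y" "\<And>y. h G y = 1 \<Longrightarrow> w y \<ge> 1" for n w
  proof -
    have hm: "h G \<in> borel_measurable borel" by (rule lipschitz_borel_measurable[OF Qlip[OF hQ]])
    have A: "{y. h G y = 1} \<in> sets (\<mu> n)"
      using measurable_sets[OF hm, of "{1}"] by (simp add: sets vimage_def)
    have sp: "space (\<mu> n) = UNIV" using sets_eq_imp_space_eq[OF sets[of n]] by simp
    have "measure (\<mu> n) {y. h G y = 1} = (\<integral>y. indicator {y. h G y = 1} y \<partial>\<mu> n)"
      using A by (simp add: sp)
    also have "\<dots> \<le> I n w" unfolding I_def using that A fin[of n]
      by (intro integral_mono integrable_real_indicator)
         (auto simp: indicator_def finite_measure.emeasure_finite top.not_eq_extremum[symmetric])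
    finally show ?thesis .
  qed
  have final: "measure (\<mu> n) {y. h G y = 1} \<le> \<epsilon>" for n
  proof (cases "n \<le> N")
    case True
    have "measure (\<mu> n) {y. h G y = 1} \<le> I n (h G)"
      using hle by (intro * Qint hQ) auto
    thus ?thesis using MG[OF True] \<open>\<epsilon> > 0\<close> by simp
  next
    case False
    have "measure (\<mu> n) {y. h G y = 1} \<le> I n (\<lambda>y. g1 y - g2 y)"
      using g0 gt Qint[OF g1] Qint[OF g2] by (intro *) auto
    \<comment> \<open>Two deviations of \<epsilon>/8; with \<open>I N (h G) < \<epsilon> / 4\<close>
      the total stays below 3\<epsilon>/4.\<close>
    also have "\<dots> \<le> I N (\<lambda>y. g1 y - g2 y) + \<epsilon> / 4"
      
    proof -
      have "\<bar>I n g1 - I N g1\<bar> \<le> \<epsilon> / 8" "\<bar>I n g2 - I N g2\<bar> \<le> \<epsilon> / 8"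
        using gB False by (auto simp: B_def)
      thus ?thesis unfolding Id by linarith
    qed
    also have "I N (\<lambda>y. g1 y - g2 y) \<le> I N (\<lambda>y. 2 * h G y)"
      using g12 Qint[OF g1] Qint[OF g2] Qint[OF hQ] by (intro Imono) auto
    also have "\<dots> = 2 * I N (h G)" by (simp add: I_def)
    finally show ?thesis using MG[of N] \<open>\<epsilon> > 0\<close> by simp
  qed
  obtain k where k: "\<And>p. p \<in> G \<Longrightarrow> dist (x (k p)) p < r"
    using dense[OF r] by metis
  have sub: "{y. \<forall>i<Suc (Max (k ` G)). dist (x i) y \<ge> \<delta>} \<subseteq> {y. h G y = 1}"
  proof
    fix y assume y: "y \<in> {y. \<forall>i<Suc (Max (k ` G)). dist (x i) y \<ge> \<delta>}"
    obtain p where p: "p \<in> G" "infdist y G = dist y p"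
      using infdist_finite_attained[OF G, of y] by blast
    have "k p < Suc (Max (k ` G))" using p(1) G(1) by (simp add: less_Suc_eq_le)
    hence "\<delta> \<le> dist (x (k p)) y" using y by blast
    also have "\<dots> \<le> dist (x (k p)) p + dist y p" by (metis dist_commute dist_triangle)
    finally have "r \<le> dist y p" using k[OF p(1)] by (simp add: r_def)
    thus "y \<in> {y. h G y = 1}" using p(2) r by (simp add: h_def)
  qed
  have "h G \<in> borel_measurable borel" by (rule lipschitz_borel_measurable[OF Qlip[OF hQ]])
  hence "{y. h G y = 1} \<in> sets (\<mu> n)" for n
    using measurable_sets[of "h G" borel borel "{1}"] by (simp add: sets vimage_def)
  hence "measure (\<mu> n) {y. \<forall>i<Suc (Max (k ` G)). dist (x i) y \<ge> \<delta>} \<le> \<epsilon>" for n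
    using finite_measure.finite_measure_mono[OF fin sub, of n] final[of n] by simp
  thus ?thesis by blast
qed


section \<open>Nested intervals and limit measures\<close>

text \<open>
  The mass tree \<open>m\<close> is indexed by finite sequences with the most recent entry first: the children of \<open>s\<close>
  are the \<open>j # s\<close>.
\<close>

fun left_end :: "(nat list \<Rightarrow> real) \<Rightarrow> nat list \<Rightarrow> real" where
  "left_end m [] = 0"
| "left_end m (j # s) = left_end m s + (\<Sum>i<j. m (i # s))"

definition mass_interval :: "(nat list \<Rightarrow> real) \<Rightarrow> nat list \<Rightarrow> real set" where
  "mass_interval m s = {left_end m s ..< left_end m s + m s}"

text \<open>The partial sums of the children's masses increase to the mass of \<open>s\<close>, so
  the half-open intervals of the children tile that of \<open>s\<close>. A child of mass 0 gets an
  empty interval.\<close>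

lemma mass_interval_split:
  assumes pos: "\<And>s. 0 \<le> m s" and sums: "\<And>s. (\<lambda>j. m (j # s)) sums m s"
  shows "t \<in> mass_interval m s \<longleftrightarrow> (\<exists>j. t \<in> mass_interval m (j # s))"
    and "t \<in> mass_interval m (i # s) \<Longrightarrow> t \<in> mass_interval m (j # s) \<Longrightarrow> i = j"
proof -
  let ?S = "\<lambda>j. \<Sum>i<j. m (i # s)"
  have S: "mass_interval m (j # s) = {left_end m s + ?S j ..< left_end m s + ?S (Suc j)}" for j
    by (simp add: mass_interval_def algebra_simps)
  have mono: "mono ?S" using pos by (intro incseq_SucI) simp
  have lim: "?S \<longlonglongrightarrow> m s" using sums[of s] by (simp add: sums_def)
  have Sle: "?S j \<le> m s" for j using incseq_le[OF mono lim] .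
  show "t \<in> mass_interval m s \<longleftrightarrow> (\<exists>j. t \<in> mass_interval m (j # s))"
  proof
    assume t: "t \<in> mass_interval m s"
    have "\<exists>j. t < left_end m s + ?S j"
    proof -
      have "\<forall>\<^sub>F j in sequentially. t - left_end m s < ?S j"
        using t by (intro order_tendstoD(1)[OF lim]) (auto simp: mass_interval_def)
      then obtain j where "t - left_end m s < ?S j" by (auto simp: eventually_sequentially)
      hence "t < left_end m s + ?S j" by simp
      thus ?thesis by blast
    qed
    then obtain j where j: "t < left_end m s + ?S j" "\<And>k. k < j \<Longrightarrow> \<not> t < left_end m s + ?S k"
      using exists_least_iff[of "\<lambda>j. t < left_end m s + ?S j"] by blast
    obtain k where k: "j = Suc k" using j(1) t by (cases j) (auto simp: mass_interval_def)
    have "t \<in> mass_interval m (k # s)" using j(1) j(2)[of k] unfolding S k by simp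
    thus "\<exists>j. t \<in> mass_interval m (j # s)" ..
  next
    assume "\<exists>j. t \<in> mass_interval m (j # s)"
    then obtain j where "t \<in> mass_interval m (j # s)" ..
    moreover have "0 \<le> ?S j" using pos by (simp add: sum_nonneg)
    ultimately show "t \<in> mass_interval m s"
      using Sle[of "Suc j"] unfolding S by (simp add: mass_interval_def)
  qed
  show "i = j" if "t \<in> mass_interval m (i # s)" "t \<in> mass_interval m (j # s)"
  proof -
    have False if "t \<in> mass_interval m (i # s)" "t \<in> mass_interval m (j # s)" "i < j" for i j
      using that monoD[OF mono, of "Suc i" j] unfolding S by simp
    thus ?thesis using that by (metis nat_neq_iff)
  qed
qed

text \<open>The symbolic expansion of \<open>t\<close> in the nested intervals. The choice is
  meaningful only for \<open>t\<close> in the root interval; elsewhere just the length is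
  known.\<close>

primrec address :: "(nat list \<Rightarrow> real) \<Rightarrow> real \<Rightarrow> nat \<Rightarrow> nat list" where
  "address m t 0 = []"
| "address m t (Suc k) = (SOME j. t \<in> mass_interval m (j # address m t k)) # address m t k"

lemma length_address [simp]: "length (address m t k) = k"
  by (induction k) auto

lemma
  assumes pos: "\<And>s. 0 \<le> m s" and sums: "\<And>s. (\<lambda>j. m (j # s)) sums m s"
    and t: "t \<in> mass_interval m []"
  shows in_mass_interval_address: "t \<in> mass_interval m (address m t k)"
    and address_eq_iff: "address m t (length s) = s \<longleftrightarrow> t \<in> mass_interval m s"
proof -
  note split = mass_interval_split[of m, OF pos sums]
  show in_ad: "t \<in> mass_interval m (address m t k)" for k
  proof (induction k)
    case (Suc k)
    hence "\<exists>j. t \<in> mass_interval m (j # address m t k)" using split(1) by blast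
    from someI_ex[OF this] show ?case by simp
  qed (use t in simp)
  show "address m t (length s) = s \<longleftrightarrow> t \<in> mass_interval m s"
  proof
    assume "address m t (length s) = s" thus "t \<in> mass_interval m s" using in_ad[of "length s"] by simp
  next
    show "t \<in> mass_interval m s \<Longrightarrow> address m t (length s) = s"
    proof (induction s)
      case (Cons j s)
      have "address m t (length s) = s" using Cons split(1) by blast
      moreover have "t \<in> mass_interval m (address m t (Suc (length s)))" by (rule in_ad)
      ultimately show ?case using split(2) Cons.prems by auto
    qed simp
  qed
qed

text \<open>A discrete form of Scheffe's lemma: convergence of the single atoms would still let mass
  escape through infinitely many values, and convergence of the total mass excludes this.\<close>

lemma tendsto_integral_countable_valued:
  fixes \<mu> :: "nat \<Rightarrow> 'b measure" and \<tau> :: "'d measure"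
    and W :: "'b \<Rightarrow> 'c::countable" and V :: "'d \<Rightarrow> 'c" and g :: "'c \<Rightarrow> real"
  assumes fin: "\<And>n. finite_measure (\<mu> n)" "finite_measure \<tau>"
    and W: "\<And>n. W \<in> measurable (\<mu> n) (count_space UNIV)" and V: "V \<in> measurable \<tau> (count_space UNIV)"
    and total: "(\<lambda>n. measure (\<mu> n) (space (\<mu> n))) \<longlonglongrightarrow> measure \<tau> (space \<tau>)"
    and atoms: "\<And>s. (\<lambda>n. measure (\<mu> n) {y\<in>space (\<mu> n). W y = s}) \<longlonglongrightarrow> measure \<tau> {t\<in>space \<tau>. V t = s}"
    and g: "\<And>s. \<bar>g s\<bar> \<le> B"
  shows "(\<lambda>n. \<integral>y. g (W y) \<partial>\<mu> n) \<longlonglongrightarrow> (\<integral>t. g (V t) \<partial>\<tau>)"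
proof (rule LIMSEQ_I)
  \<comment> \<open>Replacing the integral by a finite sum costs at most \<open>B\<close> times the
    mass outside \<open>F\<close>. The measure is arbitrary because the estimate serves both
    \<open>\<mu> n\<close> and \<open>\<tau>\<close>.\<close>
  have tail: "\<bar>(\<integral>y. g (U y) \<partial>M) - (\<Sum>s\<in>F. g s * measure M {y\<in>space M. U y = s})\<bar>
      \<le> B * (measure M (space M) - (\<Sum>s\<in>F. measure M {y\<in>space M. U y = s}))"
    if M: "finite_measure M" and U: "U \<in> measurable M (count_space UNIV)" and F: "finite F"
    for M :: "'x measure" and U :: "'x \<Rightarrow> 'c" and F
  proof -
    interpret finite_measure M by fact
    have A: "{y\<in>space M. U y \<in> S} \<in> sets M" for S
      using measurable_sets[OF U, of S] by (simp add: vimage_def Int_def conj_commute)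
    have A1: "{y\<in>space M. U y = s} \<in> sets M" for s using A[of "{s}"] by simp
    have int: "integrable M (\<lambda>y. f (U y))" if "\<And>s. \<bar>f s\<bar> \<le> D" for f :: "'c \<Rightarrow> real" and D
      using that measurable_compose[OF U, of f borel] by (intro integrable_const_bound[of _ D]) auto
    have sumF: "(\<Sum>s\<in>F. h s * measure M {y\<in>space M. U y = s}) = (\<integral>y. h (U y) * indicator F (U y) \<partial>M)"
      for h :: "'c \<Rightarrow> real"
    proof -
      have "(\<integral>y. h (U y) * indicator F (U y) \<partial>M) =
          (\<integral>y. (\<Sum>s\<in>F. h s * indicator {y\<in>space M. U y = s} y) \<partial>M)"
      proof (intro Bochner_Integration.integral_cong refl)
        fix y assume "y \<in> space M"
        hence "(\<Sum>s\<in>F. h s * indicator {y\<in>space M. U y = s} y) = (\<Sum>s\<in>F. if s = U y then h s else 0)"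
          by (intro sum.cong) (auto simp: indicator_def)
        thus "h (U y) * indicator F (U y) = (\<Sum>s\<in>F. h s * indicator {y\<in>space M. U y = s} y)"
          using F by (simp add: indicator_def)
      qed
      also have "\<dots> = (\<Sum>s\<in>F. h s * measure M {y\<in>space M. U y = s})"
        using A1 by (simp add: Bochner_Integration.integral_sum less_top[symmetric])
      finally show ?thesis ..
    qed
    have "B \<ge> 0" using g[of undefined] by linarith
    have bd: "\<bar>g s * indicator F s\<bar> \<le> B" for s using g[of s] \<open>B \<ge> 0\<close> by (auto simp: indicator_def)
    have "(\<integral>y. g (U y) \<partial>M) - (\<Sum>s\<in>F. g s * measure M {y\<in>space M. U y = s}) =
        (\<integral>y. g (U y) - g (U y) * indicator F (U y) \<partial>M)"
      unfolding sumF using int[of g B] g int[of "\<lambda>s. g s * indicator F s" B] bd by simp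
    also have "\<bar>\<dots>\<bar> \<le> (\<integral>y. \<bar>g (U y) - g (U y) * indicator F (U y)\<bar> \<partial>M)"
      by (rule integral_abs_bound)
    also have "\<dots> \<le> (\<integral>y. B - B * indicator F (U y) \<partial>M)"
      using g \<open>B \<ge> 0\<close> int[of "\<lambda>s. \<bar>g s - g s * indicator F s\<bar>" B] int[of "\<lambda>s. B - B * indicator F s" B]
      by (intro integral_mono) (auto simp: indicator_def)
    also have "\<dots> = B * (measure M (space M) - (\<integral>y. 1 * indicator F (U y) \<partial>M))"
      using int[of "\<lambda>s. indicator F s" 1] by (simp add: algebra_simps)
    also have "(\<integral>y. 1 * indicator F (U y) \<partial>M) = (\<Sum>s\<in>F. measure M {y\<in>space M. U y = s})"
      unfolding sumF[of "\<lambda>_. 1", symmetric] by simp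
    finally show ?thesis .
  qed
  fix e :: real assume e: "e > 0"
  have B: "B \<ge> 0" using g[of undefined] by linarith
  interpret \<tau>: finite_measure \<tau> by fact
  define q where "q s = measure \<tau> {t\<in>space \<tau>. V t = s}" for s
  define p where "p n s = measure (\<mu> n) {t\<in>space (\<mu> n). W t = s}" for n s
  define e' where "e' = e / (4 * (B + 1))"
  have e': "e' > 0" "B * e' \<le> e / 4" "B * (2 * e') \<le> e / 2" using e B by (auto simp: e'_def field_simps)
  \<comment> \<open>Finitely many values carry all of \<open>\<tau>\<close> but less than
    \<open>e'\<close>; by convergence of atoms and total mass the same then holds for every late
    \<open>\<mu> n\<close>.\<close>
  obtain F where F: "finite F" "measure \<tau> (space \<tau>) - (\<Sum>s\<in>F. q s) < e'"
  proof -
    define A where "A k = {t\<in>space \<tau>. to_nat (V t) = k}" for k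
    have AV: "A k \<in> sets \<tau>" for k
      using measurable_sets[OF V, of "{s. to_nat s = k}"] by (simp add: A_def vimage_def Int_def conj_commute)
    have "(\<lambda>k. measure \<tau> (A k)) sums measure \<tau> (\<Union>k. A k)"
      using AV by (intro \<tau>.finite_measure_UNION) (auto simp: disjoint_family_on_def A_def)
    moreover have "(\<Union>k. A k) = space \<tau>" by (auto simp: A_def)
    ultimately have "(\<lambda>K. \<Sum>k<K. measure \<tau> (A k)) \<longlonglongrightarrow> measure \<tau> (space \<tau>)" by (simp add: sums_def)
    hence "\<forall>\<^sub>F K in sequentially. measure \<tau> (space \<tau>) - e' < (\<Sum>k<K. measure \<tau> (A k))"
      using e' by (intro order_tendstoD(1)) auto
    then obtain K where K: "measure \<tau> (space \<tau>) - e' < (\<Sum>k<K. measure \<tau> (A k))"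
      by (auto simp: eventually_sequentially)
    define F where "F = {s :: 'c. to_nat s < K}"
    have fF: "finite F"
      using finite_vimageI[of "{..<K}" "to_nat :: 'c \<Rightarrow> nat"] by (simp add: F_def vimage_def)
    have "(\<Sum>k<K. measure \<tau> (A k)) = (\<Sum>k\<in>to_nat ` F. measure \<tau> (A k))"
    proof (rule sum.mono_neutral_right)
      show "\<forall>k\<in>{..<K} - to_nat ` F. measure \<tau> (A k) = 0"
      proof
        fix k assume "k \<in> {..<K} - to_nat ` F"
        hence "A k = {}" by (auto simp: A_def F_def)
        thus "measure \<tau> (A k) = 0" by simp
      qed
    qed (auto simp: F_def)
    also have "\<dots> = (\<Sum>s\<in>F. q s)"
      by (subst sum.reindex) (auto simp: A_def q_def inj_on_def)
    finally show ?thesis using that fF K by simp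
  qed
  have B1: "(\<lambda>n. (\<Sum>s\<in>F. g s * p n s) - (\<Sum>s\<in>F. g s * q s)) \<longlonglongrightarrow> 0"
    using atoms by (auto simp: p_def q_def intro!: tendsto_eq_intros)
  have B2: "(\<lambda>n. measure (\<mu> n) (space (\<mu> n)) - (\<Sum>s\<in>F. p n s)) \<longlonglongrightarrow> measure \<tau> (space \<tau>) - (\<Sum>s\<in>F. q s)"
    using atoms total by (auto simp: p_def q_def intro!: tendsto_intros)
  have "\<forall>\<^sub>F n in sequentially. \<bar>(\<Sum>s\<in>F. g s * p n s) - (\<Sum>s\<in>F. g s * q s)\<bar> < e / 4"
    using B1 e by (auto dest: tendstoD[where e = "e / 4"] simp: dist_real_def)
  moreover have "\<forall>\<^sub>F n in sequentially. measure (\<mu> n) (space (\<mu> n)) - (\<Sum>s\<in>F. p n s) < e'"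
    by (rule order_tendstoD(2)[OF B2 F(2)])
  ultimately have "\<forall>\<^sub>F n in sequentially. norm ((\<integral>y. g (W y) \<partial>\<mu> n) - (\<integral>t. g (V t) \<partial>\<tau>)) < e"
  proof eventually_elim
    case (elim n)
    have "\<bar>(\<integral>y. g (W y) \<partial>\<mu> n) - (\<Sum>s\<in>F. g s * p n s)\<bar>
        \<le> B * (measure (\<mu> n) (space (\<mu> n)) - (\<Sum>s\<in>F. p n s))"
      unfolding p_def by (rule tail[OF fin(1) W F(1)])
    also have "\<dots> \<le> B * e'" using elim(2) B by (intro mult_left_mono) auto
    finally have 1: "\<bar>(\<integral>y. g (W y) \<partial>\<mu> n) - (\<Sum>s\<in>F. g s * p n s)\<bar> \<le> B * e'" .
    have "\<bar>(\<integral>t. g (V t) \<partial>\<tau>) - (\<Sum>s\<in>F. g s * q s)\<bar>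
        \<le> B * (measure \<tau> (space \<tau>) - (\<Sum>s\<in>F. q s))"
      unfolding q_def by (rule tail[OF fin(2) V F(1)])
    also have "\<dots> \<le> B * e'" using F(2) B by (intro mult_left_mono) auto
    finally have 2: "\<bar>(\<integral>t. g (V t) \<partial>\<tau>) - (\<Sum>s\<in>F. g s * q s)\<bar> \<le> B * e'" .
    show ?case unfolding real_norm_def using 1 2 elim(1) e'(2) by linarith
  qed
  thus "\<exists>no. \<forall>n\<ge>no. norm ((\<integral>y. g (W y) \<partial>\<mu> n) - (\<integral>t. g (V t) \<partial>\<tau>)) < e"
    by (simp add: eventually_sequentially)
qed

section \<open>The limit measure on a Polish space\<close>

lemma mass_interval_subset:
  assumes pos: "\<And>s. 0 \<le> m s" and sums: "\<And>s. (\<lambda>j. m (j # s)) sums m s"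
  shows "mass_interval m s \<subseteq> mass_interval m []"
proof (induction s)
  case (Cons j s)
  thus ?case using mass_interval_split(1)[of m, OF pos sums] by blast
qed simp

lemma measurable_count_spaceI:
  fixes f :: "'a \<Rightarrow> 'c::countable"
  assumes "\<And>s. {t\<in>space M. f t = s} \<in> sets M"
  shows "f \<in> measurable M (count_space UNIV)"
  using assms by (subst measurable_count_space_eq2_countable) (auto simp: vimage_def Int_def conj_commute)

text \<open>The masses of cells converge only along a subsequence, but the integrals converge along
  the whole sequence by hypothesis, so a measure read off from the subsequence has the right
  integrals. Completeness of the metric turns addresses into points.\<close>

lemma lipschitz_limit_measure:
  fixes \<mu> :: "nat \<Rightarrow> 'a::polish_space measure"
  assumes fin: "\<And>n. finite_measure (\<mu> n)" and sets: "\<And>n. sets (\<mu> n) = sets borel"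
    and conv: "\<And>u L. L-lipschitz_on UNIV u \<Longrightarrow> bounded (range u) \<Longrightarrow>
       convergent (\<lambda>n. \<integral>y. u y \<partial>\<mu> n :: real)"
  obtains \<nu> where "finite_measure \<nu>" "sets \<nu> = sets borel"
    "\<And>u L. L-lipschitz_on UNIV u \<Longrightarrow> bounded (range u) \<Longrightarrow>
       (\<lambda>n. \<integral>y. u y \<partial>\<mu> n :: real) \<longlonglongrightarrow> (\<integral>y. u y \<partial>\<nu>)"
proof -
  obtain D :: "'a set" where D: "countable D" "\<And>U. open U \<Longrightarrow> U \<noteq> {} \<Longrightarrow> \<exists>d\<in>D. d \<in> U"
    using countable_dense_setE by blast
  define x where "x = from_nat_into D"
  have dense: "\<exists>i. dist (x i) y < e" if "e > 0" for y e
  proof -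
    obtain d where d: "d \<in> D" "d \<in> ball y e" using D(2)[of "ball y e"] \<open>e > 0\<close> by auto
    then obtain i where "x i = d" using from_nat_into_surj[OF D(1)] unfolding x_def by blast
    thus ?thesis using d(2) by (auto simp: dist_commute)
  qed
  have sp: "space (\<mu> n) = UNIV" for n using sets_eq_imp_space_eq[OF sets[of n]] by simp
  \<comment> \<open>Taking the first dense point within (1/2)^k makes the cells of one level
    disjoint Borel sets of diameter at most 2 (1/2)^k.\<close>
  define c where "c k y = (LEAST i. dist (x i) y < (1/2)^k)" for k :: nat and y
  have c1: "dist (x (c k y)) y < (1/2)^k" for k y
    unfolding c_def by (rule LeastI_ex) (simp add: dense)
  have c2: "\<not> dist (x i) y < (1/2)^k" if "i < c k y" for i k y
    using that unfolding c_def by (rule not_less_Least)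
  have c_iff: "c k y = i \<longleftrightarrow> dist (x i) y < (1/2)^k \<and> (\<forall>j<i. \<not> dist (x j) y < (1/2)^k)" for k y i
    using c1[of k y] c2[of _ k y] by (metis nat_neq_iff)
  have cm: "{y. c k y = i} \<in> sets borel" for k i
    unfolding c_iff by measurable
  \<comment> \<open>Most recent choice first, to match the indexing of the mass tree.\<close>
  define path where "path k y = rec_nat [] (\<lambda>i s. c i y # s) k" for k y
  have path [simp]: "path 0 y = []" "path (Suc k) y = c k y # path k y" for k y
    by (simp_all add: path_def)
  have len [simp]: "length (path k y) = k" for k y by (induction k) auto
  define cell where "cell s = {y. path (length s) y = s}" for s
  have cell_Nil [simp]: "cell [] = UNIV" by (simp add: cell_def)
  have cell_Cons: "cell (j # s) = cell s \<inter> {y. c (length s) y = j}" for j s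
    by (auto simp: cell_def)
  have cell_sets: "cell s \<in> sets borel" for s
    by (induction s) (use cm in \<open>auto simp: cell_Cons\<close>)
  have path_sets: "{y. path k y = s} \<in> sets borel" for k s
  proof (cases "length s = k")
    case True thus ?thesis using cell_sets[of s] by (simp add: cell_def)
  next
    case False
    hence "{y. path k y = s} = {}" by (metis (mono_tags, lifting) Collect_empty_eq len)
    thus ?thesis by simp
  qed
  define p where "p n s = measure (\<mu> n) (cell s)" for n s
  define T where "T n = measure (\<mu> n) UNIV" for n
  have T: "T n = (\<integral>y. 1 \<partial>\<mu> n)" for n by (simp add: T_def sp)
  have "0-lipschitz_on UNIV (\<lambda>_::'a. 1 :: real)" by (auto intro!: lipschitz_onI)
  hence "convergent T" unfolding T by (rule conv) simp
  then obtain C where C: "\<And>n. T n \<le> C"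
    by (metis BseqE convergent_imp_Bseq real_norm_def abs_ge_self order_trans)
  have p: "0 \<le> p n s" "p n s \<le> C" for n s
  proof -
    interpret finite_measure "\<mu> n" by (rule fin)
    show "0 \<le> p n s" by (simp add: p_def)
    have "p n s \<le> T n" unfolding p_def T_def
      by (rule finite_measure_mono) (auto simp: sets)
    thus "p n s \<le> C" using C[of n] by linarith
  qed
  \<comment> \<open>Sequential compactness of a product over the countable type
    \<open>nat list\<close> replaces a diagonal argument over all cells.\<close>
  have "compact (PiE UNIV (\<lambda>_::nat list. {0..C}))"
    unfolding compactin_euclidean_iff[symmetric] euclidean_product_topology[symmetric] compactin_PiE by simp
  hence "seq_compact (PiE UNIV (\<lambda>_::nat list. {0..C}))" by (rule compact_imp_seq_compact)
  moreover have "\<forall>n. p n \<in> PiE UNIV (\<lambda>_. {0..C})" using p by auto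
  ultimately obtain m r where r: "strict_mono r" "(p \<circ> r) \<longlonglongrightarrow> m"
    unfolding seq_compact_def by metis
  have lim: "(\<lambda>n. p (r n) s) \<longlonglongrightarrow> m s" for s
  proof -
    have "isCont (\<lambda>f :: nat list \<Rightarrow> real. f s) m"
      using continuous_on_product_coordinates[of s] continuous_on_eq_continuous_at[OF open_UNIV] by blast
    from isCont_tendsto_compose[OF this r(2)] show ?thesis by (simp add: o_def)
  qed
  have pos: "0 \<le> m s" for s using lim[of s] p by (intro LIMSEQ_le_const) auto
  \<comment> \<open>Limits of masses stay additive because uniform concentration prevents loss of
    mass to children of large index: the balls around the first \<open>N\<close> dense points hold
    all but \<open>e / 2\<close> of every \<open>\<mu> n\<close>.\<close>
  have sums: "(\<lambda>j. m (j # s)) sums m s" for s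
    unfolding sums_def
  proof (rule LIMSEQ_I)
    fix e :: real assume e: "e > 0"
    define k where "k = length s"
    obtain N where N: "\<And>n. measure (\<mu> n) {y. \<forall>i<N. dist (x i) y \<ge> (1/2)^k} \<le> e / 2"
    proof -
      have "\<exists>N. \<forall>n. measure (\<mu> n) {y. \<forall>i<N. dist (x i) y \<ge> (1/2)^k} \<le> e / 2"
        by (rule uniform_total_boundedness[OF dense fin sets conv]) (use e in auto)
      thus ?thesis using that by blast
    qed
    have "\<bar>(\<Sum>j<M. m (j # s)) - m s\<bar> \<le> e / 2" if M: "M \<ge> N" for M
    proof -
      have bound: "\<bar>(\<Sum>j<M. p n (j # s)) - p n s\<bar> \<le> e / 2" for n
      proof -
        interpret finite_measure "\<mu> n" by (rule fin)
        let ?R = "cell s \<inter> {y. \<not> c k y < M}"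
        have cs: "{y. \<not> c k y < M} \<in> sets borel"
        proof -
          have "{y. \<not> c k y < M} = UNIV - (\<Union>i<M. {y. c k y = i})" by auto
          also have "\<dots> \<in> sets borel"
            using cm by (intro sets.Diff sets.finite_UN) auto
          finally show ?thesis .
        qed
        have "(\<Sum>j<M. p n (j # s)) = measure (\<mu> n) (\<Union>j<M. cell (j # s))"
          unfolding p_def
          by (rule finite_measure_finite_Union[symmetric])
             (use cell_sets in \<open>auto simp: sets disjoint_family_on_def, auto simp: cell_Cons\<close>)
        also have "(\<Union>j<M. cell (j # s)) = cell s - ?R" by (auto simp: cell_Cons k_def)
        also have "measure (\<mu> n) \<dots> = p n s - measure (\<mu> n) ?R"
          unfolding p_def using cell_sets cs by (intro finite_measure_Diff) (auto simp: sets)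
        finally have "\<bar>(\<Sum>j<M. p n (j # s)) - p n s\<bar> = measure (\<mu> n) ?R" by simp
        also have "\<dots> \<le> measure (\<mu> n) {y. \<forall>i<N. dist (x i) y \<ge> (1/2)^k}"
        proof (rule finite_measure_mono)
          show "?R \<subseteq> {y. \<forall>i<N. dist (x i) y \<ge> (1/2)^k}"
            using c2[of _ k] M by (auto simp: not_less[symmetric])
          show "{y. \<forall>i<N. dist (x i) y \<ge> (1/2)^k} \<in> sets (\<mu> n)"
            unfolding sets by measurable
        qed
        finally show ?thesis using N[of n] by linarith
      qed
      have "(\<lambda>n. \<bar>(\<Sum>j<M. p (r n) (j # s)) - p (r n) s\<bar>) \<longlonglongrightarrow> \<bar>(\<Sum>j<M. m (j # s)) - m s\<bar>"
        by (intro tendsto_intros lim)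
      thus ?thesis by (rule LIMSEQ_le_const2) (use bound in auto)
    qed
    thus "\<exists>no. \<forall>M\<ge>no. norm ((\<Sum>j<M. m (j # s)) - m s) < e"
      using e by (intro exI[of _ N]) force
  qed
  define J where "J = mass_interval m []"
  have J: "J = {0..<m []}" by (simp add: J_def mass_interval_def)
  define V where "V t k = address m t k" for t k
  have V_iff: "V t (length s) = s \<longleftrightarrow> t \<in> mass_interval m s" if "t \<in> J" for t s
    using address_eq_iff[OF pos sums] that by (simp add: V_def J_def)
  \<comment> \<open>The interval of an address of \<open>t\<close> contains \<open>t\<close> and
    hence has positive length; so its cell has positive mass for some measure and is
    nonempty.\<close>
  have branch: "\<exists>y. path l y = V t l" if t: "t \<in> J" for t l
  proof -
    have "t \<in> mass_interval m (V t l)"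
      using in_mass_interval_address[OF pos sums] t by (simp add: V_def J_def)
    hence "m (V t l) > 0" by (simp add: mass_interval_def)
    hence "\<forall>\<^sub>F n in sequentially. p (r n) (V t l) > 0" by (intro order_tendstoD(1)[OF lim])
    then obtain n where "p (r n) (V t l) > 0" by (auto simp: eventually_sequentially)
    hence "cell (V t l) \<noteq> {}" by (auto simp: p_def)
    thus ?thesis by (auto simp: cell_def V_def)
  qed
  have initial: "path k y = V t k" if "path l y = V t l" "k \<le> l" for k l y t
    using that(2,1)
  proof (induction k rule: inc_induct)
    case (step k) thus ?case by (simp add: V_def)
  qed
  \<comment> \<open>The choice made at level k is the head of the address of length
    \<open>Suc k\<close>; \<open>X k t\<close> is the centre of that ball.\<close>
  define X where "X k t = x (hd (V t (Suc k)))" for k t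
  have Xd: "dist (X k t) (X l t) \<le> 2 * (1/2)^k" if t: "t \<in> J" and "k \<le> l" for k l t
  proof -
    \<comment> \<open>A point of the deeper cell lies in both cells, within (1/2)^k and (1/2)^l of
      their centres.\<close>
    obtain y where y: "path (Suc l) y = V t (Suc l)" using branch[OF t] by blast
    have y': "path (Suc k) y = V t (Suc k)" using initial[OF y, of "Suc k"] \<open>k \<le> l\<close> by simp
    have "X l t = x (c l y)" "X k t = x (c k y)" using y y' by (simp_all add: X_def flip: y y')
    hence "dist (X k t) (X l t) \<le> dist (x (c k y)) y + dist (x (c l y)) y"
      by (simp add: dist_triangle2)
    also have "\<dots> \<le> (1/2)^k + (1/2)^l" using c1[of k y] c1[of l y] by linarith
    also have "(1/2::real)^l \<le> (1/2)^k" using \<open>k \<le> l\<close> by (intro power_decreasing) auto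
    finally show ?thesis by simp
  qed
  have half: "(\<lambda>k. K * (1/2::real)^k) \<longlonglongrightarrow> 0" for K
    by (rule tendsto_mult_right_zero) (rule LIMSEQ_power_zero, simp)
  have "convergent (\<lambda>k. X k t)" if t: "t \<in> J" for t
  proof -
    have "Cauchy (\<lambda>k. X k t)"
    proof (rule metric_CauchyI)
      fix e :: real assume "e > 0"
      hence "\<forall>\<^sub>F k in sequentially. 4 * (1/2::real)^k < e" by (intro order_tendstoD(2)[OF half])
      then obtain N where N: "4 * (1/2::real)^N < e" by (auto simp: eventually_sequentially)
      have "dist (X k t) (X l t) < e" if "k \<ge> N" "l \<ge> N" for k l
        using Xd[OF t that(1)] Xd[OF t that(2)] dist_triangle3[of "X k t" "X l t" "X N t"] N by linarith
      thus "\<exists>M. \<forall>m\<ge>M. \<forall>n\<ge>M. dist (X m t) (X n t) < e" by blast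
    qed
    thus ?thesis by (simp add: Cauchy_convergent_iff)
  qed
  define Z where "Z t = lim (\<lambda>k. X k t)" for t
  have XZ: "(\<lambda>k. X k t) \<longlonglongrightarrow> Z t" if "t \<in> J" for t
    using \<open>\<And>t. t \<in> J \<Longrightarrow> convergent (\<lambda>k. X k t)\<close>[OF that] by (simp add: Z_def convergent_LIMSEQ_iff)
  have XZd: "dist (X k t) (Z t) \<le> 2 * (1/2)^k" if "t \<in> J" for k t
  proof -
    have "(\<lambda>l. dist (X k t) (X l t)) \<longlonglongrightarrow> dist (X k t) (Z t)" by (intro tendsto_intros XZ that)
    thus ?thesis by (rule LIMSEQ_le_const2) (use Xd[OF that] in blast)
  qed
  define \<tau> where "\<tau> = restrict_space lborel J"
  have Js: "J \<in> sets borel" by (simp add: J)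
  have spt: "space \<tau> = J" using Js by (simp add: \<tau>_def space_restrict_space)
  have fint: "finite_measure \<tau>"
    by (rule finite_measureI) (use pos[of "[]"] Js in \<open>simp add: \<tau>_def emeasure_restrict_space space_restrict_space J\<close>)
  have Vset: "{t\<in>space \<tau>. V t k = s} = (if length s = k then mass_interval m s else {})" for k s
  proof (cases "length s = k")
    case True
    thus ?thesis using V_iff[of _ s] mass_interval_subset[of m s, OF pos sums] by (auto simp: spt J_def)
  next
    case False
    have "length (V t k) = k" for t by (simp add: V_def)
    with False show ?thesis by auto
  qed
  have mis: "mass_interval m s \<in> sets \<tau>" for s
    using mass_interval_subset[of m s, OF pos sums] Js
    unfolding \<tau>_def J_def by (auto simp: sets_restrict_space_iff mass_interval_def)
  have mim: "measure \<tau> (mass_interval m s) = m s" for s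
    using mass_interval_subset[of m s, OF pos sums] pos[of s] Js
    unfolding \<tau>_def J_def by (subst measure_restrict_space) (auto simp: mass_interval_def)
  have Vm: "(\<lambda>t. V t k) \<in> measurable \<tau> (count_space UNIV)" for k
    using mis by (intro measurable_count_spaceI) (auto simp: Vset)
  have pathm: "path k \<in> measurable (\<mu> n) (count_space UNIV)" for k n
    using path_sets by (intro measurable_count_spaceI) (simp add: sp sets)
  have Xm: "X k \<in> borel_measurable \<tau>" for k
    unfolding X_def using measurable_compose[OF Vm[of "Suc k"], of "\<lambda>s. x (hd s)" borel] by simp
  have Zm: "Z \<in> borel_measurable \<tau>"
    by (rule borel_measurable_LIMSEQ_metric[OF Xm]) (use XZ in \<open>simp add: spt\<close>)
  \<comment> \<open>Cells are not closed, so \<open>Z t\<close> may fall outside the cells of its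
    own address, and \<open>\<nu>\<close> need not give a cell the mass \<open>m\<close>. Only the
    distance to the centres is controlled, which is enough for Lipschitz functions.\<close>
  define \<nu> where "\<nu> = distr \<tau> borel Z"
  show ?thesis
  proof (rule that)
    show "finite_measure \<nu>" unfolding \<nu>_def by (rule finite_measure.finite_measure_distr[OF fint Zm])
    show "sets \<nu> = sets borel" by (simp add: \<nu>_def)
    fix u :: "'a \<Rightarrow> real" and L assume u: "L-lipschitz_on UNIV u" "bounded (range u)"
    obtain B where B: "\<And>y. \<bar>u y\<bar> \<le> B" using u(2) by (auto simp: bounded_iff)
    have L: "0 \<le> L" "\<And>y z. \<bar>u y - u z\<bar> \<le> L * dist y z"
      using u(1) by (auto simp: lipschitz_on_def dist_real_def)
    have um: "u \<in> borel_measurable borel" by (rule lipschitz_borel_measurable[OF u(1)])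
    have uint: "integrable (\<mu> n) u" for n
      using B by (intro integrable_bounded_borel[OF fin sets um]) auto
    \<comment> \<open>The value of \<open>u\<close> at the centre of the last ball. It approximates
      \<open>u\<close> through paths and \<open>u\<close> composed with \<open>Z\<close> through
      addresses, by the same function on a countable set.\<close>
    define g where "g s = u (x (hd s))" for s :: "nat list"
    have gB: "\<bar>g s\<bar> \<le> B" for s using B by (simp add: g_def)
    have gint: "integrable (\<mu> n) (\<lambda>y. g (path k y))" for n k
      using gB measurable_compose[OF pathm, of g borel]
      by (intro finite_measure.integrable_const_bound[OF fin, of _ B]) auto
    have gVint: "integrable \<tau> (\<lambda>t. g (V t k))" for k
      using gB measurable_compose[OF Vm, of g borel]
      by (intro finite_measure.integrable_const_bound[OF fint, of _ B]) auto
    have uZm: "(\<lambda>t. u (Z t)) \<in> borel_measurable \<tau>" using measurable_compose[OF Zm um] .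
    have uZint: "integrable \<tau> (\<lambda>t. u (Z t))"
      using B uZm by (intro finite_measure.integrable_const_bound[OF fint, of _ B]) auto
    \<comment> \<open>The limit exists along the whole sequence, so it may be computed along the
      subsequence \<open>r\<close>.\<close>
    obtain a where a: "(\<lambda>n. \<integral>y. u y \<partial>\<mu> n) \<longlonglongrightarrow> a"
      using conv[OF u] by (auto simp: convergent_def)
    have ar: "(\<lambda>n. \<integral>y. u y \<partial>\<mu> (r n)) \<longlonglongrightarrow> a"
      using LIMSEQ_subseq_LIMSEQ[OF a r(1)] by (simp add: o_def)
    have Tr: "(\<lambda>n. T (r n)) \<longlonglongrightarrow> m []" using lim[of "[]"] by (simp add: p_def T_def)
    have gconv: "(\<lambda>n. \<integral>y. g (path k y) \<partial>\<mu> (r n)) \<longlonglongrightarrow> (\<integral>t. g (V t k) \<partial>\<tau>)" for k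
    proof (rule tendsto_integral_countable_valued[OF fin fint pathm Vm _ _ gB])
      show "(\<lambda>n. measure (\<mu> (r n)) (space (\<mu> (r n)))) \<longlonglongrightarrow> measure \<tau> (space \<tau>)"
        using Tr mim[of "[]"] by (simp add: sp spt T_def J_def)
      fix s
      show "(\<lambda>n. measure (\<mu> (r n)) {y\<in>space (\<mu> (r n)). path k y = s}) \<longlonglongrightarrow> measure \<tau> {t\<in>space \<tau>. V t k = s}"
      proof (cases "length s = k")
        case True
        thus ?thesis using lim[of s] by (auto simp: Vset mim sp p_def cell_def)
      next
        case False
        hence "{y. path k y = s} = {}" by (metis (mono_tags, lifting) Collect_empty_eq len)
        thus ?thesis using False by (simp add: Vset sp)
      qed
    qed
    have dist1: "\<bar>(\<integral>y. u y \<partial>\<mu> n) - (\<integral>y. g (path (Suc k) y) \<partial>\<mu> n)\<bar> \<le> L * (1/2)^k * T n" for n k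
    proof -
      have "\<bar>(\<integral>y. u y \<partial>\<mu> n) - (\<integral>y. g (path (Suc k) y) \<partial>\<mu> n)\<bar> \<le> (\<integral>y. \<bar>u y - g (path (Suc k) y)\<bar> \<partial>\<mu> n)"
        unfolding Bochner_Integration.integral_diff[OF uint gint, symmetric] by (rule integral_abs_bound)
      also have "\<dots> \<le> (\<integral>y. L * (1/2)^k \<partial>\<mu> n)"
      proof (rule integral_mono)
        fix y
        have "\<bar>u y - g (path (Suc k) y)\<bar> \<le> L * dist y (x (c k y))" by (simp add: g_def L(2))
        also have "\<dots> \<le> L * (1/2)^k"
          using c1[of k y] L(1) by (intro mult_left_mono) (auto simp: dist_commute)
        finally show "\<bar>u y - g (path (Suc k) y)\<bar> \<le> L * (1/2)^k" .
      qed (intro integrable_abs Bochner_Integration.integrable_diff uint gint finite_measure.integrable_const fin)+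
      also have "\<dots> = L * (1/2)^k * T n" by (simp add: T_def sp)
      finally show ?thesis .
    qed
    have dist2: "\<bar>(\<integral>t. g (V t (Suc k)) \<partial>\<tau>) - (\<integral>t. u (Z t) \<partial>\<tau>)\<bar> \<le> L * (2 * (1/2)^k) * m []" for k
    proof -
      have "\<bar>(\<integral>t. g (V t (Suc k)) \<partial>\<tau>) - (\<integral>t. u (Z t) \<partial>\<tau>)\<bar> \<le> (\<integral>t. \<bar>g (V t (Suc k)) - u (Z t)\<bar> \<partial>\<tau>)"
        unfolding Bochner_Integration.integral_diff[OF gVint uZint, symmetric] by (rule integral_abs_bound)
      also have "\<dots> \<le> (\<integral>t. L * (2 * (1/2)^k) \<partial>\<tau>)"
      proof (rule integral_mono)
        fix t assume "t \<in> space \<tau>"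
        have "\<bar>g (V t (Suc k)) - u (Z t)\<bar> \<le> L * dist (X k t) (Z t)" by (simp add: g_def X_def L(2))
        also have "\<dots> \<le> L * (2 * (1/2)^k)"
          using XZd[of t k] \<open>t \<in> space \<tau>\<close> L(1) by (intro mult_left_mono) (auto simp: spt)
        finally show "\<bar>g (V t (Suc k)) - u (Z t)\<bar> \<le> L * (2 * (1/2)^k)" .
      qed (use gVint uZint fint in \<open>auto simp: finite_measure.integrable_const\<close>)
      also have "\<dots> = L * (2 * (1/2)^k) * m []" using mim[of "[]"] by (simp add: spt J_def)
      finally show ?thesis .
    qed
    \<comment> \<open>The factor 3 is 1 from \<open>dist1\<close> plus 2 from
      \<open>dist2\<close>.\<close>
    have "\<bar>a - (\<integral>t. u (Z t) \<partial>\<tau>)\<bar> \<le> (3 * L * m []) * (1/2)^k" for k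
    proof -
      have 1: "(\<lambda>n. \<bar>(\<integral>y. u y \<partial>\<mu> (r n)) - (\<integral>y. g (path (Suc k) y) \<partial>\<mu> (r n))\<bar>)
          \<longlonglongrightarrow> \<bar>a - (\<integral>t. g (V t (Suc k)) \<partial>\<tau>)\<bar>"
        by (intro tendsto_intros ar gconv)
      have 2: "(\<lambda>n. L * (1/2)^k * T (r n)) \<longlonglongrightarrow> L * (1/2)^k * m []"
        by (intro tendsto_intros Tr)
      have "\<bar>a - (\<integral>t. g (V t (Suc k)) \<partial>\<tau>)\<bar> \<le> L * (1/2)^k * m []"
        by (rule LIMSEQ_le[OF 1 2]) (use dist1 in blast)
      thus ?thesis using dist2[of k] by (simp add: algebra_simps)
    qed
    hence "\<bar>a - (\<integral>t. u (Z t) \<partial>\<tau>)\<bar> \<le> 0" by (intro LIMSEQ_le_const[OF half]) auto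
    hence "a = (\<integral>y. u y \<partial>\<nu>)" using um Zm by (simp add: \<nu>_def integral_distr)
    thus "(\<lambda>n. \<integral>y. u y \<partial>\<mu> n) \<longlonglongrightarrow> (\<integral>y. u y \<partial>\<nu>)" using a by simp
  qed
qed

section \<open>Lipschitz minorants and weak convergence\<close>

lemma lipschitz_approximation_below:
  fixes u :: "'a::metric_space \<Rightarrow> real"
  assumes cont: "continuous_on UNIV u" and B: "\<And>y. \<bar>u y\<bar> \<le> B"
  obtains v :: "nat \<Rightarrow> 'a \<Rightarrow> real" where
    "\<And>j. \<exists>L. L-lipschitz_on UNIV (v j)" "\<And>j y. - B \<le> v j y" "\<And>j y. v j y \<le> u y"
    "\<And>i j y. i \<le> j \<Longrightarrow> v i y \<le> v j y" "\<And>y. (\<lambda>j. v j y) \<longlonglongrightarrow> u y"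
proof -
  \<comment> \<open>The Pasch-Hausdorff envelope, the largest \<open>j\<close>-Lipschitz function
    below \<open>u\<close>.\<close>
  define v where "v j y = (INF z. u z + real j * dist y z)" for j y
  have lb: "- B \<le> u z + real j * dist y z" for j y z
    using B[of z] zero_le_dist[of y z] by (smt (verit) mult_nonneg_nonneg of_nat_0_le_iff)
  have bdd: "bdd_below (range (\<lambda>z. u z + real j * dist y z))" for j y
    using lb by (auto intro!: bdd_belowI)
  have low: "v j y \<le> u z + real j * dist y z" for j y z
    unfolding v_def by (rule cINF_lower[OF bdd]) simp
  show ?thesis
  proof (rule that)
    fix j
    have le: "v j y - v j z \<le> real j * dist y z" for y z
    proof -
      have "v j y - real j * dist y z \<le> u w + real j * dist z w" for w
      proof -
        have "real j * dist y w \<le> real j * dist y z + real j * dist z w"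
          using dist_triangle[of y w z] by (simp add: distrib_left[symmetric] mult_left_mono)
        thus ?thesis using low[of j y w] by linarith
      qed
      hence "v j y - real j * dist y z \<le> v j z" unfolding v_def[of j z] by (intro cINF_greatest) auto
      thus ?thesis by simp
    qed
    have "(real j)-lipschitz_on UNIV (v j)"
    proof (rule lipschitz_onI)
      fix y z show "dist (v j y) (v j z) \<le> real j * dist y z"
        using le[of y z] le[of z y] by (simp add: dist_real_def abs_le_iff dist_commute)
    qed simp
    thus "\<exists>L. L-lipschitz_on UNIV (v j)" ..
    fix y
    show "- B \<le> v j y" unfolding v_def by (rule cINF_greatest) (use lb in auto)
    show "v j y \<le> u y" using low[of j y y] by simp
  next
    fix i j :: nat and y assume ij: "i \<le> j"
    have "v i y \<le> u z + real j * dist y z" for z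
      using low[of i y z] mult_right_mono[of "real i" "real j" "dist y z"] ij by simp
    thus "v i y \<le> v j y" unfolding v_def[of j] by (intro cINF_greatest) auto
  next
    fix y show "(\<lambda>j. v j y) \<longlonglongrightarrow> u y"
    proof (rule LIMSEQ_I)
      fix e :: real assume e: "e > 0"
      obtain d where d: "d > 0" "\<And>z. dist z y < d \<Longrightarrow> dist (u z) (u y) < e / 2"
        using cont e unfolding continuous_on_iff by (metis UNIV_I half_gt_zero)
      \<comment> \<open>Beyond distance \<open>d\<close> the penalty
        \<open>real j * dist y z\<close> outweighs the oscillation of \<open>u\<close>, which is at
        most \<open>2 * B\<close>.\<close>
      obtain N :: nat where N: "2 * B / d \<le> real N" using real_arch_simple by blast
      have "norm (v j y - u y) < e" if "j \<ge> N" for j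
      proof -
        have "u y - e / 2 \<le> u z + real j * dist y z" for z
        proof (cases "dist z y < d")
          case True
          have "0 \<le> real j * dist y z" by simp
          thus ?thesis using d(2)[OF True, unfolded dist_real_def] by linarith
        next
          case False
          have "2 * B \<le> real N * d" using N d(1) by (simp add: field_simps)
          also have "\<dots> \<le> real j * dist y z"
            using that False d(1) by (intro mult_mono) (auto simp: dist_commute)
          finally show ?thesis using B[of y] B[of z] e by (auto simp: abs_le_iff)
        qed
        hence "u y - e / 2 \<le> v j y" unfolding v_def by (intro cINF_greatest) auto
        thus ?thesis using low[of j y y] e by auto
      qed
      thus "\<exists>no. \<forall>n\<ge>no. norm (v n y - u y) < e" by blast
    qed
  qed
qed

text \<open>Lipschitz minorants with almost the full integral against \<open>\<nu>\<close> bound the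
  integrals from below in the limit; the upper bound is the same argument for
  \<open>- u\<close>.\<close>

lemma weak_convergence_from_lipschitz:
  fixes \<mu> :: "nat \<Rightarrow> 'a::metric_space measure"
  assumes fin: "\<And>n. finite_measure (\<mu> n)" "finite_measure \<nu>"
    and sets: "\<And>n. sets (\<mu> n) = sets borel" "sets \<nu> = sets borel"
    and conv: "\<And>u L. L-lipschitz_on UNIV u \<Longrightarrow> bounded (range u) \<Longrightarrow>
       (\<lambda>n. \<integral>y. u y \<partial>\<mu> n :: real) \<longlonglongrightarrow> (\<integral>y. u y \<partial>\<nu>)"
    and cont: "continuous_on UNIV u" and bdd: "bounded (range u)"
  shows "(\<lambda>n. \<integral>y. u y \<partial>\<mu> n :: real) \<longlonglongrightarrow> (\<integral>y. u y \<partial>\<nu>)"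
proof -
  have int: "integrable M w" if "finite_measure M" "sets M = sets borel" "continuous_on UNIV w" "\<And>y. \<bar>w y\<bar> \<le> B"
    for M and w :: "'a \<Rightarrow> real" and B
    using that by (intro integrable_bounded_borel[of M w B] borel_measurable_continuous_onI) auto
  have lower: "\<forall>\<^sub>F n in sequentially. (\<integral>y. w y \<partial>\<nu>) - e < (\<integral>y. w y \<partial>\<mu> n)"
    if w: "continuous_on UNIV w" "bounded (range w)" and e: "e > 0" for w :: "'a \<Rightarrow> real" and e
  proof -
    obtain B where B: "\<And>y. \<bar>w y\<bar> \<le> B" using w(2) by (auto simp: bounded_iff)
    obtain v where v: "\<And>j. \<exists>L. L-lipschitz_on UNIV (v j)" "\<And>j y. - B \<le> v j y" "\<And>j y. v j y \<le> w y"
        "\<And>i j y. i \<le> j \<Longrightarrow> v i y \<le> v j y" "\<And>y. (\<lambda>j. v j y) \<longlonglongrightarrow> w y"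
      using lipschitz_approximation_below[OF w(1), of B] B by blast
    have vB: "\<bar>v j y\<bar> \<le> B" for j y using v(2,3)[of j y] B[of y] by (auto simp: abs_le_iff)
    have vc: "continuous_on UNIV (v j)" for j using v(1)[of j] lipschitz_on_continuous_on by blast
    have "(\<lambda>j. \<integral>y. v j y \<partial>\<nu>) \<longlonglongrightarrow> (\<integral>y. w y \<partial>\<nu>)"
      using int[OF fin(2) sets(2) vc vB] int[OF fin(2) sets(2) w(1) B] vB v(5) fin(2)
      by (intro integral_dominated_convergence[where w = "\<lambda>_. B"])
         (auto dest: borel_measurable_integrable simp: finite_measure.integrable_const)
    hence "\<forall>\<^sub>F j in sequentially. (\<integral>y. w y \<partial>\<nu>) - e < (\<integral>y. v j y \<partial>\<nu>)"
      using e by (intro order_tendstoD(1)) auto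
    then obtain j where j: "(\<integral>y. w y \<partial>\<nu>) - e < (\<integral>y. v j y \<partial>\<nu>)" by (auto simp: eventually_sequentially)
    have "bounded (range (v j))" using vB by (intro boundedI[of _ B]) auto
    hence "(\<lambda>n. \<integral>y. v j y \<partial>\<mu> n) \<longlonglongrightarrow> (\<integral>y. v j y \<partial>\<nu>)" using v(1)[of j] conv by blast
    hence "\<forall>\<^sub>F n in sequentially. (\<integral>y. w y \<partial>\<nu>) - e < (\<integral>y. v j y \<partial>\<mu> n)"
      using j by (rule order_tendstoD(1))
    moreover have "(\<integral>y. v j y \<partial>\<mu> n) \<le> (\<integral>y. w y \<partial>\<mu> n)" for n
      using v(3) by (intro integral_mono int[OF fin(1) sets(1) vc vB] int[OF fin(1) sets(1) w(1) B])
    ultimately show ?thesis by (auto elim!: eventually_mono intro: less_le_trans)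
  qed
  show ?thesis
  proof (rule tendstoI)
    fix e :: real assume e: "e > 0"
    have "continuous_on UNIV (\<lambda>y. - u y)" "bounded (range (\<lambda>y. - u y))"
      using cont bdd by (auto intro!: continuous_intros simp: bounded_iff)
    from lower[OF this e] lower[OF cont bdd e]
    show "\<forall>\<^sub>F n in sequentially. dist (\<integral>y. u y \<partial>\<mu> n) (\<integral>y. u y \<partial>\<nu>) < e"
      by eventually_elim (auto simp: dist_real_def)
  qed
qed


section \<open>Complex measures and the pairing\<close>

text \<open>The bound makes the upper variation a real supremum, so that the Jordan parts are finite
  measures.\<close>

definition signed_measure :: "('a::topological_space set \<Rightarrow> real) \<Rightarrow> bool" where
  "signed_measure \<nu> \<longleftrightarrow>
     (\<forall>A :: nat \<Rightarrow> 'a set. range A \<subseteq> sets borel \<longrightarrow> disjoint_family A \<longrightarrow> (\<lambda>n. \<nu> (A n)) sums \<nu> (\<Union>n. A n)) \<and>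
     (\<exists>C. \<forall>A\<in>sets borel. \<bar>\<nu> A\<bar> \<le> C)"

definition upper_variation :: "('a::topological_space set \<Rightarrow> real) \<Rightarrow> 'a set \<Rightarrow> real" where
  "upper_variation \<nu> A = (SUP B\<in>{B\<in>sets borel. B \<subseteq> A}. \<nu> B)"

lemma signed_measure_uminus: "signed_measure \<nu> \<Longrightarrow> signed_measure (\<lambda>A. - \<nu> A)"
  unfolding signed_measure_def by (simp add: sums_minus)

context
  fixes \<nu> :: "'a::topological_space set \<Rightarrow> real"
  assumes \<nu>: "signed_measure \<nu>"
begin

lemma signed_measure_sums:
  "range A \<subseteq> sets borel \<Longrightarrow> disjoint_family A \<Longrightarrow> (\<lambda>n. \<nu> (A n)) sums \<nu> (\<Union>n. A n)"
  using \<nu> unfolding signed_measure_def by blast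

lemma signed_measure_empty: "\<nu> {} = 0"
proof -
  have "(\<lambda>n::nat. \<nu> {}) sums \<nu> {}"
    using signed_measure_sums[of "\<lambda>_. {}"] by (simp add: disjoint_family_on_def)
  hence "summable (\<lambda>n::nat. \<nu> {})" by (rule sums_summable)
  thus ?thesis by (simp add: summable_const_iff)
qed

lemma signed_measure_Un:
  assumes "A \<in> sets borel" "B \<in> sets borel" "A \<inter> B = {}"
  shows "\<nu> (A \<union> B) = \<nu> A + \<nu> B"
proof -
  have r: "range (binaryset A B) \<subseteq> sets borel"
    using assms by (auto simp: range_binaryset_eq)
  have "disjoint_family (binaryset A B)"
    using assms by (auto simp: disjoint_family_on_def binaryset_def)
  from signed_measure_sums[OF r this]
  have "(\<lambda>n. \<nu> (binaryset A B n)) sums \<nu> (A \<union> B)"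
    by (simp add: UN_binaryset_eq)
  moreover have "(\<lambda>n. \<nu> (binaryset A B n)) sums (\<nu> A + \<nu> B)"
    by (rule binaryset_sums) (rule signed_measure_empty)
  ultimately show ?thesis using sums_unique2 by blast
qed

lemma upper_variation_bdd: "bdd_above (\<nu> ` {B\<in>sets borel. B \<subseteq> A})"
  using \<nu> unfolding signed_measure_def bdd_above_def by (auto simp: abs_le_iff)

lemma upper_variation_upper: "B \<in> sets borel \<Longrightarrow> B \<subseteq> A \<Longrightarrow> \<nu> B \<le> upper_variation \<nu> A"
  unfolding upper_variation_def by (rule cSUP_upper[OF _ upper_variation_bdd]) simp

lemma upper_variation_least:
  "(\<And>B. B \<in> sets borel \<Longrightarrow> B \<subseteq> A \<Longrightarrow> \<nu> B \<le> C) \<Longrightarrow> upper_variation \<nu> A \<le> C"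
  unfolding upper_variation_def by (rule cSUP_least) auto

lemma upper_variation_nonneg: "0 \<le> upper_variation \<nu> A"
  using upper_variation_upper[of "{}" A] by (simp add: signed_measure_empty)

lemma upper_variation_mono: "A \<subseteq> B \<Longrightarrow> upper_variation \<nu> A \<le> upper_variation \<nu> B"
  by (intro upper_variation_least upper_variation_upper) auto

lemma upper_variation_superadd:
  assumes "A \<inter> B = {}"
  shows "upper_variation \<nu> A + upper_variation \<nu> B \<le> upper_variation \<nu> (A \<union> B)"
proof -
  have "\<nu> A' + \<nu> B' \<le> upper_variation \<nu> (A \<union> B)"
    if "A' \<in> sets borel" "A' \<subseteq> A" "B' \<in> sets borel" "B' \<subseteq> B" for A' B'
  proof -
    have "A' \<inter> B' = {}" using that assms by blast
    moreover have "\<nu> (A' \<union> B') \<le> upper_variation \<nu> (A \<union> B)"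
      using that by (intro upper_variation_upper) auto
    ultimately show ?thesis using that signed_measure_Un[of A' B'] by simp
  qed
  hence "\<nu> B' \<le> upper_variation \<nu> (A \<union> B) - \<nu> A'"
    if "A' \<in> sets borel" "A' \<subseteq> A" "B' \<in> sets borel" "B' \<subseteq> B" for A' B'
    using that by (simp add: le_diff_eq add.commute)
  hence "upper_variation \<nu> B \<le> upper_variation \<nu> (A \<union> B) - \<nu> A'" if "A' \<in> sets borel" "A' \<subseteq> A" for A'
    using that by (intro upper_variation_least) auto
  hence "upper_variation \<nu> A \<le> upper_variation \<nu> (A \<union> B) - upper_variation \<nu> B"
    by (intro upper_variation_least) (auto simp: algebra_simps)
  thus ?thesis by simp
qed

text \<open>\<open>ennreal\<close> is monotone and continuous, hence commutes with bounded suprema.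
  This moves the extended real supremum in \<open>pos_part\<close> to the reals, where subtraction
  is available.\<close>

lemma ennreal_upper_variation:
  "(SUP B\<in>{B\<in>sets borel. B \<subseteq> A}. ennreal (\<nu> B)) = ennreal (upper_variation \<nu> A)"
proof -
  let ?S = "\<nu> ` {B\<in>sets borel. B \<subseteq> A}"
  have "ennreal (Sup ?S) = (SUP s\<in>?S. ennreal s)"
  proof (rule continuous_at_Sup_mono)
    show "mono ennreal" by (auto intro!: monoI ennreal_leI)
    have "continuous_on UNIV ennreal" by (rule continuous_on_ennreal[OF continuous_on_id])
    thus "continuous (at_left (Sup ?S)) ennreal"
      by (rule continuous_at_imp_continuous_at_within[OF continuous_on_eq_continuous_at[OF open_UNIV, THEN iffD1, rule_format]]) simp
    show "?S \<noteq> {}" by auto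
    show "bdd_above ?S" by (rule upper_variation_bdd)
  qed
  thus ?thesis by (simp add: upper_variation_def image_comp o_def)
qed

text \<open>Superadditivity on finite unions gives one inequality. For the other, a Borel subset
  \<open>B\<close> of the union is cut into the pieces \<open>B \<inter> A i\<close>, each bounded
  by the variation of \<open>A i\<close>.\<close>

lemma upper_variation_countably_additive:
  "countably_additive (sets borel) (\<lambda>A. ennreal (upper_variation \<nu> A))"
proof (rule countably_additiveI)
  fix A :: "nat \<Rightarrow> 'a set" assume A: "range A \<subseteq> sets borel" "disjoint_family A"
  let ?U = "\<Union>n. A n"
  show "(\<Sum>i. ennreal (upper_variation \<nu> (A i))) = ennreal (upper_variation \<nu> ?U)"
  proof (rule antisym)
    have "(\<Sum>i<n. upper_variation \<nu> (A i)) \<le> upper_variation \<nu> (\<Union>i<n. A i)" for n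
    proof (induction n)
      case (Suc n)
      have "(\<Union>i<n. A i) \<inter> A n = {}"
      proof -
        have "A i \<inter> A n = {}" if "i < n" for i using A(2) that by (simp add: disjoint_family_on_def)
        thus ?thesis by blast
      qed
      from upper_variation_superadd[OF this] Suc show ?case by (simp add: lessThan_Suc Un_commute)
    qed (simp add: upper_variation_nonneg)
    moreover have "upper_variation \<nu> (\<Union>i<n. A i) \<le> upper_variation \<nu> ?U" for n
      by (rule upper_variation_mono) auto
    ultimately have "(\<Sum>i<n. upper_variation \<nu> (A i)) \<le> upper_variation \<nu> ?U" for n
      using order_trans by blast
    thus "(\<Sum>i. ennreal (upper_variation \<nu> (A i))) \<le> ennreal (upper_variation \<nu> ?U)"
      unfolding suminf_eq_SUP
      by (intro SUP_least) (simp add: sum_ennreal upper_variation_nonneg ennreal_leI)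
  next
    have "ennreal (\<nu> B) \<le> (\<Sum>i. ennreal (upper_variation \<nu> (A i)))" if B: "B \<in> sets borel" "B \<subseteq> ?U" for B
    proof -
      have BA: "B \<inter> A i \<in> sets borel" for i using A(1) B(1) by blast
      have "disjoint_family (\<lambda>i. B \<inter> A i)" using A(2) by (auto simp: disjoint_family_on_def)
      hence "(\<lambda>i. \<nu> (B \<inter> A i)) sums \<nu> (\<Union>i. B \<inter> A i)" using BA by (intro signed_measure_sums) auto
      moreover have "(\<Union>i. B \<inter> A i) = B" using B(2) by auto
      \<comment> \<open>The pieces may have negative values, so partial sums are formed in the reals
        before \<open>ennreal\<close> is applied.\<close>
      ultimately have "(\<lambda>n. ennreal (\<Sum>i<n. \<nu> (B \<inter> A i))) \<longlonglongrightarrow> ennreal (\<nu> B)"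
        by (intro tendsto_ennrealI) (simp add: sums_def)
      moreover have "ennreal (\<Sum>i<n. \<nu> (B \<inter> A i)) \<le> (\<Sum>i. ennreal (upper_variation \<nu> (A i)))" for n
      proof -
        have "ennreal (\<Sum>i<n. \<nu> (B \<inter> A i)) \<le> ennreal (\<Sum>i<n. upper_variation \<nu> (A i))"
          using BA by (intro ennreal_leI sum_mono upper_variation_upper) auto
        also have "\<dots> = (\<Sum>i<n. ennreal (upper_variation \<nu> (A i)))"
          by (simp add: sum_ennreal upper_variation_nonneg)
        also have "\<dots> \<le> (\<Sum>i. ennreal (upper_variation \<nu> (A i)))"
          by (rule sum_le_suminf) auto
        finally show ?thesis .
      qed
      ultimately show ?thesis by (intro LIMSEQ_le_const2) auto
    qed
    hence "(SUP B\<in>{B\<in>sets borel. B \<subseteq> ?U}. ennreal (\<nu> B)) \<le> (\<Sum>i. ennreal (upper_variation \<nu> (A i)))"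
      by (intro SUP_least) simp
    thus "ennreal (upper_variation \<nu> ?U) \<le> (\<Sum>i. ennreal (upper_variation \<nu> (A i)))"
      by (simp only: ennreal_upper_variation)
  qed
qed

lemma sets_pos_part: "sets (pos_part \<nu>) = sets borel"
  using sets.sigma_sets_eq[of "borel :: 'a measure"] by (simp add: pos_part_def)

lemma emeasure_pos_part:
  assumes "A \<in> sets borel"
  shows "emeasure (pos_part \<nu>) A = ennreal (upper_variation \<nu> A)"
  unfolding pos_part_def ennreal_upper_variation
proof (rule emeasure_measure_of_sigma[OF _ _ upper_variation_countably_additive assms])
  show "sigma_algebra UNIV (sets (borel :: 'a measure))"
    using sets.sigma_algebra_axioms[of "borel :: 'a measure"] by simp
  have "upper_variation \<nu> {} = 0"
    by (intro antisym upper_variation_least upper_variation_nonneg) (simp add: signed_measure_empty)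
  thus "positive (sets borel) (\<lambda>A. ennreal (upper_variation \<nu> A))" by (simp add: positive_def)
qed

lemma finite_measure_pos_part: "finite_measure (pos_part \<nu>)"
proof
  have "space (pos_part \<nu>) = UNIV" using sets_eq_imp_space_eq[OF sets_pos_part] by simp
  thus "emeasure (pos_part \<nu>) (space (pos_part \<nu>)) \<noteq> \<infinity>" by (simp add: emeasure_pos_part)
qed

lemma measure_pos_part: "A \<in> sets borel \<Longrightarrow> measure (pos_part \<nu>) A = upper_variation \<nu> A"
  by (simp add: measure_def emeasure_pos_part upper_variation_nonneg)

end

text \<open>Passing from \<open>B\<close> to \<open>A - B\<close> turns the bound by the upper
  variation of \<open>\<nu>\<close> into a bound for \<open>- \<nu> B\<close>. The same inequality
  for \<open>- \<nu>\<close> gives the reverse estimate.\<close>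

lemma jordan_decomposition:
  assumes \<nu>: "signed_measure \<nu>" and A: "A \<in> sets borel"
  shows "measure (pos_part \<nu>) A - measure (pos_part (\<lambda>A. - \<nu> A)) A = \<nu> A"
proof -
  have le: "upper_variation (\<lambda>A. - \<nu> A) A \<le> upper_variation \<nu> A - \<nu> A" if "signed_measure \<nu>" for \<nu>
  proof (rule upper_variation_least[OF signed_measure_uminus[OF that]])
    fix B assume B: "B \<in> sets borel" "B \<subseteq> A"
    have "\<nu> (B \<union> (A - B)) = \<nu> B + \<nu> (A - B)" using A B by (intro signed_measure_Un[OF that]) auto
    moreover have "B \<union> (A - B) = A" using B by auto
    moreover have "\<nu> (A - B) \<le> upper_variation \<nu> A" using A B by (intro upper_variation_upper[OF that]) auto
    ultimately show "- \<nu> B \<le> upper_variation \<nu> A - \<nu> A" by simp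
  qed
  from le[OF \<nu>] le[OF signed_measure_uminus[OF \<nu>]] show ?thesis
    by (simp add: measure_pos_part[OF \<nu> A] measure_pos_part[OF signed_measure_uminus[OF \<nu>] A])
qed

section \<open>The four Jordan parts and the pairing\<close>

lemma norm_meas_of_le: "norm (meas_of m A) \<le> norm m"
proof (cases "A \<in> sets borel")
  case True
  thus ?thesis unfolding norm_cmeas_def
    using variation_sumsI[of "{A}" m] variation_sums_bdd[of m] by (intro cSup_upper) auto
qed (simp add: meas_of_nonborel)

text \<open>
  For \<open>k = 0, 1, 2, 3\<close> these are \<open>Re\<^sup>+, Im\<^sup>+, Re\<^sup>-, Im\<^sup>-\<close>, so that \<open>m\<close> is the sum of \<open>\<i>\<^sup>k\<close> times the \<open>k\<close>-th one.
\<close>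

definition jordan_part :: "'a::topological_space cmeas \<Rightarrow> nat \<Rightarrow> 'a measure" where
  "jordan_part m k = pos_part (\<lambda>A. Re ((- \<i>) ^ k * meas_of m A))"

lemma signed_measure_Re: "signed_measure (\<lambda>A. Re (c * meas_of m A))"
  unfolding signed_measure_def
proof (intro conjI allI impI)
  fix A :: "nat \<Rightarrow> 'a set" assume "range A \<subseteq> sets borel" "disjoint_family A"
  hence "(\<lambda>n. c * meas_of m (A n)) sums (c * meas_of m (\<Union>n. A n))"
    by (intro sums_mult meas_of_sums)
  thus "(\<lambda>n. Re (c * meas_of m (A n))) sums Re (c * meas_of m (\<Union>n. A n))" by (rule sums_Re)
next
  have "\<bar>Re (c * meas_of m A)\<bar> \<le> norm c * norm m" for A
  proof -
    have "\<bar>Re (c * meas_of m A)\<bar> \<le> norm (c * meas_of m A)" by (rule abs_Re_le_cmod)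
    also have "\<dots> \<le> norm c * norm m"
      unfolding norm_mult by (intro mult_left_mono norm_meas_of_le norm_ge_zero)
    finally show ?thesis .
  qed
  thus "\<exists>C. \<forall>A\<in>sets borel. \<bar>Re (c * meas_of m A)\<bar> \<le> C" by blast
qed

lemma sets_part [simp]: "sets (jordan_part m k) = sets borel"
  and finite_measure_part [simp]: "finite_measure (jordan_part m k)"
  unfolding jordan_part_def
  by (rule sets_pos_part[OF signed_measure_Re], rule finite_measure_pos_part[OF signed_measure_Re])

lemma space_part [simp]: "space (jordan_part m k) = UNIV"
  using sets_eq_imp_space_eq[OF sets_part] by simp

lemma measure_part_le: "measure (jordan_part m k) A \<le> norm m"
proof (cases "A \<in> sets borel")
  case True
  have "Re ((- \<i>) ^ k * meas_of m B) \<le> norm m" for B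
    using complex_Re_le_cmod[of "(- \<i>) ^ k * meas_of m B"] norm_meas_of_le[of m B]
    by (auto simp: norm_mult norm_power)
  thus ?thesis unfolding jordan_part_def measure_pos_part[OF signed_measure_Re True]
    by (intro upper_variation_least signed_measure_Re)
qed (simp add: measure_notin_sets)

lemma meas_of_part:
  assumes "A \<in> sets borel"
  shows "meas_of m A = (\<Sum>k<4. \<i> ^ k * of_real (measure (jordan_part m k) A))"
proof -
  have p: "jordan_part m 0 = pos_part (\<lambda>A. Re (meas_of m A))" "jordan_part m 2 = pos_part (\<lambda>A. - Re (meas_of m A))"
    "jordan_part m 1 = pos_part (\<lambda>A. Im (meas_of m A))" "jordan_part m 3 = pos_part (\<lambda>A. - Im (meas_of m A))"
    by (simp_all add: jordan_part_def power3_eq_cube)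
  have "signed_measure (\<lambda>A. Re (meas_of m A))" "signed_measure (\<lambda>A. Im (meas_of m A))"
    using signed_measure_Re[of 1 m] signed_measure_Re[of "- \<i>" m] by simp_all
  from this[THEN jordan_decomposition, OF assms, folded p]
  have "Re (meas_of m A) = measure (jordan_part m 0) A - measure (jordan_part m 2) A"
    "Im (meas_of m A) = measure (jordan_part m 1) A - measure (jordan_part m 3) A" by simp_all
  moreover have "{..<4::nat} = {0,1,2,3}" by auto
  ultimately show ?thesis by (simp add: complex_eq_iff power3_eq_cube)
qed

lemma pairing_part: "pairing f m = (\<Sum>k<4. \<i> ^ k * (\<integral>x. apply_bcontfun f x \<partial>jordan_part m k))"
proof -
  have p: "jordan_part m 0 = pos_part (\<lambda>A. Re (meas_of m A))" "jordan_part m 2 = pos_part (\<lambda>A. - Re (meas_of m A))"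
    "jordan_part m 1 = pos_part (\<lambda>A. Im (meas_of m A))" "jordan_part m 3 = pos_part (\<lambda>A. - Im (meas_of m A))"
    by (simp_all add: jordan_part_def power3_eq_cube)
  have "{..<4::nat} = {0,1,2,3}" by auto
  thus ?thesis
    unfolding pairing_def cmeas_integral_def p[symmetric] by (simp add: algebra_simps power3_eq_cube)
qed

lemma bcontfun_measurable: "apply_bcontfun f \<in> borel_measurable borel"
  by (rule borel_measurable_continuous_onI) simp

lemma bcontfun_integrable:
  fixes f :: "'a::topological_space \<Rightarrow>\<^sub>C complex"
  shows "finite_measure M \<Longrightarrow> sets M = sets borel \<Longrightarrow> integrable M (apply_bcontfun f)"
  by (rule integrable_bounded_borel[OF _ _ bcontfun_measurable norm_bounded])

lemma integral_linear_relation: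
  fixes f :: "'a::topological_space \<Rightarrow> complex" and c :: "'i \<Rightarrow> complex" and d :: "'j \<Rightarrow> complex"
  assumes M: "\<And>i. i \<in> I \<Longrightarrow> finite_measure (M i)" "\<And>i. i \<in> I \<Longrightarrow> sets (M i) = sets borel"
    and N: "\<And>j. j \<in> J \<Longrightarrow> finite_measure (N j)" "\<And>j. j \<in> J \<Longrightarrow> sets (N j) = sets borel"
    and eq: "\<And>A. A \<in> sets borel \<Longrightarrow>
      (\<Sum>i\<in>I. c i * of_real (measure (M i) A)) = (\<Sum>j\<in>J. d j * of_real (measure (N j) A))"
    and f: "f \<in> borel_measurable borel" "\<And>x. norm (f x) \<le> B"
  shows "(\<Sum>i\<in>I. c i * (\<integral>x. f x \<partial>M i)) = (\<Sum>j\<in>J. d j * (\<integral>x. f x \<partial>N j))"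
proof -
  obtain F where F: "\<And>i::nat. simple_function borel (F i)" "\<And>x. (\<lambda>i. F i x) \<longlonglongrightarrow> f x"
    "\<And>i x. dist (F i x) 0 \<le> 2 * dist (f x) 0"
    using borel_measurable_implies_sequence_metric[OF f(1), of 0] by auto
  have FB: "norm (F n x) \<le> 2 * B" for n x using F(3)[of n x] f(2)[of x] by simp
  have lim: "(\<lambda>n. \<integral>x. F n x \<partial>M) \<longlonglongrightarrow> (\<integral>x. f x \<partial>M)"
    if "finite_measure M" "sets M = sets borel" for M
  proof (rule integral_dominated_convergence[where w = "\<lambda>_. 2 * B"])
    show "f \<in> borel_measurable M" "\<And>n. F n \<in> borel_measurable M"
      using f(1) borel_measurable_simple_function[OF F(1)] that(2) by (simp_all cong: measurable_cong_sets)
  qed (use F FB that in \<open>auto simp: finite_measure.integrable_const\<close>)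
  have simple: "(\<integral>x. F n x \<partial>M) = (\<Sum>y\<in>range (F n). y * of_real (measure M (F n -` {y})))"
    if M: "finite_measure M" "sets M = sets borel" for M n
  proof -
    interpret finite_measure M by fact
    have sp: "space M = UNIV" using sets_eq_imp_space_eq[OF M(2)] by simp
    have s: "F n -` {y} \<in> sets M" for y
      using simple_functionD(2)[OF F(1), of n "{y}"] M(2) by simp
    have fin: "finite (range (F n))" using simple_functionD(1)[OF F(1), of n] by simp
    have "F n x = (\<Sum>y\<in>range (F n). indicator (F n -` {y}) x *\<^sub>R y)" for x
    proof -
      have "(\<Sum>y\<in>range (F n). indicator (F n -` {y}) x *\<^sub>R y) = (\<Sum>y\<in>range (F n). if y = F n x then y else 0)"
        by (intro sum.cong) (auto simp: indicator_def)
      thus ?thesis using fin by simp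
    qed
    hence "(\<integral>x. F n x \<partial>M) = (\<integral>x. (\<Sum>y\<in>range (F n). indicator (F n -` {y}) x *\<^sub>R y) \<partial>M)"
      by (intro Bochner_Integration.integral_cong refl)
    also have "\<dots> = (\<Sum>y\<in>range (F n). measure M (F n -` {y}) *\<^sub>R y)"
      using s by (subst Bochner_Integration.integral_sum) (auto simp: sp less_top[symmetric])
    finally show ?thesis by (simp add: scaleR_conv_of_real mult.commute)
  qed
  have "(\<Sum>i\<in>I. c i * (\<integral>x. F n x \<partial>M i)) = (\<Sum>j\<in>J. d j * (\<integral>x. F n x \<partial>N j))" for n
  proof -
    have "(\<Sum>i\<in>I. c i * (\<integral>x. F n x \<partial>M i)) =
        (\<Sum>y\<in>range (F n). y * (\<Sum>i\<in>I. c i * of_real (measure (M i) (F n -` {y}))))"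
      by (simp add: simple M sum_distrib_left sum.swap[of _ "range (F n)"] mult_ac)
    also have "\<dots> = (\<Sum>y\<in>range (F n). y * (\<Sum>j\<in>J. d j * of_real (measure (N j) (F n -` {y}))))"
      using simple_functionD(2)[OF F(1), of n] by (intro sum.cong arg_cong2[where f = "(*)"] eq) auto
    also have "\<dots> = (\<Sum>j\<in>J. d j * (\<integral>x. F n x \<partial>N j))"
      by (simp add: simple N sum_distrib_left sum.swap[of _ "range (F n)"] mult_ac)
    finally show ?thesis .
  qed
  moreover have "(\<lambda>n. \<Sum>i\<in>I. c i * (\<integral>x. F n x \<partial>M i)) \<longlonglongrightarrow> (\<Sum>i\<in>I. c i * (\<integral>x. f x \<partial>M i))"
    by (intro tendsto_intros lim M)
  moreover have "(\<lambda>n. \<Sum>j\<in>J. d j * (\<integral>x. F n x \<partial>N j)) \<longlonglongrightarrow> (\<Sum>j\<in>J. d j * (\<integral>x. f x \<partial>N j))"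
    by (intro tendsto_intros lim N)
  ultimately show ?thesis using LIMSEQ_unique by simp
qed

text \<open>Frees the pairing from the Jordan decomposition: any representation by finite measures
  computes it. Linearity in the measure rests on this.\<close>

lemma pairing_eqI:
  fixes m :: "'a::topological_space cmeas"
  assumes "\<And>i. i \<in> I \<Longrightarrow> finite_measure (N i)" "\<And>i. i \<in> I \<Longrightarrow> sets (N i) = sets borel"
    and "\<And>A. A \<in> sets borel \<Longrightarrow> meas_of m A = (\<Sum>i\<in>I. c i * of_real (measure (N i) A))"
  shows "pairing f m = (\<Sum>i\<in>I. c i * (\<integral>x. apply_bcontfun f x \<partial>N i))"
  unfolding pairing_part
proof (rule integral_linear_relation[where B = "norm f"])
  fix A :: "'a set" assume A: "A \<in> sets borel"
  show "(\<Sum>k<4. \<i> ^ k * of_real (measure (jordan_part m k) A)) = (\<Sum>i\<in>I. c i * of_real (measure (N i) A))"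
    using meas_of_part[OF A, of m] assms(3)[OF A] by (rule trans[OF sym])
qed (assumption | rule finite_measure_part sets_part assms(1,2) bcontfun_measurable norm_bounded)+

lemma pairing_add_right: "pairing f (m + n) = pairing f m + pairing f n"
proof -
  \<comment> \<open>The eight parts of \<open>m\<close> and \<open>n\<close> are merged into one
    family, with the Boolean selecting the measure.\<close>
  have split: "(\<Sum>i\<in>(UNIV :: bool set) \<times> {..<4::nat}. h i) = (\<Sum>k<4. h (True, k)) + (\<Sum>k<4. h (False, k))"
    for h :: "bool \<times> nat \<Rightarrow> complex"
    using sum.cartesian_product[of "\<lambda>b k. h (b, k)" "{..<4}" UNIV] by (simp add: UNIV_bool add.commute)
  define N where "N i = jordan_part (if fst i then m else n) (snd i)" for i :: "bool \<times> nat"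
  have "pairing f (m + n) = (\<Sum>i\<in>UNIV \<times> {..<4}. \<i> ^ snd i * (\<integral>x. apply_bcontfun f x \<partial>N i))"
    by (rule pairing_eqI) (simp_all only: split, simp_all add: N_def plus_cmeas.rep_eq meas_of_part)
  thus ?thesis by (simp add: split N_def pairing_part)
qed

lemma pairing_scale_right: "pairing f (scale_cmeas c m) = c * pairing f m"
proof -
  have "pairing f (scale_cmeas c m) = (\<Sum>k<4. (c * \<i> ^ k) * (\<integral>x. apply_bcontfun f x \<partial>jordan_part m k))"
    by (rule pairing_eqI) (auto simp: scale_cmeas.rep_eq meas_of_part sum_distrib_left mult_ac)
  thus ?thesis by (simp add: pairing_part sum_distrib_left mult_ac)
qed

lemma pairing_diff_right: "pairing f (m - n) = pairing f m - pairing f n"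
  using pairing_add_right[of f "m - n" n] by simp

lemma pairing_zero_right [simp]: "pairing f 0 = 0"
  using pairing_diff_right[of f 0 0] by simp

lemma scaleR_cmeas_conv: "r *\<^sub>R m = scale_cmeas (of_real r) m"
  by (simp add: meas_of_inject[symmetric] fun_eq_iff scaleR_cmeas.rep_eq scale_cmeas.rep_eq scaleR_conv_of_real)

lemma scaleR_cb_conv: "r *\<^sub>R f = scale_cb (of_real r) f"
  by (intro bcontfun_eqI) (simp add: scaleR_conv_of_real)

lemma pairing_add_left: "pairing (f + g) m = pairing f m + pairing g m"
proof -
  have "(\<integral>x. apply_bcontfun (f + g) x \<partial>jordan_part m k) =
      (\<integral>x. apply_bcontfun f x \<partial>jordan_part m k) + (\<integral>x. apply_bcontfun g x \<partial>jordan_part m k)" for k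
    unfolding plus_bcontfun.rep_eq
    by (intro Bochner_Integration.integral_add bcontfun_integrable finite_measure_part sets_part)
  thus ?thesis by (simp only: pairing_part sum.distrib distrib_left)
qed

lemma pairing_scale_left: "pairing (scale_cb c f) m = c * pairing f m"
proof -
  have "(\<integral>x. apply_bcontfun (scale_cb c f) x \<partial>jordan_part m k) = c * (\<integral>x. apply_bcontfun f x \<partial>jordan_part m k)" for k
    by simp
  thus ?thesis by (simp only: pairing_part sum_distrib_left mult.left_commute)
qed

lemma pairing_diff_left: "pairing (f - g) m = pairing f m - pairing g m"
  using pairing_add_left[of "f - g" g m] by simp

lemma pairing_zero_left [simp]: "pairing 0 m = 0"
  using pairing_diff_left[of 0 0 m] by simp

text \<open>Each of the four Jordan parts has mass at most \<open>norm m\<close> and is estimated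
  separately, whence the 4.\<close>

lemma norm_pairing_le: "norm (pairing f m) \<le> 4 * norm f * norm m"
proof -
  have "norm (\<i> ^ k * (\<integral>x. apply_bcontfun f x \<partial>jordan_part m k)) \<le> norm f * norm m" for k
  proof -
    have "norm (\<integral>x. apply_bcontfun f x \<partial>jordan_part m k) \<le> (\<integral>x. norm (apply_bcontfun f x) \<partial>jordan_part m k)"
      by (rule integral_norm_bound)
    also have "\<dots> \<le> (\<integral>x. norm f \<partial>jordan_part m k)"
      by (intro integral_mono integrable_norm bcontfun_integrable norm_bounded)
         (auto simp: finite_measure.integrable_const)
    also have "\<dots> \<le> norm f * norm m"
      using mult_left_mono[OF measure_part_le[of m k UNIV] norm_ge_zero[of f]] by (simp add: mult.commute)
    finally show ?thesis by (simp add: norm_mult norm_power)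
  qed
  hence "norm (pairing f m) \<le> (\<Sum>k<4::nat. norm f * norm m)"
    unfolding pairing_part by (intro sum_norm_le)
  thus ?thesis by simp
qed

section \<open>Tightness, positivity and separation by continuous functions\<close>

lemma finite_measure_inner_compact:
  fixes M :: "'a::polish_space measure"
  assumes "finite_measure M" "sets M = sets borel" "e > 0"
  obtains K where "compact K" "measure M (- K) < e"
proof -
  interpret finite_measure M by fact
  have sp: "space M = UNIV" using sets_eq_imp_space_eq[OF assms(2)] by simp
  show ?thesis
  \<comment> \<open>\<open>ennreal\<close> cuts off negative numbers, so
    \<open>measure M UNIV - e\<close> must be nonnegative before inner regularity is applied to
    it.\<close>
  proof (cases "measure M UNIV < e")
    case True thus ?thesis using that[of "{}"] by simp
  next
    case False
    have "emeasure M UNIV = (SUP K\<in>{K. K \<subseteq> UNIV \<and> compact K}. emeasure M K)"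
      by (rule inner_regular) (use assms(2) sp in auto)
    moreover have "ennreal (measure M UNIV - e) < emeasure M UNIV"
      using assms(3) False by (simp add: emeasure_eq_measure ennreal_less_iff)
    ultimately obtain K where K: "compact K" "ennreal (measure M UNIV - e) < emeasure M K"
      by (auto simp: less_SUP_iff)
    have "measure M UNIV - e < measure M K"
      using K(2) False by (simp add: emeasure_eq_measure ennreal_less_iff)
    moreover have "measure M (- K) = measure M UNIV - measure M K"
      using finite_measure_compl[of K] K(1) assms(2) by (simp add: sp Compl_eq_Diff_UNIV compact_imp_closed)
    ultimately show ?thesis using that[OF K(1)] by simp
  qed
qed

text \<open>The bridge from uniform convergence on compact sets to weak convergence. The compact set
  depends only on \<open>m\<close> and \<open>e\<close>, so it serves all members of a norm-bounded
  net at once.\<close>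

lemma pairing_tight:
  fixes m :: "'a::polish_space cmeas"
  assumes "e > 0"
  obtains K where "compact K"
    "\<And>(f :: 'a \<Rightarrow>\<^sub>C complex) D \<delta>. (\<And>x. x \<in> K \<Longrightarrow> norm (apply_bcontfun f x) \<le> \<delta>) \<Longrightarrow> norm f \<le> D \<Longrightarrow> 0 \<le> \<delta> \<Longrightarrow>
       norm (pairing f m) \<le> 4 * (\<delta> * norm m + D * e)"
proof -
  have "\<exists>K. compact K \<and> measure (jordan_part m k) (- K) < e" for k
    using finite_measure_inner_compact[OF finite_measure_part sets_part assms] by blast
  then obtain K where K: "\<And>k. compact (K k)" "\<And>k. measure (jordan_part m k) (- K k) < e" by metis
  define L where "L = (\<Union>k<4. K k)"
  have L: "compact L" unfolding L_def by (intro compact_UN) (auto simp: K)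
  show ?thesis
  proof (rule that[OF L])
    fix f :: "'a \<Rightarrow>\<^sub>C complex" and D \<delta> :: real
    assume f: "\<And>x. x \<in> L \<Longrightarrow> norm (apply_bcontfun f x) \<le> \<delta>" "norm f \<le> D" "0 \<le> \<delta>"
    have D: "D \<ge> 0" using f(2) norm_ge_zero[of f] by linarith
    have "norm (\<i> ^ k * (\<integral>x. apply_bcontfun f x \<partial>jordan_part m k)) \<le> \<delta> * norm m + D * e" if "k < 4" for k
    proof -
      interpret finite_measure "jordan_part m k" by simp
      have Ks: "- K k \<in> sets borel" using K(1)[of k] by (simp add: compact_imp_closed open_Compl)
      have "norm (\<integral>x. apply_bcontfun f x \<partial>jordan_part m k) \<le> (\<integral>x. norm (apply_bcontfun f x) \<partial>jordan_part m k)"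
        by (rule integral_norm_bound)
      also have "\<dots> \<le> (\<integral>x. \<delta> + D * indicator (- K k) x \<partial>jordan_part m k)"
      proof (rule integral_mono)
        fix x
        show "norm (apply_bcontfun f x) \<le> \<delta> + D * indicator (- K k) x"
        proof (cases "x \<in> K k")
          case True
          thus ?thesis using f(1)[of x] that by (auto simp: L_def)
        next
          case False
          thus ?thesis using norm_bounded[of f x] f(2,3) by simp
        qed
      qed (use Ks in \<open>auto intro!: integrable_norm bcontfun_integrable simp: less_top[symmetric]\<close>)
      also have "\<dots> = \<delta> * measure (jordan_part m k) UNIV + D * measure (jordan_part m k) (- K k)"
        using Ks by (subst Bochner_Integration.integral_add) (auto simp: less_top[symmetric])
      also have "\<dots> \<le> \<delta> * norm m + D * e"
        using K(2)[of k] measure_part_le[of m k UNIV] f(3) D by (intro add_mono mult_left_mono) auto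
      finally show ?thesis by (simp add: norm_mult norm_power)
    qed
    hence "norm (pairing f m) \<le> (\<Sum>k<4::nat. \<delta> * norm m + D * e)"
      unfolding pairing_part by (intro sum_norm_le) auto
    thus "norm (pairing f m) \<le> 4 * (\<delta> * norm m + D * e)" by simp
  qed
qed

definition of_measure :: "'a::topological_space measure \<Rightarrow> 'a cmeas" where
  "of_measure M = Cmeas (\<lambda>A. if A \<in> sets borel then of_real (measure M A) else 0)"

lemma meas_of_of_measure:
  assumes "finite_measure M" "sets M = sets borel" "A \<in> sets borel"
  shows "meas_of (of_measure M) A = of_real (measure M A)"
proof -
  have "(\<lambda>n. of_real (measure M (B n)) :: complex) sums of_real (measure M (\<Union>n. B n))"
    if "range B \<subseteq> sets borel" "disjoint_family B" for B :: "nat \<Rightarrow> 'a set"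
    using finite_measure.finite_measure_UNION[OF assms(1), of B] that assms(2) by (simp add: sums_of_real_iff)
  hence "complex_borel_measure (\<lambda>A. if A \<in> sets borel then of_real (measure M A) else 0 :: complex)"
    unfolding complex_borel_measure_def by (auto simp: subset_iff)
  thus ?thesis using assms(3) by (simp add: of_measure_def Cmeas_inverse)
qed

lemma pairing_of_measure:
  assumes "finite_measure M" "sets M = sets borel"
  shows "pairing f (of_measure M) = (\<integral>x. apply_bcontfun f x \<partial>M)"
proof -
  have "pairing f (of_measure M) = (\<Sum>i\<in>{()}. 1 * (\<integral>x. apply_bcontfun f x \<partial>M))"
    by (rule pairing_eqI) (use assms meas_of_of_measure in auto)
  thus ?thesis by simp
qed

lemma cmeas_eqI: "(\<And>A. A \<in> sets borel \<Longrightarrow> meas_of m A = meas_of n A) \<Longrightarrow> m = n"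
  by (metis ext meas_of_inject meas_of_nonborel)

lemma pos_cmeas_eq_of_measure:
  assumes "\<And>A. meas_of m A \<in> \<real>\<^sub>\<ge>\<^sub>0"
  shows "m = of_measure (jordan_part m 0)"
proof (rule cmeas_eqI)
  fix A :: "'a set" assume A: "A \<in> sets borel"
  have Re: "0 \<le> Re (meas_of m B)" and Im: "Im (meas_of m B) = 0" for B
    using assms[of B] by (auto simp: complex_nonneg_Reals_iff)
  have sg: "signed_measure (\<lambda>A. Re (meas_of m A))" using signed_measure_Re[of 1 m] by simp
  have "upper_variation (\<lambda>A. - Re (meas_of m A)) A = 0"
    using Re by (intro antisym upper_variation_least upper_variation_nonneg signed_measure_uminus sg) auto
  hence "measure (jordan_part m 0) A = Re (meas_of m A)"
    using jordan_decomposition[OF sg A] measure_pos_part[OF signed_measure_uminus[OF sg] A]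
    by (simp add: jordan_part_def)
  hence "meas_of m A = of_real (measure (jordan_part m 0) A)" using Im[of A] by (simp add: complex_eq_iff)
  thus "meas_of m A = meas_of (of_measure (jordan_part m 0)) A" using A by (simp add: meas_of_of_measure)
qed

lemma cmeas_decomposition: "m = (\<Sum>k<4. scale_cmeas (\<i> ^ k) (of_measure (jordan_part m k)))"
proof (rule cmeas_eqI)
  fix A :: "'a set" assume A: "A \<in> sets borel"
  have "meas_of (sum g F) A = (\<Sum>k\<in>F. meas_of (g k) A)" for g and F :: "nat set"
    by (induction F rule: infinite_finite_induct) (auto simp: zero_cmeas.rep_eq plus_cmeas.rep_eq)
  thus "meas_of m A = meas_of (\<Sum>k<4. scale_cmeas (\<i> ^ k) (of_measure (jordan_part m k))) A"
    unfolding meas_of_part[OF A, of m] using A by (simp add: scale_cmeas.rep_eq meas_of_of_measure)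
qed

definition of_real_cb :: "('a::topological_space \<Rightarrow> real) \<Rightarrow> ('a \<Rightarrow>\<^sub>C complex)" where
  "of_real_cb u = Bcontfun (\<lambda>x. of_real (u x))"

lemma apply_of_real_cb:
  assumes "continuous_on UNIV u" "bounded (range u)"
  shows "apply_bcontfun (of_real_cb u) x = of_real (u x)"
proof -
  have "(\<lambda>x. of_real (u x) :: complex) \<in> bcontfun"
    using assms by (auto simp: bcontfun_def bounded_iff intro!: continuous_intros)
  thus ?thesis by (simp add: of_real_cb_def Bcontfun_inverse)
qed

text \<open>The indicator of a closed set is a decreasing limit of continuous functions, which
  compares the measures on closed sets; inner regularity by compact sets extends this to Borel
  sets.\<close>

lemma measure_le_of_integral_le:
  fixes M N :: "'a::polish_space measure"
  assumes M: "finite_measure M" "sets M = sets borel" and N: "finite_measure N" "sets N = sets borel"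
    and le: "\<And>u. continuous_on UNIV u \<Longrightarrow> (\<And>x. 0 \<le> u x \<and> u x \<le> 1) \<Longrightarrow> (\<integral>x. u x \<partial>M) \<le> (\<integral>x. u x \<partial>N :: real)"
    and B: "B \<in> sets borel"
  shows "measure M B \<le> measure N B"
proof -
  have closed_le: "measure M K \<le> measure N K" if K: "closed K" "K \<noteq> {}" for K
  proof -
    define u where "u j x = max 0 (1 - real j * infdist x K)" for j :: nat and x
    have uc: "continuous_on UNIV (u j)" for j unfolding u_def by (intro continuous_intros)
    have u01: "0 \<le> u j x" "u j x \<le> 1" for j x by (auto simp: u_def infdist_nonneg)
    have ul: "(\<lambda>j. u j x) \<longlonglongrightarrow> indicator K x" for x
    proof (cases "x \<in> K")
      case False
      hence d: "infdist x K > 0" using K infdist_pos_not_in_closed by blast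
      then obtain N :: nat where N: "1 / infdist x K \<le> real N" using real_arch_simple by blast
      have "u j x = 0" if "j \<ge> N" for j
      proof -
        have "1 / infdist x K \<le> real j" using N that by linarith
        thus ?thesis using d by (simp add: u_def field_simps)
      qed
      hence "\<forall>\<^sub>F j in sequentially. u j x = 0" by (auto simp: eventually_sequentially)
      thus ?thesis using False by (simp add: tendsto_eventually)
    qed (simp add: u_def)
    have lim: "(\<lambda>j. \<integral>x. u j x \<partial>M) \<longlonglongrightarrow> measure M K" if "finite_measure M" "sets M = sets borel" for M
    proof -
      have "space M = UNIV" using sets_eq_imp_space_eq[OF that(2)] by simp
      moreover have "(\<lambda>j. \<integral>x. u j x \<partial>M) \<longlonglongrightarrow> (\<integral>x. indicator K x \<partial>M)"
      proof (rule integral_dominated_convergence[where w = "\<lambda>_. 1"])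
        have "(indicator K :: 'a \<Rightarrow> real) \<in> borel_measurable borel" using K by (intro borel_measurable_indicator) auto
        thus "(indicator K :: 'a \<Rightarrow> real) \<in> borel_measurable M" using that(2) by (simp cong: measurable_cong_sets)
        show "\<And>j. u j \<in> borel_measurable M"
          using borel_measurable_continuous_onI[OF uc] that(2) by (simp cong: measurable_cong_sets)
      qed (use K ul u01 that in \<open>auto simp: finite_measure.integrable_const borel_closed\<close>)
      ultimately show ?thesis by simp
    qed
    show ?thesis
      by (rule LIMSEQ_le[OF lim[OF M] lim[OF N]]) (use le[OF uc] u01 in blast)
  qed
  interpret M: finite_measure M by fact
  interpret N: finite_measure N by fact
  have sp: "space M = UNIV" using sets_eq_imp_space_eq[OF M(2)] by simp
  have "emeasure M B = (SUP K\<in>{K. K \<subseteq> B \<and> compact K}. emeasure M K)"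
    by (rule inner_regular[OF M(2) _ B]) (simp add: sp)
  also have "\<dots> \<le> emeasure N B"
  proof (rule SUP_least)
    fix K assume K: "K \<in> {K. K \<subseteq> B \<and> compact K}"
    have "emeasure M K \<le> emeasure N K"
      using closed_le[of K] K by (cases "K = {}") (auto simp: M.emeasure_eq_measure N.emeasure_eq_measure compact_imp_closed)
    also have "\<dots> \<le> emeasure N B" using K B N(2) by (intro emeasure_mono) auto
    finally show "emeasure M K \<le> emeasure N B" .
  qed
  finally show ?thesis by (simp add: M.emeasure_eq_measure N.emeasure_eq_measure)
qed

text \<open>Positivity on functions orders the integrals of the Jordan parts: the negative real part
  is dominated by the positive one, and the two imaginary parts agree.
  \<open>measure_le_of_integral_le\<close> carries this over to sets.\<close>

lemma meas_of_nonneg: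
  fixes m :: "'a::polish_space cmeas"
  assumes pos: "\<And>f. (\<And>x. apply_bcontfun f x \<in> \<real>\<^sub>\<ge>\<^sub>0) \<Longrightarrow> pairing f m \<in> \<real>\<^sub>\<ge>\<^sub>0"
  shows "meas_of m A \<in> \<real>\<^sub>\<ge>\<^sub>0"
proof (cases "A \<in> sets borel")
  case True
  have set4: "{..<4::nat} = {0,1,2,3}" by auto
  have rel: "(\<integral>x. u x \<partial>jordan_part m 2) \<le> (\<integral>x. u x \<partial>jordan_part m 0)" "(\<integral>x. u x \<partial>jordan_part m 3) = (\<integral>x. u x \<partial>jordan_part m 1)"
    if u: "continuous_on UNIV u" "\<And>x. 0 \<le> u x \<and> u x \<le> 1" for u :: "'a \<Rightarrow> real"
  proof -
    have b: "bounded (range u)" using u(2) by (intro boundedI[of _ 1]) auto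
    have "pairing (of_real_cb u) m \<in> \<real>\<^sub>\<ge>\<^sub>0"
      using u(2) by (intro pos) (simp add: apply_of_real_cb[OF u(1) b])
    moreover have "pairing (of_real_cb u) m = of_real ((\<integral>x. u x \<partial>jordan_part m 0) - (\<integral>x. u x \<partial>jordan_part m 2))
        + \<i> * of_real ((\<integral>x. u x \<partial>jordan_part m 1) - (\<integral>x. u x \<partial>jordan_part m 3))"
      unfolding pairing_part apply_of_real_cb[OF u(1) b] set4
      by (simp add: algebra_simps power3_eq_cube)
    ultimately show "(\<integral>x. u x \<partial>jordan_part m 2) \<le> (\<integral>x. u x \<partial>jordan_part m 0)" "(\<integral>x. u x \<partial>jordan_part m 3) = (\<integral>x. u x \<partial>jordan_part m 1)"
      by (auto simp: complex_nonneg_Reals_iff)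
  qed
  have "measure (jordan_part m 2) A \<le> measure (jordan_part m 0) A" "measure (jordan_part m 3) A \<le> measure (jordan_part m 1) A"
    "measure (jordan_part m 1) A \<le> measure (jordan_part m 3) A"
    using rel True by (auto intro!: measure_le_of_integral_le)
  thus ?thesis unfolding meas_of_part[OF True] set4 by (simp add: complex_nonneg_Reals_iff power3_eq_cube)
qed (simp add: meas_of_nonborel)

text \<open>Both \<open>m - n\<close> and \<open>n - m\<close> pair to 0 with every function, so
  both are nonnegative.\<close>

lemma pairing_separates_measures:
  fixes m :: "'a::polish_space cmeas"
  assumes "\<And>f. pairing f m = pairing f n"
  shows "m = n"
proof (rule cmeas_eqI)
  fix A :: "'a set"
  have "meas_of (m - n) A \<in> \<real>\<^sub>\<ge>\<^sub>0" "meas_of (n - m) A \<in> \<real>\<^sub>\<ge>\<^sub>0"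
    using assms by (auto intro!: meas_of_nonneg simp: pairing_diff_right)
  thus "meas_of m A = meas_of n A" by (auto simp: minus_cmeas.rep_eq complex_nonneg_Reals_iff complex_eq_iff)
qed

lemma meas_of_dirac_nonneg: "meas_of (dirac x) A \<in> \<real>\<^sub>\<ge>\<^sub>0"
  by (auto simp: dirac.rep_eq indicator_def)

lemma pairing_dirac [simp]: "pairing f (dirac x) = apply_bcontfun f (x :: 'a::polish_space)"
proof -
  have m: "dirac x = of_measure (jordan_part (dirac x) 0)" by (rule pos_cmeas_eq_of_measure[OF meas_of_dirac_nonneg])
  let ?M = "jordan_part (dirac x) 0"
  interpret finite_measure ?M by simp
  have xs: "{x} \<in> sets borel" "- {x} \<in> sets borel" by auto
  have "meas_of (dirac x) (- {x}) = of_real (measure ?M (- {x}))" "meas_of (dirac x) {x} = of_real (measure ?M {x})"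
    using meas_of_of_measure[of ?M "- {x}"] meas_of_of_measure[of ?M "{x}"] m xs by auto
  hence ms: "measure ?M (- {x}) = 0" "measure ?M {x} = 1" using xs by (auto simp: dirac.rep_eq)
  have "AE y in ?M. y = x"
    by (rule AE_I[of _ _ "- {x}"]) (use ms xs in \<open>auto simp: emeasure_eq_measure\<close>)
  hence "(\<integral>y. apply_bcontfun f y \<partial>?M) = (\<integral>y. indicator {x} y *\<^sub>R apply_bcontfun f x \<partial>?M)"
    using bcontfun_integrable[of ?M f] xs
    by (intro integral_cong_AE) (auto simp: less_top[symmetric] intro!: borel_measurable_scaleR borel_measurable_indicator)
  also have "\<dots> = apply_bcontfun f x" using ms xs by (simp add: less_top[symmetric])
  finally show ?thesis using pairing_of_measure[of ?M f] m by simp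
qed

lemma bcontfun_eq_pairingI: "(\<And>m. pairing f m = pairing g m) \<Longrightarrow> f = g"
  for f g :: "'a::polish_space \<Rightarrow>\<^sub>C complex"
  by (rule bcontfun_eqI) (metis pairing_dirac)

definition nonneg_cmeas :: "'a::topological_space cmeas \<Rightarrow> bool" where "nonneg_cmeas m \<longleftrightarrow> (\<forall>B. meas_of m B \<in> \<real>\<^sub>\<ge>\<^sub>0)"

lemma pairing_pos: "nonneg_cmeas m \<Longrightarrow> pairing f m = (\<integral>x. apply_bcontfun f x \<partial>jordan_part m 0)"
  using pos_cmeas_eq_of_measure[of m] pairing_of_measure[of "jordan_part m 0" f] by (simp add: nonneg_cmeas_def)

lemma pairing_of_real_cb:
  assumes "nonneg_cmeas m" "continuous_on UNIV u" "bounded (range u)"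
  shows "pairing (of_real_cb u) m = of_real (\<integral>x. u x \<partial>jordan_part m 0)"
  using assms by (simp add: pairing_pos apply_of_real_cb)

lemma pos_of_measure:
  assumes "finite_measure M" "sets M = sets borel"
  shows "nonneg_cmeas (of_measure M)"
  unfolding nonneg_cmeas_def using meas_of_of_measure[OF assms] meas_of_nonborel
  by (metis complex_nonneg_Reals_iff Im_complex_of_real Re_complex_of_real measure_nonneg zero_complex.simps order_refl)

lemma pos_dirac: "nonneg_cmeas (dirac x)"
  by (simp add: nonneg_cmeas_def meas_of_dirac_nonneg)

lemma pairing_pos_nonneg:
  assumes "nonneg_cmeas m" "\<And>x. apply_bcontfun f x \<in> \<real>\<^sub>\<ge>\<^sub>0"
  shows "pairing f m \<in> \<real>\<^sub>\<ge>\<^sub>0"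
proof -
  have "(\<integral>x. apply_bcontfun f x \<partial>jordan_part m 0) = (\<integral>x. of_real (Re (apply_bcontfun f x)) \<partial>jordan_part m 0)"
    using assms(2) by (intro Bochner_Integration.integral_cong) (auto simp: complex_nonneg_Reals_iff complex_eq_iff)
  moreover have "0 \<le> (\<integral>x. Re (apply_bcontfun f x) \<partial>jordan_part m 0)"
    using assms(2) by (intro Bochner_Integration.integral_nonneg) (auto simp: complex_nonneg_Reals_iff)
  ultimately show ?thesis by (simp add: pairing_pos[OF assms(1)] complex_nonneg_Reals_iff)
qed

lemma tendsto_pairing_left:
  assumes "((\<lambda>a. h a) \<longlongrightarrow> 0) F"
  shows "((\<lambda>a. pairing (h a) m) \<longlongrightarrow> 0) F"
proof (rule Lim_null_comparison)
  show "\<forall>\<^sub>F a in F. norm (pairing (h a) m) \<le> 4 * norm (h a) * norm m"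
    by (simp add: norm_pairing_le)
  have "((\<lambda>a. 4 * norm (h a) * norm m) \<longlongrightarrow> 4 * 0 * norm m) F"
    by (intro tendsto_intros tendsto_norm_zero assms)
  thus "((\<lambda>a. 4 * norm (h a) * norm m) \<longlongrightarrow> 0) F" by simp
qed

lemma tendsto_pairing_right:
  assumes "((\<lambda>a. k a) \<longlongrightarrow> 0) F"
  shows "((\<lambda>a. pairing f (k a)) \<longlongrightarrow> 0) F"
proof (rule Lim_null_comparison)
  show "\<forall>\<^sub>F a in F. norm (pairing f (k a)) \<le> 4 * norm f * norm (k a)"
    by (simp add: norm_pairing_le)
  have "((\<lambda>a. 4 * norm f * norm (k a)) \<longlongrightarrow> 4 * norm f * 0) F"
    by (intro tendsto_intros tendsto_norm_zero assms)
  thus "((\<lambda>a. 4 * norm f * norm (k a)) \<longlongrightarrow> 0) F" by simp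
qed

lemma bcontfun_Re_Im:
  fixes f :: "'a::topological_space \<Rightarrow>\<^sub>C complex"
  defines "u \<equiv> \<lambda>x. Re (apply_bcontfun f x)" and "v \<equiv> \<lambda>x. Im (apply_bcontfun f x)"
  shows "continuous_on UNIV u" "bounded (range u)" "continuous_on UNIV v" "bounded (range v)"
    "f = of_real_cb u + scale_cb \<i> (of_real_cb v)"
proof -
  show c: "continuous_on UNIV u" "continuous_on UNIV v"
    unfolding u_def v_def
    by (rule continuous_on_Re[OF continuous_on_apply_bcontfun], rule continuous_on_Im[OF continuous_on_apply_bcontfun])
  have "norm (u x) \<le> norm f" "norm (v x) \<le> norm f" for x
    using abs_Re_le_cmod[of "apply_bcontfun f x"] abs_Im_le_cmod[of "apply_bcontfun f x"] norm_bounded[of f x]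
    by (auto simp: u_def v_def)
  thus b: "bounded (range u)" "bounded (range v)" by (auto intro!: boundedI[of _ "norm f"])
  show "f = of_real_cb u + scale_cb \<i> (of_real_cb v)"
    by (rule bcontfun_eqI)
       (simp add: plus_bcontfun.rep_eq apply_of_real_cb[OF c(1) b(1)] apply_of_real_cb[OF c(2) b(2)],
        simp add: u_def v_def complex_eq[symmetric])
qed

lemma of_real_cb_Lip_b:
  assumes "L-lipschitz_on UNIV u" "bounded (range u)"
  shows "of_real_cb u \<in> Lip_b"
proof -
  have "apply_bcontfun (of_real_cb u) x = of_real (u x)" for x
    using assms lipschitz_on_continuous_on by (intro apply_of_real_cb) auto
  hence "L-lipschitz_on UNIV (apply_bcontfun (of_real_cb u))"
    using assms(1) by (simp add: lipschitz_on_def dist_of_real)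
  thus ?thesis unfolding Lip_b_def by blast
qed


section \<open>Weak and strict topologies, adjoints and nets\<close>

lemma limitin_topology_generated_by:
  assumes "l \<in> \<Union>S" "\<And>U. U \<in> S \<Longrightarrow> l \<in> U \<Longrightarrow> \<forall>\<^sub>F a in F. x a \<in> U"
  shows "limitin (topology_generated_by S) x l F"
proof -
  have "l \<in> U \<longrightarrow> (\<forall>\<^sub>F a in F. x a \<in> U)" if "generate_topology_on S U" for U
    using that
  proof induction
    case (Int U V) thus ?case by (auto intro: eventually_conj)
  next
    case (UN \<U>) thus ?case by (fastforce elim: eventually_mono)
  qed (use assms in auto)
  thus ?thesis using assms(1) by (simp add: limitin_def openin_topology_generated_by_iff)
qed

lemma openin_weak_topology: "open U \<Longrightarrow> openin (weak_topology b) {x. b x y \<in> U}"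
  unfolding weak_topology_def by (rule topology_generated_by_Basis) blast

lemma topspace_weak_topology [simp]: "topspace (weak_topology b) = UNIV"
  using openin_subset[OF openin_weak_topology[OF open_UNIV, of b]] by auto

lemma limitin_weak_topology:
  "limitin (weak_topology b) x l F \<longleftrightarrow> (\<forall>y. ((\<lambda>a. b (x a) y) \<longlongrightarrow> b l y) F)"
proof
  assume lim: "limitin (weak_topology b) x l F"
  show "\<forall>y. ((\<lambda>a. b (x a) y) \<longlongrightarrow> b l y) F"
  proof (intro allI topological_tendstoI)
    fix y U assume U: "open U" "b l y \<in> U"
    have "\<forall>\<^sub>F a in F. x a \<in> {x. b x y \<in> U}"
      using lim openin_weak_topology[OF U(1), of b y] U(2) unfolding limitin_def by blast
    thus "\<forall>\<^sub>F a in F. b (x a) y \<in> U" by simp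
  qed
next
  assume lim: "\<forall>y. ((\<lambda>a. b (x a) y) \<longlongrightarrow> b l y) F"
  show "limitin (weak_topology b) x l F" unfolding weak_topology_def
  proof (rule limitin_topology_generated_by)
    have "{x. b x undefined \<in> UNIV} \<in> {{x. b x y \<in> U} |y U. open U}" using open_UNIV by blast
    thus "l \<in> \<Union>{{x. b x y \<in> U} |y U. open U}" by (rule UnionI) simp
  next
    fix U assume "U \<in> {{x. b x y \<in> U} |y U. open U}" "l \<in> U"
    then obtain y V where "U = {x. b x y \<in> V}" "open V" "b l y \<in> V" by blast
    thus "\<forall>\<^sub>F a in F. x a \<in> U" using topological_tendstoD[OF lim[rule_format, of y]] by simp
  qed
qed

lemma closedin_weak_topology: "closed C \<Longrightarrow> closedin (weak_topology b) {x. b x y \<in> C}"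
  using openin_weak_topology[of "- C" b y]
  by (simp add: closedin_def open_Compl Compl_eq[symmetric] Compl_eq_Diff_UNIV[symmetric] Collect_neg_eq[symmetric])

lemma weak_closure_in_closed:
  assumes "p \<in> weak_topology b closure_of W" "closed C" "\<And>x. x \<in> W \<Longrightarrow> b x y \<in> C"
  shows "b p y \<in> C"
proof -
  have "weak_topology b closure_of W \<subseteq> {x. b x y \<in> C}"
    using assms by (intro closure_of_minimal closedin_weak_topology) auto
  thus ?thesis using assms(1) by blast
qed

text \<open>The form in which (AS2) is applied to the averages: a closed convex condition on one
  pairing passes from an orbit to its weakly closed hull.\<close>

lemma weak_closure_hull_in_closed:
  assumes p: "p \<in> weak_topology b closure_of (convex hull W)"
    and C: "closed C" "convex C" and W: "\<And>x. x \<in> W \<Longrightarrow> b x y \<in> C"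
    and lin: "\<And>u v. b (u + v) y = b u y + b v y" "\<And>r u. b (r *\<^sub>R u) y = of_real r * b u y"
  shows "b p y \<in> C"
proof (rule weak_closure_in_closed[OF p C(1)])
  have "convex {x. b x y \<in> C}"
    using C(2) by (auto simp: convex_def lin scaleR_conv_of_real)
  hence "convex hull W \<subseteq> {x. b x y \<in> C}" using W by (intro hull_minimal) auto
  thus "b x y \<in> C" if "x \<in> convex hull W" for x using that by blast
qed

lemma weak_topology_nbhd:
  assumes "openin (weak_topology b) U" "x \<in> U"
  obtains Y e where "finite Y" "e > 0" "\<forall>z. (\<forall>y\<in>Y. norm (b z y - b x y) < e) \<longrightarrow> z \<in> U"
proof -
  have "x \<in> U \<longrightarrow> (\<exists>Y e. finite Y \<and> e > 0 \<and> (\<forall>z. (\<forall>y\<in>Y. norm (b z y - b x y) < e) \<longrightarrow> z \<in> U))"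
    if "generate_topology_on {{x. b x y \<in> U} | y U. open U} U" for U
    using that
  proof induction
    case (Int U V)
    show ?case
    proof
      assume "x \<in> U \<inter> V"
      then obtain Y1 e1 Y2 e2 where "finite Y1" "e1 > 0" "finite Y2" "e2 > 0"
        and 1: "\<And>z. (\<forall>y\<in>Y1. norm (b z y - b x y) < e1) \<Longrightarrow> z \<in> U"
        and 2: "\<And>z. (\<forall>y\<in>Y2. norm (b z y - b x y) < e2) \<Longrightarrow> z \<in> V"
        using Int.IH by blast
      thus "\<exists>Y e. finite Y \<and> e > 0 \<and> (\<forall>z. (\<forall>y\<in>Y. norm (b z y - b x y) < e) \<longrightarrow> z \<in> U \<inter> V)"
        by (intro exI[of _ "Y1 \<union> Y2"] exI[of _ "min e1 e2"]) auto
    qed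
  next
    case (UN \<U>)
    show ?case
    proof
      assume "x \<in> \<Union>\<U>"
      then obtain S where S: "S \<in> \<U>" "x \<in> S" by blast
      with UN.IH obtain Y e where "finite Y" "e > 0" "\<forall>z. (\<forall>y\<in>Y. norm (b z y - b x y) < e) \<longrightarrow> z \<in> S"
        by blast
      thus "\<exists>Y e. finite Y \<and> e > 0 \<and> (\<forall>z. (\<forall>y\<in>Y. norm (b z y - b x y) < e) \<longrightarrow> z \<in> \<Union>\<U>)"
        using S(1) by (intro exI[of _ Y] exI[of _ e]) auto
    qed
  next
    case (Basis S)
    then obtain y V where V: "S = {x. b x y \<in> V}" "open V" by blast
    show ?case
    proof
      assume "x \<in> S"
      then obtain e where "e > 0" "\<And>w. dist w (b x y) < e \<Longrightarrow> w \<in> V" using V by (auto simp: open_dist)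
      thus "\<exists>Y e. finite Y \<and> e > 0 \<and> (\<forall>z. (\<forall>y\<in>Y. norm (b z y - b x y) < e) \<longrightarrow> z \<in> S)"
        by (intro exI[of _ "{y}"] exI[of _ e]) (auto simp: V dist_norm)
    qed
  qed simp
  from this[of U] assms
  obtain Y e where "finite Y" "e > 0" "\<forall>z. (\<forall>y\<in>Y. norm (b z y - b x y) < e) \<longrightarrow> z \<in> U"
    unfolding weak_topology_def openin_topology_generated_by_iff by auto
  thus ?thesis by (rule that)
qed

text \<open>A functional vanishing on the common kernel of finitely many functionals is a
  combination of them, and a combination of pairings is the pairing with one measure. One measure is
  eliminated at a time.\<close>

lemma functional_in_span_of_pairings:
  fixes \<phi> :: "('a::topological_space \<Rightarrow>\<^sub>C complex) \<Rightarrow> complex"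
  assumes "finite Y"
    and "\<And>f g. \<phi> (f + g) = \<phi> f + \<phi> g" "\<And>c f. \<phi> (scale_cb c f) = c * \<phi> f"
    and "\<And>f. (\<And>y. y \<in> Y \<Longrightarrow> pairing f y = 0) \<Longrightarrow> \<phi> f = 0"
  shows "\<exists>n. \<forall>f. \<phi> f = pairing f n"
  using assms
proof (induction Y arbitrary: \<phi> rule: finite_induct)
  case empty
  thus ?case by (intro exI[of _ 0]) simp
next
  case (insert y0 Y)
  have neg: "\<phi> (f - g) = \<phi> f - \<phi> g" for f g
    using insert.prems(1)[of "f - g" g] by simp
  show ?case
  proof (cases "\<forall>f. (\<forall>y\<in>Y. pairing f y = 0) \<longrightarrow> pairing f y0 = 0")
    case True
    show ?thesis
    proof (rule insert.IH)
      fix f assume "\<And>y. y \<in> Y \<Longrightarrow> pairing f y = 0"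
      thus "\<phi> f = 0" using True by (intro insert.prems(3)) auto
    qed (use insert.prems(1,2) in auto)
  next
    case False
    then obtain f1 where f1: "\<forall>y\<in>Y. pairing f1 y = 0" "pairing f1 y0 \<noteq> 0" by blast
    define f0 where "f0 = scale_cb (inverse (pairing f1 y0)) f1"
    have f0: "\<And>y. y \<in> Y \<Longrightarrow> pairing f0 y = 0" "pairing f0 y0 = 1"
      using f1 by (auto simp: f0_def pairing_scale_left)
    \<comment> \<open>Removes the component detected by \<open>y0\<close>, so that the remainder
      vanishes on the common kernel of \<open>Y\<close> alone.\<close>
    define \<psi> where "\<psi> f = \<phi> f - pairing f y0 * \<phi> f0" for f
    have "\<exists>n. \<forall>f. \<psi> f = pairing f n"
    proof (rule insert.IH)
      show "\<psi> (f + g) = \<psi> f + \<psi> g" for f g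
        by (simp add: \<psi>_def insert.prems(1) pairing_add_left algebra_simps)
      show "\<psi> (scale_cb c f) = c * \<psi> f" for c f
        by (simp add: \<psi>_def insert.prems(2) pairing_scale_left algebra_simps)
      fix f assume f: "\<And>y. y \<in> Y \<Longrightarrow> pairing f y = 0"
      have "\<phi> (f - scale_cb (pairing f y0) f0) = 0"
        by (rule insert.prems(3)) (use f f0 in \<open>auto simp: pairing_diff_left pairing_scale_left\<close>)
      thus "\<psi> f = 0" by (simp add: neg insert.prems(2) \<psi>_def)
    qed
    then obtain n where n: "\<And>f. \<psi> f = pairing f n" by blast
    have "\<phi> f = pairing f (n + scale_cmeas (\<phi> f0) y0)" for f
      using n[of f] by (simp add: \<psi>_def pairing_add_right pairing_scale_right algebra_simps)
    thus ?thesis by blast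
  qed
qed

section \<open>Adjoints of weakly continuous operators\<close>

lemma sigma_operators_add: "S \<in> sigma_operators \<Longrightarrow> S (f + g) = S f + S g"
  and sigma_operators_scale: "S \<in> sigma_operators \<Longrightarrow> S (scale_cb c f) = scale_cb c (S f)"
  by (auto simp: sigma_operators_def Vector_Spaces.linear_def module_hom_def module_hom_axioms_def)

lemma sigma_operators_diff:
  assumes "S \<in> sigma_operators"
  shows "S (f - g) = S f - S g"
  using sigma_operators_add[OF assms, of "f - g" g] by simp

text \<open>Weak continuity bounds the functional \<open>\<lambda>f. pairing (S f) m\<close> near 0
  and so makes it vanish on the common kernel of finitely many measures; this gives existence of the
  adjoint. Uniqueness is separation of measures by functions.\<close>

lemma pairing_sigma_adjoint:
  fixes m :: "'a::polish_space cmeas"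
  assumes S: "S \<in> sigma_operators"
  shows "pairing f (sigma_adjoint S m) = pairing (S f) m"
proof -
  define U where "U = {f. S f \<in> {g. pairing g m \<in> ball 0 1}}"
  have S0: "S 0 = 0" using sigma_operators_add[OF S, of 0 0] by simp
  have U: "openin sigma_fun U"
    using openin_continuous_map_preimage[of sigma_fun sigma_fun S "{g. pairing g m \<in> ball 0 1}"]
      openin_weak_topology[OF open_ball, of pairing m 0 1] S
    by (simp add: U_def sigma_operators_def)
  have U0: "0 \<in> U" by (simp add: U_def S0)
  obtain Y e where Y: "finite Y" "e > 0"
      "\<forall>z. (\<forall>y\<in>Y. norm (pairing z y - pairing 0 y) < e) \<longrightarrow> z \<in> U"
    by (rule weak_topology_nbhd[OF U U0])
  have "\<exists>n. \<forall>f. pairing (S f) m = pairing f n"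
  proof (rule functional_in_span_of_pairings[OF Y(1)])
    show "pairing (S (f + g)) m = pairing (S f) m + pairing (S g) m" for f g
      by (simp add: sigma_operators_add[OF S] pairing_add_left)
    show "pairing (S (scale_cb c f)) m = c * pairing (S f) m" for c f
      by (simp add: sigma_operators_scale[OF S] pairing_scale_left)
    fix f assume f: "\<And>y. y \<in> Y \<Longrightarrow> pairing f y = 0"
    show "pairing (S f) m = 0"
    proof (rule ccontr)
      assume ne: "pairing (S f) m \<noteq> 0"
      \<comment> \<open>Scaling does not leave the common kernel, and the multiple on which the
        functional takes the value 1 lies outside the open unit ball defining
        \<open>U\<close>.\<close>
      have "scale_cb (inverse (pairing (S f) m)) f \<in> U"
        using f Y(2) by (intro Y(3)[rule_format]) (simp add: pairing_scale_left)
      thus False using ne by (simp add: U_def sigma_operators_scale[OF S] pairing_scale_left)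
    qed
  qed
  then obtain n where n: "\<forall>f. pairing (S f) m = pairing f n" by blast
  have "sigma_adjoint S m = n"
    unfolding sigma_adjoint_def
  proof (rule the_equality)
    fix n' assume "\<forall>f. pairing (S f) m = pairing f n'"
    thus "n' = n" using n by (intro pairing_separates_measures) simp
  qed (rule n)
  thus ?thesis using n by simp
qed

text \<open>Replaces subnets by filters \<open>G\<close> finer than the tails, which can be
  restricted freely. The subnet realising \<open>G\<close> consists of pairs (i, B) with i in B and
  B a set of \<open>G\<close>, ordered by reverse inclusion of the sets.\<close>

lemma net_clusters_filter:
  fixes \<Lambda> :: "'a set"
  assumes cl: "net_clusters T \<Lambda> le x" and dir: "directed_on \<Lambda> le"
    and G: "G \<noteq> bot" "G \<le> net_filter \<Lambda> le"
  obtains p where "p \<in> topspace T" "\<And>U. openin T U \<Longrightarrow> p \<in> U \<Longrightarrow> \<exists>\<^sub>F a in G. x a \<in> U"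
proof -
  define M where "M = {(i, B). i \<in> B \<and> B \<subseteq> \<Lambda> \<and> eventually (\<lambda>i. i \<in> B) G}"
  define leM where "leM = (\<lambda>(i :: 'a, B :: 'a set) (j :: 'a, C). C \<subseteq> B)"
  have "\<Lambda> \<noteq> {}" using dir by (simp add: directed_on_def)
  hence "eventually (\<lambda>i. i \<in> \<Lambda>) (net_filter \<Lambda> le)" by (auto simp: eventually_net_filter[OF dir])
  hence \<Lambda>: "eventually (\<lambda>i. i \<in> \<Lambda>) G" by (rule filter_leD[OF G(2)])
  have ne: "\<exists>i. i \<in> B" if "eventually (\<lambda>i. i \<in> B) G" for B
    using eventually_happens'[OF G(1) that] .
  have "directed_on M leM"
    unfolding directed_on_def
  proof (intro conjI ballI impI)
    show "M \<noteq> {}" using \<Lambda> ne[OF \<Lambda>] by (auto simp: M_def)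
    fix a b assume ab: "a \<in> M" "b \<in> M"
    obtain i B j C where eq: "a = (i, B)" "b = (j, C)" by (cases a, cases b)
    have "eventually (\<lambda>i. i \<in> B \<inter> C) G"
      using ab by (auto simp: M_def eq intro: eventually_conj)
    moreover from ne[OF this] obtain k where "k \<in> B \<inter> C" by blast
    ultimately have "(k, B \<inter> C) \<in> M" using ab by (auto simp: M_def eq)
    thus "\<exists>c\<in>M. leM a c \<and> leM b c" by (rule bexI[rotated]) (auto simp: leM_def eq)
  qed (auto simp: leM_def)
  moreover have "fst ` M \<subseteq> \<Lambda>" by (auto simp: M_def)
  moreover have "\<exists>i\<in>M. \<forall>j\<in>M. leM i j \<longrightarrow> le a (fst j)" if a: "a \<in> \<Lambda>" for a
  proof -
    have "eventually (\<lambda>b. b \<in> \<Lambda> \<and> le a b) (net_filter \<Lambda> le)"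
      unfolding eventually_net_filter[OF dir] using a by blast
    hence ev: "eventually (\<lambda>b. b \<in> {b\<in>\<Lambda>. le a b}) G" using filter_leD[OF G(2)] by simp
    then obtain k where "k \<in> {b\<in>\<Lambda>. le a b}" using ne by blast
    hence "(k, {b\<in>\<Lambda>. le a b}) \<in> M" using ev by (auto simp: M_def)
    thus ?thesis by (rule bexI[rotated]) (auto simp: leM_def M_def)
  qed
  ultimately have "subnet_map M leM \<Lambda> le fst" by (simp add: subnet_map_def)
  then obtain p where p: "net_cluster_point T M leM (x \<circ> fst) p"
    using cl unfolding net_clusters_def by blast
  show ?thesis
  proof (rule that)
    show "p \<in> topspace T" using p by (simp add: net_cluster_point_def)
    fix U assume U: "openin T U" "p \<in> U"
    show "\<exists>\<^sub>F a in G. x a \<in> U"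
    proof (rule ccontr)
      assume "\<not> ?thesis"
      \<comment> \<open>The set of indices missing \<open>U\<close> would belong to
        \<open>G\<close>, and beyond it the subnet could never enter \<open>U\<close>.\<close>
      hence "eventually (\<lambda>a. a \<in> {a\<in>\<Lambda>. x a \<notin> U}) G"
        using \<Lambda> by (auto simp: not_frequently elim: eventually_elim2)
      moreover from ne[OF this] obtain k where "k \<in> {a\<in>\<Lambda>. x a \<notin> U}" by blast
      ultimately have "(k, {a\<in>\<Lambda>. x a \<notin> U}) \<in> M" by (auto simp: M_def)
      then obtain b where "b \<in> M" "leM (k, {a\<in>\<Lambda>. x a \<notin> U}) b" "x (fst b) \<in> U"
        using p U unfolding net_cluster_point_def o_def by blast
      thus False by (auto simp: leM_def M_def)
    qed
  qed
qed

section \<open>The strict topology on norm-bounded nets\<close>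

lemma strict_weight_bdd:
  assumes "\<phi> \<in> strict_weights"
  shows "bdd_above (range (\<lambda>x. norm (\<phi> x * apply_bcontfun f x)))"
proof -
  obtain C where "\<And>x. norm (\<phi> x) \<le> C" using assms by (auto simp: strict_weights_def bounded_iff)
  hence "norm (\<phi> x * apply_bcontfun f x) \<le> C * norm f" for x
    unfolding norm_mult by (intro mult_mono norm_bounded) (auto intro: order_trans[OF norm_ge_zero])
  thus ?thesis by (auto intro!: bdd_aboveI)
qed

lemma strict_seminorm_upper:
  "\<phi> \<in> strict_weights \<Longrightarrow> norm (\<phi> x * apply_bcontfun f x) \<le> strict_seminorm \<phi> f"
  unfolding strict_seminorm_def by (rule cSUP_upper[OF _ strict_weight_bdd]) auto

lemma strict_seminorm_least:
  "(\<And>x. norm (\<phi> x * apply_bcontfun f x) \<le> C) \<Longrightarrow> strict_seminorm \<phi> f \<le> C"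
  unfolding strict_seminorm_def by (rule cSUP_least) auto

lemma strict_seminorm_triangle:
  assumes "\<phi> \<in> strict_weights"
  shows "strict_seminorm \<phi> (f + g) \<le> strict_seminorm \<phi> f + strict_seminorm \<phi> g"
proof (rule strict_seminorm_least)
  fix x
  have "norm (\<phi> x * apply_bcontfun (f + g) x) \<le> norm (\<phi> x * apply_bcontfun f x) + norm (\<phi> x * apply_bcontfun g x)"
    by (simp add: plus_bcontfun.rep_eq distrib_left norm_triangle_ineq)
  thus "norm (\<phi> x * apply_bcontfun (f + g) x) \<le> strict_seminorm \<phi> f + strict_seminorm \<phi> g"
    using strict_seminorm_upper[OF assms, of x f] strict_seminorm_upper[OF assms, of x g] by linarith
qed

lemma indicator_compact_strict_weight: "compact K \<Longrightarrow> indicator K \<in> strict_weights"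
  unfolding strict_weights_def vanishes_at_infinity_def
  by (auto intro!: boundedI[of _ 1] simp: indicator_def)

text \<open>Weights may be discontinuous, so the indicator of a compact set is one; its seminorm
  controls the function uniformly on that set.\<close>

lemma openin_strict_compact_ball:
  assumes "compact K" "e > 0"
  obtains U where "openin strict_topology U" "f \<in> U"
    "\<forall>g\<in>U. \<forall>x\<in>K. norm (apply_bcontfun g x - apply_bcontfun f x) < e"
proof
  let ?U = "{g. strict_seminorm (indicator K) (g - f) < e}"
  note w = indicator_compact_strict_weight[OF assms(1)]
  show "openin strict_topology ?U"
    unfolding strict_topology_def using assms w by (intro topology_generated_by_Basis) blast
  have "strict_seminorm (indicator K) (f - f) \<le> 0"
    by (rule strict_seminorm_least) simp
  thus "f \<in> ?U" using assms(2) by simp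
  show "\<forall>g\<in>?U. \<forall>x\<in>K. norm (apply_bcontfun g x - apply_bcontfun f x) < e"
  proof (intro ballI)
    fix g x assume "g \<in> ?U" "x \<in> K"
    thus "norm (apply_bcontfun g x - apply_bcontfun f x) < e"
      using strict_seminorm_upper[OF w, of x "g - f"] by (simp add: minus_bcontfun.rep_eq)
  qed
qed

lemma limitin_strict_topologyD:
  assumes "limitin strict_topology x g F" "compact K" "e > 0"
  shows "\<forall>\<^sub>F a in F. \<forall>y\<in>K. norm (apply_bcontfun (x a) y - apply_bcontfun g y) < e"
proof -
  obtain U where "openin strict_topology U" "g \<in> U"
    "\<forall>h\<in>U. \<forall>y\<in>K. norm (apply_bcontfun h y - apply_bcontfun g y) < e"
    by (rule openin_strict_compact_ball[OF assms(2,3), of g])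
  thus ?thesis using assms(1) by (auto simp: limitin_def elim!: eventually_mono)
qed

text \<open>A weight is bounded on \<open>K\<close>, where convergence is uniform, and small off
  \<open>K\<close>, where the norm bound takes over.\<close>

lemma limitin_strict_topologyI:
  assumes bdd: "\<forall>\<^sub>F a in F. norm (x a) \<le> C"
    and conv: "\<And>K e. compact K \<Longrightarrow> e > 0 \<Longrightarrow>
      \<forall>\<^sub>F a in F. \<forall>y\<in>K. norm (apply_bcontfun (x a) y - apply_bcontfun g y) < e"
  shows "limitin strict_topology x g F"
  unfolding strict_topology_def
proof (rule limitin_topology_generated_by)
  have z: "(\<lambda>_. 0) \<in> strict_weights"
    unfolding strict_weights_def vanishes_at_infinity_def by (auto intro!: exI[of _ "{}"] boundedI[of _ 0])
  have "strict_seminorm (\<lambda>_. 0) (g - g) < 1"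
    using strict_seminorm_least[of "\<lambda>_. 0" "g - g" 0] by simp
  thus "g \<in> \<Union>{{g. strict_seminorm \<phi> (g - f) < \<epsilon>} |\<phi> f \<epsilon>. \<phi> \<in> strict_weights \<and> \<epsilon> > 0}"
    using z zero_less_one by blast
next
  fix U assume "U \<in> {{g. strict_seminorm \<phi> (g - f) < \<epsilon>} |\<phi> f \<epsilon>. \<phi> \<in> strict_weights \<and> \<epsilon> > 0}" "g \<in> U"
  then obtain \<phi> f \<epsilon> where U: "U = {g. strict_seminorm \<phi> (g - f) < \<epsilon>}" and \<phi>: "\<phi> \<in> strict_weights"
    and g: "strict_seminorm \<phi> (g - f) < \<epsilon>" by auto
  define d where "d = (\<epsilon> - strict_seminorm \<phi> (g - f)) / 2"
  have d: "d > 0" "strict_seminorm \<phi> (g - f) + d < \<epsilon>" using g by (auto simp: d_def field_simps)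
  obtain B where B: "\<And>x. norm (\<phi> x) \<le> B" using \<phi> by (auto simp: strict_weights_def bounded_iff)
  have B0: "B \<ge> 0" using B[of undefined] norm_ge_zero order_trans by blast
  define D where "D = \<bar>C\<bar> + norm g"
  have D0: "D \<ge> 0" by (simp add: D_def)
  \<comment> \<open>\<open>e1\<close> bounds the weight off \<open>K\<close> and \<open>e2\<close>
    the difference of functions on \<open>K\<close>; the added 1 keeps both denominators
    positive.\<close>
  define e1 where "e1 = d / (D + 1)"
  have e1: "e1 > 0" "e1 * D \<le> d" using d(1) D0 by (auto simp: e1_def field_simps)
  define e2 where "e2 = d / (B + 1)"
  have e2: "e2 > 0" "B * e2 \<le> d" using d(1) B0 by (auto simp: e2_def field_simps)
  obtain K where K: "compact K" "\<And>y. y \<notin> K \<Longrightarrow> norm (\<phi> y) < e1"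
    using \<phi> e1(1) unfolding strict_weights_def vanishes_at_infinity_def by blast
  from bdd conv[OF K(1) e2(1)] show "\<forall>\<^sub>F a in F. x a \<in> U"
  proof eventually_elim
    case (elim a)
    have "norm (\<phi> y * apply_bcontfun (x a - g) y) \<le> d" for y
    proof (cases "y \<in> K")
      case True
      have "norm (\<phi> y * apply_bcontfun (x a - g) y) \<le> B * e2"
        using elim(2) True B[of y] B0 unfolding norm_mult
        by (intro mult_mono) (auto simp: minus_bcontfun.rep_eq intro: less_imp_le)
      thus ?thesis using e2(2) by linarith
    next
      case False
      have "norm (x a - g) \<le> D"
        using elim(1) norm_triangle_ineq4[of "x a" g] by (simp add: D_def)
      hence "norm (apply_bcontfun (x a - g) y) \<le> D" using norm_bounded[of "x a - g" y] by linarith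
      hence "norm (\<phi> y * apply_bcontfun (x a - g) y) \<le> e1 * D"
        using K(2)[OF False] e1(1) unfolding norm_mult by (intro mult_mono) auto
      thus ?thesis using e1(2) by linarith
    qed
    hence "strict_seminorm \<phi> (x a - g) \<le> d" by (rule strict_seminorm_least)
    moreover have "strict_seminorm \<phi> ((x a - g) + (g - f)) \<le> strict_seminorm \<phi> (x a - g) + strict_seminorm \<phi> (g - f)"
      by (rule strict_seminorm_triangle[OF \<phi>])
    ultimately show "x a \<in> U" using d(2) by (simp add: U)
  qed
qed

lemma limitin_imp_net_cluster_point:
  assumes dir: "directed_on \<Lambda> le" and lim: "limitin T x p (net_filter \<Lambda> le)"
  shows "net_cluster_point T \<Lambda> le x p"
  unfolding net_cluster_point_def
proof (intro conjI allI impI ballI)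
  show "p \<in> topspace T" using lim by (simp add: limitin_def)
  fix U a assume U: "openin T U \<and> p \<in> U" and a: "a \<in> \<Lambda>"
  hence "\<forall>\<^sub>F b in net_filter \<Lambda> le. x b \<in> U" using lim by (simp add: limitin_def)
  then obtain b where b: "b \<in> \<Lambda>" "\<forall>c\<in>\<Lambda>. le b c \<longrightarrow> x c \<in> U"
    unfolding eventually_net_filter[OF dir] by blast
  obtain c where "c \<in> \<Lambda>" "le a c" "le b c" using dir a b(1) unfolding directed_on_def by blast
  thus "\<exists>b\<in>\<Lambda>. le a b \<and> x b \<in> U" using b(2) by blast
qed


section \<open>Average schemes on Polish spaces\<close>

locale polish_average_scheme = markovian_average_scheme \<S> \<Lambda> le A
  for \<S> :: "(('a::polish_space \<Rightarrow>\<^sub>C complex) \<Rightarrow> ('a \<Rightarrow>\<^sub>C complex)) set"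
    and \<Lambda> :: "'i set" and le :: "'i \<Rightarrow> 'i \<Rightarrow> bool"
    and A :: "'i \<Rightarrow> ('a \<Rightarrow>\<^sub>C complex) \<Rightarrow> ('a \<Rightarrow>\<^sub>C complex)"
begin

abbreviation tails :: "'i filter" where "tails \<equiv> net_filter \<Lambda> le"

abbreviation S' :: "(('a \<Rightarrow>\<^sub>C complex) \<Rightarrow> ('a \<Rightarrow>\<^sub>C complex)) \<Rightarrow> 'a cmeas \<Rightarrow> 'a cmeas" where
  "S' \<equiv> sigma_adjoint"

lemma S_op: "S \<in> \<S> \<Longrightarrow> S \<in> sigma_operators" using S_operators by blast
lemma A_op: "a \<in> \<Lambda> \<Longrightarrow> A a \<in> sigma_operators" using A_operators by blast

lemma tails_nontrivial: "tails \<noteq> bot"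
  unfolding trivial_limit_def eventually_net_filter[OF directed]
  using directed unfolding directed_on_def by blast

lemma eventually_in_index: "\<forall>\<^sub>F a in tails. a \<in> \<Lambda>"
  using directed unfolding eventually_net_filter[OF directed] directed_on_def by blast

lemma pairing_S': "S \<in> \<S> \<Longrightarrow> pairing f (S' S m) = pairing (S f) m"
  by (rule pairing_sigma_adjoint[OF S_op])

lemma pairing_A': "a \<in> \<Lambda> \<Longrightarrow> pairing f (S' (A a) m) = pairing (A a f) m"
  by (rule pairing_sigma_adjoint[OF A_op])

text \<open>Transfers properties of the semigroup to the averages: with a singleton for
  \<open>C\<close> it transfers invariance, with the nonnegative reals positivity.\<close>

lemma pairing_A_closed_convex:
  assumes "a \<in> \<Lambda>" "closed C" "convex C" "\<And>S. S \<in> \<S> \<Longrightarrow> pairing (S f) m \<in> C"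
  shows "pairing (A a f) m \<in> C"
  by (rule weak_closure_hull_in_closed[OF AS2[OF assms(1)] assms(2,3)])
     (use assms(4) in \<open>auto simp: pairing_add_left scaleR_cb_conv pairing_scale_left\<close>)

lemma fix_spaceD: "f \<in> fix_space \<S> \<Longrightarrow> S \<in> \<S> \<Longrightarrow> S f = f"
  by (auto simp: fix_space_def)

lemma fix_space_S'D: "m \<in> fix_space (S' ` \<S>) \<Longrightarrow> S \<in> \<S> \<Longrightarrow> S' S m = m"
  by (auto simp: fix_space_def)

lemma A_fix:
  assumes "f \<in> fix_space \<S>" "a \<in> \<Lambda>"
  shows "A a f = f"
proof (rule bcontfun_eq_pairingI)
  fix m
  have "pairing (A a f) m \<in> {pairing f m}"
    by (rule pairing_A_closed_convex[OF assms(2)]) (auto simp: fix_spaceD[OF assms(1)])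
  thus "pairing (A a f) m = pairing f m" by simp
qed

lemma pairing_A_fix':
  assumes "m \<in> fix_space (S' ` \<S>)" "a \<in> \<Lambda>"
  shows "pairing (A a f) m = pairing f m"
proof -
  have "pairing (A a f) m \<in> {pairing f m}"
  proof (rule pairing_A_closed_convex[OF assms(2)])
    fix S assume "S \<in> \<S>"
    thus "pairing (S f) m \<in> {pairing f m}"
      using fix_space_S'D[OF assms(1)] pairing_S'[of S f m] by simp
  qed auto
  thus ?thesis by simp
qed

lemma A_positive:
  assumes f: "\<And>x. apply_bcontfun f x \<in> \<real>\<^sub>\<ge>\<^sub>0" and a: "a \<in> \<Lambda>"
  shows "apply_bcontfun (A a f) x \<in> \<real>\<^sub>\<ge>\<^sub>0"
proof -
  have "pairing (A a f) (dirac x) \<in> \<real>\<^sub>\<ge>\<^sub>0"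
  proof (rule pairing_A_closed_convex[OF a closed_nonneg_Reals_complex])
    show "convex (\<real>\<^sub>\<ge>\<^sub>0 :: complex set)"
      by (auto simp: convex_def complex_nonneg_Reals_iff)
    show "pairing (S f) (dirac x) \<in> \<real>\<^sub>\<ge>\<^sub>0" if "S \<in> \<S>" for S
      using positive[OF that] f unfolding positive_operator_def by simp
  qed
  thus ?thesis by simp
qed

lemma pos_A':
  assumes "nonneg_cmeas m" "a \<in> \<Lambda>"
  shows "nonneg_cmeas (S' (A a) m)"
  unfolding nonneg_cmeas_def
proof
  fix B show "meas_of (S' (A a) m) B \<in> \<real>\<^sub>\<ge>\<^sub>0"
    by (rule meas_of_nonneg) (use assms in \<open>auto simp: pairing_A' intro!: pairing_pos_nonneg A_positive\<close>)
qed

lemma pairing_A_of_real_cb: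
  assumes "nonneg_cmeas m" "a \<in> \<Lambda>" "continuous_on UNIV u" "bounded (range u)"
  shows "pairing (A a (of_real_cb u)) m = of_real (\<integral>x. u x \<partial>jordan_part (S' (A a) m) 0)"
  using pairing_of_real_cb[OF pos_A'[OF assms(1,2)] assms(3,4)] by (simp add: pairing_A'[OF assms(2)])

lemma A_of_real_cb_mono:
  assumes "a \<in> \<Lambda>" "continuous_on UNIV u" "bounded (range u)" "continuous_on UNIV v" "bounded (range v)"
    and "\<And>y. u y \<le> v y"
  shows "Re (apply_bcontfun (A a (of_real_cb u)) x) \<le> Re (apply_bcontfun (A a (of_real_cb v)) x)"
    and "Im (apply_bcontfun (A a (of_real_cb u)) x) = 0"
proof -
  let ?M = "jordan_part (S' (A a) (dirac x)) 0"
  have int: "integrable ?M w" if w: "continuous_on UNIV w" "bounded (range w)" for w :: "'a \<Rightarrow> real"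
  proof -
    obtain B where "\<And>y. norm (w y) \<le> B" using w(2) by (auto simp: bounded_iff)
    thus ?thesis
      by (intro integrable_bounded_borel[of ?M w B] borel_measurable_continuous_onI w) auto
  qed
  have "(\<integral>y. u y \<partial>?M) \<le> (\<integral>y. v y \<partial>?M)"
    using assms by (intro integral_mono int) auto
  thus "Re (apply_bcontfun (A a (of_real_cb u)) x) \<le> Re (apply_bcontfun (A a (of_real_cb v)) x)"
    "Im (apply_bcontfun (A a (of_real_cb u)) x) = 0"
    using pairing_A_of_real_cb[OF pos_dirac assms(1-3), of x]
      pairing_A_of_real_cb[OF pos_dirac assms(1,4,5), of x] by simp_all
qed

section \<open>Strict convergence and strict cluster points of the averages\<close>

lemma A_bounded: obtains C where "C > 0" "\<And>a f. a \<in> \<Lambda> \<Longrightarrow> norm (A a f) \<le> C * norm f"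
  using AS1 by blast

lemma eventually_A_bounded: "\<exists>D. \<forall>\<^sub>F a in tails. norm (A a f) \<le> D"
  using A_bounded eventually_in_index by (metis (mono_tags, lifting) eventually_mono)

text \<open>By (AS1) the averages of one function are norm bounded, so this is strict convergence of
  \<open>A a f\<close> to \<open>g\<close>, freed from the weights.\<close>

definition compactly_conv :: "('a \<Rightarrow>\<^sub>C complex) \<Rightarrow> ('a \<Rightarrow>\<^sub>C complex) \<Rightarrow> bool" where
  "compactly_conv f g \<longleftrightarrow> (\<forall>K e. compact K \<longrightarrow> e > 0 \<longrightarrow>
     (\<forall>\<^sub>F a in tails. \<forall>x\<in>K. norm (apply_bcontfun (A a f) x - apply_bcontfun g x) < e))"

lemma compactly_convD:
  "compactly_conv f g \<Longrightarrow> compact K \<Longrightarrow> e > 0 \<Longrightarrow>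
    \<forall>\<^sub>F a in tails. \<forall>x\<in>K. norm (apply_bcontfun (A a f) x - apply_bcontfun g x) < e"
  unfolding compactly_conv_def by blast

lemma limitin_strict_iff: "limitin strict_topology (\<lambda>a. A a f) g tails \<longleftrightarrow> compactly_conv f g"
proof
  assume "limitin strict_topology (\<lambda>a. A a f) g tails"
  thus "compactly_conv f g"
    unfolding compactly_conv_def by (intro allI impI limitin_strict_topologyD)
next
  assume c: "compactly_conv f g"
  obtain D where "\<forall>\<^sub>F a in tails. norm (A a f) \<le> D" using eventually_A_bounded by blast
  thus "limitin strict_topology (\<lambda>a. A a f) g tails"
    by (rule limitin_strict_topologyI) (rule compactly_convD[OF c])
qed

lemma pairing_close:
  assumes e: "e > 0" and D: "\<And>a. a \<in> \<Lambda> \<Longrightarrow> norm (A a f) \<le> D"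
  obtains K d where "compact K" "d > 0"
    "\<forall>a\<in>\<Lambda>. (\<forall>x\<in>K. norm (apply_bcontfun (A a f) x - apply_bcontfun g x) < d) \<longrightarrow>
      norm (pairing (A a f) m - pairing g m) < e"
proof -
  define B where "B = \<bar>D\<bar> + norm g"
  have B: "B \<ge> 0" by (simp add: B_def)
  \<comment> \<open>The 16 absorbs the factor 4 of \<open>pairing_tight\<close>: 4 (e/16 + e/16) =
    e/2.\<close>
  define d1 where "d1 = e / (16 * (B + 1))"
  define d where "d = e / (16 * (norm m + 1))"
  have d1: "d1 > 0" "B * d1 \<le> e / 16" using e B by (auto simp: d1_def field_simps)
  have m1: "norm m + 1 > 0" by (simp add: add_nonneg_pos)
  have d: "d > 0" "d * norm m \<le> e / 16" using e m1 by (auto simp: d_def field_simps)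
  obtain K where K: "compact K" "\<And>(f :: 'a \<Rightarrow>\<^sub>C complex) D \<delta>. (\<And>x. x \<in> K \<Longrightarrow> norm (apply_bcontfun f x) \<le> \<delta>) \<Longrightarrow> norm f \<le> D \<Longrightarrow> 0 \<le> \<delta> \<Longrightarrow>
       norm (pairing f m) \<le> 4 * (\<delta> * norm m + D * d1)"
    using pairing_tight[OF d1(1), of m] by blast
  have "norm (pairing (A a f) m - pairing g m) < e"
    if a: "a \<in> \<Lambda>" and x: "\<forall>x\<in>K. norm (apply_bcontfun (A a f) x - apply_bcontfun g x) < d" for a
  proof -
    have "norm (A a f - g) \<le> B"
      using D[OF a] norm_triangle_ineq4[of "A a f" g] by (simp add: B_def)
    hence "norm (pairing (A a f - g) m) \<le> 4 * (d * norm m + B * d1)"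
      using x d(1) by (intro K(2)) (auto simp: minus_bcontfun.rep_eq intro: less_imp_le)
    thus ?thesis using d(2) d1(2) e by (simp add: pairing_diff_left)
  qed
  thus ?thesis using that[OF K(1) d(1)] by blast
qed

lemma compactly_conv_pairing:
  assumes c: "compactly_conv f g"
  shows "((\<lambda>a. pairing (A a f) m) \<longlongrightarrow> pairing g m) tails"
proof (rule tendstoI)
  fix e :: real assume e: "e > 0"
  obtain C where C: "C > 0" "\<And>a f. a \<in> \<Lambda> \<Longrightarrow> norm (A a f) \<le> C * norm f" by (rule A_bounded) blast
  obtain K d where K: "compact K" "d > 0"
    "\<forall>a\<in>\<Lambda>. (\<forall>x\<in>K. norm (apply_bcontfun (A a f) x - apply_bcontfun g x) < d) \<longrightarrow>
      norm (pairing (A a f) m - pairing g m) < e"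
    by (rule pairing_close[OF e C(2), of f g m])
  from eventually_in_index compactly_convD[OF c K(1,2)]
  show "\<forall>\<^sub>F a in tails. dist (pairing (A a f) m) (pairing g m) < e"
    by eventually_elim (use K(3) in \<open>auto simp: dist_norm\<close>)
qed

lemma compactly_conv_combine:
  assumes "compactly_conv f1 g1" "compactly_conv f2 g2"
  shows "compactly_conv (f1 + scale_cb c f2) (g1 + scale_cb c g2)"
  unfolding compactly_conv_def
proof (intro allI impI)
  fix K :: "'a set" and e :: real assume K: "compact K" "e > 0"
  define d where "d = e / (2 * (norm c + 1))"
  have n1: "norm c + 1 > 0" by (simp add: add_nonneg_pos)
  have d: "d > 0" "norm c * d \<le> e / 2" using K(2) n1 by (auto simp: d_def field_simps)
  from eventually_in_index compactly_convD[OF assms(1) K(1) half_gt_zero[OF K(2)]] compactly_convD[OF assms(2) K(1) d(1)]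
  show "\<forall>\<^sub>F a in tails. \<forall>x\<in>K. norm (apply_bcontfun (A a (f1 + scale_cb c f2)) x -
      apply_bcontfun (g1 + scale_cb c g2) x) < e"
  proof eventually_elim
    case (elim a)
    show ?case
    proof
      fix x assume x: "x \<in> K"
      let ?p = "apply_bcontfun (A a f1) x - apply_bcontfun g1 x"
      let ?q = "apply_bcontfun (A a f2) x - apply_bcontfun g2 x"
      have eq: "apply_bcontfun (A a (f1 + scale_cb c f2)) x - apply_bcontfun (g1 + scale_cb c g2) x = ?p + c * ?q"
        by (simp add: sigma_operators_add[OF A_op] sigma_operators_scale[OF A_op] elim(1) plus_bcontfun.rep_eq algebra_simps)
      have "norm (?p + c * ?q) \<le> norm ?p + norm c * norm ?q"
        by (metis norm_mult norm_triangle_ineq)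
      moreover have "norm c * norm ?q \<le> norm c * d"
        using elim(3) x by (intro mult_left_mono) (auto intro: less_imp_le)
      moreover have "norm ?p < e / 2" using elim(2) x by blast
      ultimately show "norm (apply_bcontfun (A a (f1 + scale_cb c f2)) x - apply_bcontfun (g1 + scale_cb c g2) x) < e"
        unfolding eq using d(2) by linarith
    qed
  qed
qed

lemma strict_cluster_close:
  assumes G: "G \<le> tails"
    and p: "\<forall>U. openin strict_topology U \<longrightarrow> p \<in> U \<longrightarrow> (\<exists>\<^sub>F a in G. A a f \<in> U)"
    and e: "e > 0"
  shows "\<exists>\<^sub>F a in G. norm (pairing (A a f) m - pairing p m) < e"
proof -
  have ev: "\<forall>\<^sub>F a in G. a \<in> \<Lambda>" by (rule filter_leD[OF G eventually_in_index])
  obtain C where C: "C > 0" "\<And>a f. a \<in> \<Lambda> \<Longrightarrow> norm (A a f) \<le> C * norm f" by (rule A_bounded) blast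
  obtain K d where K: "compact K" "d > 0"
    "\<forall>a\<in>\<Lambda>. (\<forall>x\<in>K. norm (apply_bcontfun (A a f) x - apply_bcontfun p x) < d) \<longrightarrow>
      norm (pairing (A a f) m - pairing p m) < e"
    by (rule pairing_close[OF e C(2), of f p m])
  obtain U where U: "openin strict_topology U" "p \<in> U"
    "\<forall>h\<in>U. \<forall>y\<in>K. norm (apply_bcontfun h y - apply_bcontfun p y) < d"
    by (rule openin_strict_compact_ball[OF K(1,2)])
  have "\<exists>\<^sub>F a in G. a \<in> \<Lambda> \<and> A a f \<in> U"
    by (rule frequently_eventually_conj[OF p[rule_format, OF U(1,2)] ev])
  thus ?thesis by (rule frequently_elim1) (use U(3) K(3) in blast)
qed

text \<open>By (AS3) \<open>S (A a f) - A a f\<close> tends to 0, while pairings with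
  \<open>A a f\<close> are frequently close to those with \<open>p\<close>. Pairings with a fixed
  measure do not change under averaging, so \<open>p\<close> inherits them from
  \<open>f\<close>.\<close>

lemma strict_cluster_fix:
  assumes G: "G \<noteq> bot" "G \<le> tails"
    and p: "\<forall>U. openin strict_topology U \<longrightarrow> p \<in> U \<longrightarrow> (\<exists>\<^sub>F a in G. A a f \<in> U)"
  shows "p \<in> fix_space \<S>"
    and "m \<in> fix_space (S' ` \<S>) \<Longrightarrow> pairing p m = pairing f m"
proof -
  note close = strict_cluster_close[OF G(2) p]
  have ev: "\<forall>\<^sub>F a in G. a \<in> \<Lambda>" by (rule filter_leD[OF G(2) eventually_in_index])
  show "p \<in> fix_space \<S>"
    unfolding fix_space_def
  proof (intro INT_I CollectI)
    fix S assume S: "S \<in> \<S>"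
    have "pairing (S p) m = pairing p m" for m
    proof (rule ccontr)
      assume ne: "pairing (S p) m \<noteq> pairing p m"
      \<comment> \<open>Moving \<open>S\<close> to the measure requires only closeness of pairings,
        not continuity of \<open>S\<close> in the strict topology.\<close>
      define k where "k = S' S m - m"
      have k: "pairing h k = pairing (S h) m - pairing h m" for h
        by (simp add: k_def pairing_diff_right pairing_S'[OF S])
      define e where "e = norm (pairing p k) / 2"
      have e: "e > 0" using ne by (simp add: e_def k)
      have "((\<lambda>a. pairing (S (A a f) - A a f) m) \<longlongrightarrow> 0) tails"
        by (rule tendsto_pairing_left[OF AS3_left[OF S]])
      hence "\<forall>\<^sub>F a in tails. norm (pairing (A a f) k) < e"
        using e by (auto dest: tendstoD simp: k pairing_diff_left)
      hence "\<forall>\<^sub>F a in G. norm (pairing (A a f) k) < e" by (rule filter_leD[OF G(2)])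
      from frequently_eventually_conj[OF close[OF e, of k] this]
      have "\<exists>\<^sub>F a in G. norm (pairing (A a f) k) < e \<and> norm (pairing (A a f) k - pairing p k) < e" by simp
      then obtain a where "norm (pairing (A a f) k - pairing p k) < e" "norm (pairing (A a f) k) < e"
        using frequently_ex by blast
      hence "norm (pairing p k) < 2 * e"
        using norm_triangle_ineq4[of "pairing (A a f) k" "pairing (A a f) k - pairing p k"] by simp
      thus False by (simp add: e_def)
    qed
    hence "S p = p" by (rule bcontfun_eq_pairingI)
    thus "p - S p = 0" by simp
  qed
  show "pairing p m = pairing f m" if m: "m \<in> fix_space (S' ` \<S>)"
  proof (rule ccontr)
    assume "pairing p m \<noteq> pairing f m"
    hence "norm (pairing f m - pairing p m) > 0" by simp
    from frequently_eventually_conj[OF close[OF this, of m] ev]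
    have "\<exists>\<^sub>F a in G. a \<in> \<Lambda> \<and> norm (pairing (A a f) m - pairing p m) < norm (pairing f m - pairing p m)" by simp
    then obtain a where "norm (pairing (A a f) m - pairing p m) < norm (pairing f m - pairing p m)" "a \<in> \<Lambda>"
      using frequently_ex by blast
    thus False using pairing_A_fix'[OF m] by simp
  qed
qed

lemma separates_imp_strict_limit:
  assumes sep: "separates_fix \<S>" and cl: "net_clusters strict_topology \<Lambda> le (\<lambda>a. A a f)"
  shows "\<exists>g. limitin strict_topology (\<lambda>a. A a f) g tails"
proof -
  obtain p where p: "p \<in> topspace strict_topology"
    "\<And>U. openin strict_topology U \<Longrightarrow> p \<in> U \<Longrightarrow> \<exists>\<^sub>F a in tails. A a f \<in> U"
    by (rule net_clusters_filter[OF cl directed tails_nontrivial order_refl]) blast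
  have "\<forall>U. openin strict_topology U \<longrightarrow> p \<in> U \<longrightarrow> (\<exists>\<^sub>F a in tails. A a f \<in> U)" using p(2) by blast
  note p' = strict_cluster_fix[OF tails_nontrivial order_refl this]
  have "\<forall>\<^sub>F a in tails. A a f \<in> U" if U: "openin strict_topology U" "p \<in> U" for U
  proof (rule ccontr)
    assume n: "\<not> ?thesis"
    \<comment> \<open>The tails confined to the indices where \<open>A a f\<close> misses
      \<open>U\<close>. A cluster point \<open>q\<close> along \<open>G\<close> must be
      \<open>p\<close> by separation, and then \<open>A a f\<close> would enter \<open>U\<close>
      along \<open>G\<close>.\<close>
    define G where "G = inf tails (principal {a. A a f \<notin> U})"
    have G: "G \<noteq> bot" "G \<le> tails"
      using n by (auto simp: G_def trivial_limit_def eventually_inf_principal)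
    obtain q where q: "q \<in> topspace strict_topology"
      "\<And>U. openin strict_topology U \<Longrightarrow> q \<in> U \<Longrightarrow> \<exists>\<^sub>F a in G. A a f \<in> U"
      by (rule net_clusters_filter[OF cl directed G]) blast
    have "\<forall>U. openin strict_topology U \<longrightarrow> q \<in> U \<longrightarrow> (\<exists>\<^sub>F a in G. A a f \<in> U)" using q(2) by blast
    note q' = strict_cluster_fix[OF G this]
    have "p = q"
    proof (rule ccontr)
      assume "p \<noteq> q"
      moreover have "p - q \<in> fix_space \<S>"
        using p'(1) q'(1) by (auto simp: fix_space_def sigma_operators_diff[OF S_op])
      ultimately obtain m where "m \<in> fix_space (S' ` \<S>)" "pairing (p - q) m \<noteq> 0"
        using sep unfolding separates_fix_def by force
      thus False using p'(2)[of m] q'(2)[of m] by (simp add: pairing_diff_left)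
    qed
    hence "\<exists>\<^sub>F a in G. A a f \<in> U" using q(2) U by blast
    thus False by (simp add: frequently_def G_def eventually_inf_principal)
  qed
  thus ?thesis using p(1) by (auto simp: limitin_def)
qed

section \<open>From (ii) and (iv) to (iii), and from (i) to (iv)\<close>

lemma cluster_imp_separates:
  assumes "\<forall>x. \<exists>m. net_cluster_point sigma_meas \<Lambda> le (\<lambda>a. S' (A a) (dirac x)) m"
  shows "separates_fix \<S>"
  unfolding separates_fix_def
proof (intro ballI impI)
  fix f assume f: "f \<in> fix_space \<S>" "f \<noteq> 0"
  obtain x where x: "apply_bcontfun f x \<noteq> 0"
    using f(2) by (metis bcontfun_eqI zero_bcontfun.rep_eq)
  obtain m where m: "net_cluster_point sigma_meas \<Lambda> le (\<lambda>a. S' (A a) (dirac x)) m" using assms by blast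
  have close: "\<exists>b\<in>\<Lambda>. le a b \<and> norm (pairing h (S' (A b) (dirac x)) - pairing h m) < e"
    if "e > 0" "a \<in> \<Lambda>" for h e a
  proof -
    have "openin sigma_meas {n. pairing h n \<in> ball (pairing h m) e}"
      by (rule openin_weak_topology[OF open_ball])
    moreover have "m \<in> {n. pairing h n \<in> ball (pairing h m) e}" using that by simp
    ultimately show ?thesis
      using m that unfolding net_cluster_point_def by (fastforce simp: dist_norm norm_minus_commute)
  qed
  obtain a0 where a0: "a0 \<in> \<Lambda>" using directed by (auto simp: directed_on_def)
  \<comment> \<open>The averages leave \<open>f\<close> unchanged, so its pairings with the net are
    constantly the value of \<open>f\<close> at \<open>x\<close>.\<close>
  have "pairing f m = apply_bcontfun f x"
  proof (rule ccontr)
    assume "pairing f m \<noteq> apply_bcontfun f x"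
    hence "norm (apply_bcontfun f x - pairing f m) > 0" by simp
    from close[OF this a0, of f] show False
      by (auto simp: pairing_A' A_fix[OF f(1)])
  qed
  moreover have "m \<in> fix_space (S' ` \<S>)"
    unfolding fix_space_def
  proof (clarsimp)
    fix S assume S: "S \<in> \<S>"
    have "pairing h (S' S m) = pairing h m" for h
    proof (rule ccontr)
      assume ne: "pairing h (S' S m) \<noteq> pairing h m"
      define k where "k = S h - h"
      define e where "e = norm (pairing k m) / 2"
      have e: "e > 0" using ne by (simp add: e_def k_def pairing_diff_left pairing_S'[OF S])
      \<comment> \<open>(AS3) for the adjoints makes pairings with \<open>k\<close> small on a whole
        tail, and clustering supplies an index in that tail where they are also close to
        \<open>pairing k m\<close>.\<close>
      have "((\<lambda>a. pairing h (S' S (S' (A a) (dirac x)) - S' (A a) (dirac x))) \<longlongrightarrow> 0) tails"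
        by (rule tendsto_pairing_right[OF AS3'_left[OF S]])
      hence "\<forall>\<^sub>F a in tails. norm (pairing k (S' (A a) (dirac x))) < e"
        using e by (auto dest: tendstoD simp: k_def pairing_diff_left pairing_diff_right pairing_S'[OF S])
      then obtain a where a: "a \<in> \<Lambda>" "\<forall>b\<in>\<Lambda>. le a b \<longrightarrow> norm (pairing k (S' (A b) (dirac x))) < e"
        unfolding eventually_net_filter[OF directed] by blast
      from close[OF e a(1), of k] obtain b where b: "b \<in> \<Lambda>" "le a b"
        "norm (pairing k (S' (A b) (dirac x)) - pairing k m) < e" by blast
      have "norm (pairing k m) < 2 * e"
        using norm_triangle_ineq4[of "pairing k (S' (A b) (dirac x))" "pairing k (S' (A b) (dirac x)) - pairing k m"]
          a(2) b by auto
      thus False by (simp add: e_def)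
    qed
    thus "m = S' S m" by (metis pairing_separates_measures)
  qed
  ultimately show "\<exists>m\<in>fix_space (S' ` \<S>). pairing f m \<noteq> 0" using x by force
qed

text \<open>A fixed function annihilates every \<open>m - S' S m\<close>, hence the span and its
  weak closure. If it annihilates the fixed measures as well, it annihilates all measures and is
  0.\<close>

lemma direct_sum_imp_separates:
  assumes "is_direct_sum (fix_space (S' ` \<S>))
    (sigma_meas closure_of (module.span scale_cmeas (rg_diff (S' ` \<S>))))"
  shows "separates_fix \<S>"
  unfolding separates_fix_def
proof (intro ballI impI)
  interpret M: vector_space scale_cmeas by (rule vector_space_scale_cmeas)
  fix f assume f: "f \<in> fix_space \<S>" "f \<noteq> 0"
  show "\<exists>m\<in>fix_space (S' ` \<S>). pairing f m \<noteq> 0"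
  proof (rule ccontr)
    assume n: "\<not> ?thesis"
    have sp: "pairing f v = 0" if "v \<in> M.span (rg_diff (S' ` \<S>))" for v
      using that
    proof (induction rule: M.span_induct_alt)
      case (step c x y)
      then obtain m S where "x = m - S' S m" "S \<in> \<S>" by (auto simp: rg_diff_def)
      hence "pairing f x = 0" by (simp add: pairing_diff_right pairing_S' fix_spaceD[OF f(1)])
      thus ?case using step by (simp add: pairing_add_right pairing_scale_right)
    qed simp
    have cl: "pairing f v = 0" if "v \<in> sigma_meas closure_of (M.span (rg_diff (S' ` \<S>)))" for v
      using weak_closure_in_closed[OF that, of "{0}" f] sp by simp
    have "pairing f m = 0" for m
    proof -
      obtain u v where "u \<in> fix_space (S' ` \<S>)" "v \<in> sigma_meas closure_of (M.span (rg_diff (S' ` \<S>)))" "m = u + v"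
        using assms unfolding is_direct_sum_def by blast
      thus ?thesis using n cl by (auto simp: pairing_add_right)
    qed
    hence "f = 0" by (intro bcontfun_eq_pairingI) simp
    thus False using f(2) by simp
  qed
qed

text \<open>The splitting is m = n + (m - n) with \<open>n\<close> the limit of the adjoint
  averages: (AS3) makes \<open>n\<close> fixed and (AS2) puts \<open>m - n\<close> into the closed
  span. That the intersection is trivial is seen on the function side: the limit of
  \<open>A a f\<close> annihilates the closed span but pairs with fixed measures as \<open>f\<close>
  does.\<close>

lemma weakly_ergodic_imp_direct_sum:
  assumes we: "weakly_ergodic \<Lambda> le A"
  shows "is_direct_sum (fix_space (S' ` \<S>))
    (sigma_meas closure_of (module.span scale_cmeas (rg_diff (S' ` \<S>))))"
  unfolding is_direct_sum_def
proof (intro conjI allI)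
  interpret M: vector_space scale_cmeas by (rule vector_space_scale_cmeas)
  let ?R = "rg_diff (S' ` \<S>)"
  have Am: "\<exists>n. \<forall>f. ((\<lambda>a. pairing f (S' (A a) m)) \<longlongrightarrow> pairing f n) tails" for m
    using we unfolding weakly_ergodic_def limitin_weak_topology by blast
  fix m
  obtain n where n: "\<And>f. ((\<lambda>a. pairing f (S' (A a) m)) \<longlongrightarrow> pairing f n) tails" using Am by blast
  have "n \<in> fix_space (S' ` \<S>)"
    unfolding fix_space_def
  proof (clarsimp)
    fix S assume S: "S \<in> \<S>"
    have "pairing f (S' S n) = pairing f n" for f
    proof -
      have "((\<lambda>a. pairing f (S' S (S' (A a) m) - S' (A a) m)) \<longlongrightarrow> 0) tails"
        by (rule tendsto_pairing_right[OF AS3'_left[OF S]])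
      moreover have "((\<lambda>a. pairing f (S' S (S' (A a) m) - S' (A a) m)) \<longlongrightarrow> pairing (S f) n - pairing f n) tails"
        unfolding pairing_diff_right pairing_S'[OF S] by (intro tendsto_diff n)
      ultimately show ?thesis
        using tendsto_unique[OF tails_nontrivial] by (fastforce simp: pairing_S'[OF S])
    qed
    thus "n = S' S n" by (metis pairing_separates_measures)
  qed
  moreover have "m - n \<in> sigma_meas closure_of (M.span ?R)"
  proof -
    \<comment> \<open>The condition on \<open>v\<close> is convex, as the coefficients sum to 1 and
      so reproduce \<open>m\<close>, and it holds on the orbit.\<close>
    have sub: "\<And>v. v \<in> convex hull ((\<lambda>S. S' S m) ` \<S>) \<Longrightarrow> m - v \<in> M.span ?R"
    proof -
      have "convex {v. m - v \<in> M.span ?R}"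
        unfolding convex_def
      proof (clarsimp)
        fix x y and u v :: real assume xy: "m - x \<in> M.span ?R" "m - y \<in> M.span ?R" and uv: "u + v = 1"
        have "m - (u *\<^sub>R x + v *\<^sub>R y) = u *\<^sub>R (m - x) + v *\<^sub>R (m - y)"
          using uv by (simp add: scaleR_diff_right algebra_simps flip: scaleR_add_left)
        also have "\<dots> \<in> M.span ?R"
          unfolding scaleR_cmeas_conv by (intro M.span_add M.span_scale xy)
        finally show "m - (u *\<^sub>R x + v *\<^sub>R y) \<in> M.span ?R" .
      qed
      moreover have "(\<lambda>S. S' S m) ` \<S> \<subseteq> {v. m - v \<in> M.span ?R}"
        by (auto simp: rg_diff_def intro!: M.span_base)
      ultimately have "convex hull ((\<lambda>S. S' S m) ` \<S>) \<subseteq> {v. m - v \<in> M.span ?R}"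
        by (intro hull_minimal) auto
      thus "\<And>v. v \<in> convex hull ((\<lambda>S. S' S m) ` \<S>) \<Longrightarrow> m - v \<in> M.span ?R" by blast
    qed
    show ?thesis
      unfolding in_closure_of
    proof (intro conjI allI impI)
      fix T assume T: "m - n \<in> T \<and> openin sigma_meas T"
      obtain Y e where Y: "finite Y" "e > 0"
        "\<forall>z. (\<forall>y\<in>Y. norm (pairing y z - pairing y (m - n)) < e) \<longrightarrow> z \<in> T"
        by (rule weak_topology_nbhd[of "\<lambda>m f. pairing f m" T "m - n"]) (use T in auto)
      have "\<forall>\<^sub>F a in tails. \<forall>y\<in>Y. norm (pairing y (S' (A a) m) - pairing y n) < e / 2"
        using Y(1) tendstoD[OF n half_gt_zero[OF Y(2)], unfolded dist_norm]
        by (intro eventually_ball_finite ballI)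
      with eventually_in_index have "\<forall>\<^sub>F a in tails. a \<in> \<Lambda> \<and> (\<forall>y\<in>Y. norm (pairing y (S' (A a) m) - pairing y n) < e / 2)"
        by (rule eventually_conj)
      then obtain a where a: "a \<in> \<Lambda>" "\<forall>y\<in>Y. norm (pairing y (S' (A a) m) - pairing y n) < e / 2"
        using eventually_happens'[OF tails_nontrivial] by blast
      let ?U = "\<Inter>y\<in>Y. {v. pairing y v \<in> ball (pairing y (S' (A a) m)) (e / 2)}"
      have "\<exists>v. v \<in> convex hull ((\<lambda>S. S' S m) ` \<S>) \<and> (\<forall>y\<in>Y. norm (pairing y v - pairing y (S' (A a) m)) < e / 2)"
      \<comment> \<open>\<open>openin_INT2\<close> applies to nonempty families; for empty
        \<open>Y\<close> any point of the hull will do.\<close>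
      proof (cases "Y = {}")
        case True
        have "S' id m \<in> convex hull ((\<lambda>S. S' S m) ` \<S>)" using S_id by (intro hull_inc) auto
        thus ?thesis using True by auto
      next
        case False
        have "openin sigma_meas ?U"
          using Y(1) False by (intro openin_INT2 openin_weak_topology open_ball) auto
        moreover have "S' (A a) m \<in> ?U" using Y(2) by simp
        ultimately obtain v where "v \<in> convex hull ((\<lambda>S. S' S m) ` \<S>)" "v \<in> ?U"
          using AS2'[OF a(1), of m] unfolding in_closure_of by blast
        thus ?thesis by (auto simp: dist_norm norm_minus_commute)
      qed
      then obtain v where v: "v \<in> convex hull ((\<lambda>S. S' S m) ` \<S>)"
        "\<forall>y\<in>Y. norm (pairing y v - pairing y (S' (A a) m)) < e / 2" by blast
      have "norm (pairing y (m - v) - pairing y (m - n)) < e" if y: "y \<in> Y" for y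
      proof -
        have "pairing y (m - v) - pairing y (m - n) =
            - ((pairing y v - pairing y (S' (A a) m)) + (pairing y (S' (A a) m) - pairing y n))"
          by (simp add: pairing_diff_right)
        also have "norm \<dots> \<le> norm (pairing y v - pairing y (S' (A a) m)) + norm (pairing y (S' (A a) m) - pairing y n)"
          unfolding norm_minus_cancel by (rule norm_triangle_ineq)
        finally show ?thesis using v(2)[rule_format, OF y] a(2)[rule_format, OF y] by linarith
      qed
      hence "m - v \<in> T" using Y(3) by blast
      thus "\<exists>y. y \<in> M.span ?R \<and> y \<in> T" using sub[OF v(1)] by blast
    qed simp
  qed
  ultimately show "\<exists>u\<in>fix_space (S' ` \<S>). \<exists>v\<in>sigma_meas closure_of (M.span ?R). m = u + v"
    by (intro bexI[of _ n] bexI[of _ "m - n"]) auto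
next
  interpret M: vector_space scale_cmeas by (rule vector_space_scale_cmeas)
  let ?R = "rg_diff (S' ` \<S>)"
  have Af: "\<exists>g. \<forall>m. ((\<lambda>a. pairing (A a f) m) \<longlongrightarrow> pairing g m) tails" for f
    using we unfolding weakly_ergodic_def limitin_weak_topology by blast
  have "u = 0" if u: "u \<in> fix_space (S' ` \<S>)" "u \<in> sigma_meas closure_of (M.span ?R)" for u
  proof (rule pairing_separates_measures)
    fix f
    \<comment> \<open>The ergodic projection of \<open>f\<close>.\<close>
    obtain g where g: "\<And>m. ((\<lambda>a. pairing (A a f) m) \<longlongrightarrow> pairing g m) tails" using Af by blast
    have "pairing g v = 0" if "v \<in> M.span ?R" for v
      using that
    proof (induction rule: M.span_induct_alt)
      case (step c x y)
      then obtain m S where x: "x = m - S' S m" "S \<in> \<S>" by (auto simp: rg_diff_def)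
      have "((\<lambda>a. pairing f (S' (A a) (S' S m - m))) \<longlongrightarrow> 0) tails"
        by (rule tendsto_pairing_right[OF AS3'_right[OF x(2)]])
      moreover have "\<forall>\<^sub>F a in tails. pairing f (S' (A a) (S' S m - m)) = - pairing (A a f) x"
        using eventually_in_index by eventually_elim (simp add: pairing_A' x(1) pairing_diff_right)
      ultimately have "((\<lambda>a. - pairing (A a f) x) \<longlongrightarrow> 0) tails"
        by (rule Lim_transform_eventually)
      from tendsto_unique[OF tails_nontrivial this tendsto_minus[OF g[of x]]]
      have "pairing g x = 0" by simp
      thus ?case using step by (simp add: pairing_add_right pairing_scale_right)
    qed simp
    hence "pairing g u = 0" using weak_closure_in_closed[OF u(2), of "{0}" g] by simp
    moreover have "((\<lambda>a. pairing (A a f) u) \<longlongrightarrow> pairing f u) tails"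
      by (rule Lim_transform_eventually[OF tendsto_const])
         (use eventually_in_index in eventually_elim, simp add: pairing_A_fix'[OF u(1)])
    ultimately show "pairing f u = pairing f 0"
      using tendsto_unique[OF tails_nontrivial _ g[of u]] by fastforce
  qed
  moreover have "(0 :: 'a cmeas) \<in> fix_space (S' ` \<S>)"
  proof -
    have "S' S 0 = 0" if "S \<in> \<S>" for S
      by (rule pairing_separates_measures) (simp add: pairing_S'[OF that])
    thus ?thesis by (auto simp: fix_space_def)
  qed
  moreover have "0 \<in> sigma_meas closure_of (M.span ?R)"
    using closure_of_subset[of "M.span ?R" sigma_meas] M.span_zero by auto
  ultimately show "fix_space (S' ` \<S>) \<inter> sigma_meas closure_of (M.span ?R) = {0}" by blast
qed

end

section \<open>Passage from Lipschitz functions to all bounded continuous functions\<close>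

locale cofinal_average_scheme = polish_average_scheme +
  fixes s :: "nat \<Rightarrow> 'b"
  assumes s_in: "\<And>n. s n \<in> \<Lambda>"
    and s_Suc: "\<And>n. le (s n) (s (Suc n))"
    and s_cofinal: "\<And>a. a \<in> \<Lambda> \<Longrightarrow> \<exists>n. le a (s n)"
begin

lemma filterlim_s: "filterlim s tails sequentially"
  unfolding filterlim_iff
proof (intro allI impI)
  fix P assume "eventually P tails"
  then obtain a where a: "a \<in> \<Lambda>" "\<forall>b\<in>\<Lambda>. le a b \<longrightarrow> P b"
    unfolding eventually_net_filter[OF directed] by blast
  obtain N where N: "le a (s N)" using s_cofinal[OF a(1)] by blast
  have "le a (s n)" if "n \<ge> N" for n
    using that
  proof (induction n rule: dec_induct)
    case (step n)
    thus ?case using directed a(1) s_in[of n] s_in[of "Suc n"] s_Suc[of n] unfolding directed_on_def by blast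
  qed (rule N)
  thus "\<forall>\<^sub>F n in sequentially. P (s n)"
    using a(2) s_in unfolding eventually_sequentially by blast
qed

lemma compactly_conv_pairing_s:
  "compactly_conv f g \<Longrightarrow> (\<lambda>n. pairing (A (s n) f) m) \<longlonglongrightarrow> pairing g m"
  by (rule filterlim_compose[OF compactly_conv_pairing filterlim_s])

end

text \<open>Isolates what separation of fixed functions contributes: strict convergence on Lipschitz
  functions, with limits that are not yet represented by measures.\<close>

locale lipschitz_convergent_scheme = cofinal_average_scheme +
  assumes lip: "\<And>f. f \<in> Lip_b \<Longrightarrow> \<exists>g. compactly_conv f g"
begin

text \<open>Positivity turns the adjoint averages of \<open>m\<close> into ordinary measures, and
  convergence on Lipschitz functions gives these a limit along \<open>s\<close>, tested first
  against Lipschitz and then against all bounded continuous functions.\<close>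

lemma limit_measure:
  assumes m: "nonneg_cmeas m"
  obtains \<nu> where "finite_measure \<nu>" "sets \<nu> = sets borel"
    "\<forall>u. continuous_on UNIV u \<longrightarrow> bounded (range u) \<longrightarrow>
      (\<lambda>n. pairing (A (s n) (of_real_cb u)) m) \<longlonglongrightarrow> of_real (\<integral>x. u x \<partial>\<nu>)"
proof -
  define \<mu> where "\<mu> n = jordan_part (S' (A (s n)) m) 0" for n
  have fin: "finite_measure (\<mu> n)" "sets (\<mu> n) = sets borel" for n by (simp_all add: \<mu>_def)
  have eq: "pairing (A (s n) (of_real_cb u)) m = of_real (\<integral>x. u x \<partial>\<mu> n)"
    if "continuous_on UNIV u" "bounded (range u)" for u n
    unfolding \<mu>_def by (rule pairing_A_of_real_cb[OF m s_in that])
  have conv: "convergent (\<lambda>n. \<integral>y. u y \<partial>\<mu> n :: real)"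
    if u: "L-lipschitz_on UNIV u" "bounded (range u)" for u L
  proof -
    obtain g where "compactly_conv (of_real_cb u) g" using lip[OF of_real_cb_Lip_b[OF u]] by blast
    from compactly_conv_pairing_s[OF this, of m]
    have "(\<lambda>n. of_real (\<integral>y. u y \<partial>\<mu> n)) \<longlonglongrightarrow> pairing g m"
      using eq[OF lipschitz_on_continuous_on[OF u(1)] u(2)] by simp
    from tendsto_Re[OF this] show ?thesis by (auto simp: convergent_def)
  qed
  have "\<exists>\<nu>. finite_measure \<nu> \<and> sets \<nu> = sets borel \<and> (\<forall>u L. L-lipschitz_on UNIV u \<longrightarrow> bounded (range u) \<longrightarrow>
       (\<lambda>n. \<integral>y. u y \<partial>\<mu> n :: real) \<longlonglongrightarrow> (\<integral>y. u y \<partial>\<nu>))"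
  proof (rule lipschitz_limit_measure[of \<mu>, OF fin])
    fix u :: "'a \<Rightarrow> real" and L assume "L-lipschitz_on UNIV u" "bounded (range u)"
    thus "convergent (\<lambda>n. \<integral>y. u y \<partial>\<mu> n)" by (rule conv)
  qed blast
  then obtain \<nu> where \<nu>: "finite_measure \<nu>" "sets \<nu> = sets borel"
    "\<And>u L. L-lipschitz_on UNIV u \<Longrightarrow> bounded (range u) \<Longrightarrow>
       (\<lambda>n. \<integral>y. u y \<partial>\<mu> n :: real) \<longlonglongrightarrow> (\<integral>y. u y \<partial>\<nu>)"
    by blast
  have "(\<lambda>n. pairing (A (s n) (of_real_cb u)) m) \<longlonglongrightarrow> of_real (\<integral>x. u x \<partial>\<nu>)"
    if u: "continuous_on UNIV u" "bounded (range u)" for u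
    unfolding eq[OF u]
    by (rule tendsto_of_real, rule weak_convergence_from_lipschitz) (assumption | rule fin \<nu> u)+
  thus ?thesis using that \<nu>(1,2) by blast
qed

text \<open>The averages of the Lipschitz bounds have continuous limits \<open>p j\<close> and
  \<open>q j\<close>. Integration against one measure \<open>\<nu> x\<close> at each point shows
  that both approach the same \<open>k\<close>, which yields continuity of \<open>k\<close> and a
  uniformly small gap on compact sets.\<close>

lemma compactly_conv_of_real_cb:
  assumes u: "continuous_on UNIV u" "bounded (range u)"
  shows "\<exists>g. compactly_conv (of_real_cb u) g"
proof -
  have "\<exists>\<nu>. finite_measure \<nu> \<and> sets \<nu> = sets borel \<and> (\<forall>w. continuous_on UNIV w \<longrightarrow> bounded (range w) \<longrightarrow>
      (\<lambda>n. pairing (A (s n) (of_real_cb w)) (dirac x)) \<longlonglongrightarrow> of_real (\<integral>y. w y \<partial>\<nu>))" for x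
    using limit_measure[OF pos_dirac, of x] by metis
  then obtain \<nu> where \<nu>: "\<And>x. finite_measure (\<nu> x)" "\<And>x. sets (\<nu> x) = sets borel"
    "\<And>x w. continuous_on UNIV w \<Longrightarrow> bounded (range w) \<Longrightarrow>
      (\<lambda>n. apply_bcontfun (A (s n) (of_real_cb w)) x) \<longlonglongrightarrow> of_real (\<integral>y. w y \<partial>\<nu> x)"
    unfolding pairing_dirac by metis
  obtain B where B: "\<And>y. \<bar>u y\<bar> \<le> B" using u(2) by (auto simp: bounded_iff)
  obtain v where v: "\<And>j. \<exists>L. L-lipschitz_on UNIV (v j)" "\<And>j y. - B \<le> v j y" "\<And>j y. v j y \<le> u y"
      "\<And>i j y. i \<le> j \<Longrightarrow> v i y \<le> v j y" "\<And>y. (\<lambda>j. v j y) \<longlonglongrightarrow> u y"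
    using lipschitz_approximation_below[OF u(1) B] by metis
  \<comment> \<open>Minorants of \<open>- u\<close>, so that \<open>- w j\<close> decreases to
    \<open>u\<close>.\<close>
  obtain w where w: "\<And>j. \<exists>L. L-lipschitz_on UNIV (w j)" "\<And>j y. - B \<le> w j y" "\<And>j y. w j y \<le> - u y"
      "\<And>i j y. i \<le> j \<Longrightarrow> w i y \<le> w j y" "\<And>y. (\<lambda>j. w j y) \<longlonglongrightarrow> - u y"
    using lipschitz_approximation_below[of "\<lambda>y. - u y" B] u(1) B by (metis abs_minus_cancel continuous_on_minus)
  have vB: "\<bar>v j y\<bar> \<le> B" and wB: "\<bar>- w j y\<bar> \<le> B" for j y
    using v(2,3)[of j y] w(2,3)[of j y] B[of y] by (auto simp: abs_le_iff)
  have vL: "\<exists>L. L-lipschitz_on UNIV (v j)" and wL: "\<exists>L. L-lipschitz_on UNIV (\<lambda>y. - w j y)" for j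
    using v(1)[of j] w(1)[of j] by auto
  have vb: "bounded (range (v j))" and wb: "bounded (range (\<lambda>y. - w j y))" for j
    using vB wB by (auto intro!: boundedI[of _ B])
  have vc: "continuous_on UNIV (v j)" and wc: "continuous_on UNIV (\<lambda>y. - w j y)" for j
    using vL[of j] wL[of j] lipschitz_on_continuous_on by blast+
  have "\<exists>g. compactly_conv (of_real_cb (v j)) g" "\<exists>g. compactly_conv (of_real_cb (\<lambda>y. - w j y)) g" for j
    using lip of_real_cb_Lip_b vL[of j] wL[of j] vb[of j] wb[of j] by blast+
  then obtain g h where g: "\<And>j. compactly_conv (of_real_cb (v j)) (g j)"
    and h: "\<And>j. compactly_conv (of_real_cb (\<lambda>y. - w j y)) (h j)" by metis
  \<comment> \<open>The limit along the whole net exists, so it can be identified along the sequence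
    \<open>s\<close>: at \<open>x\<close> it is the integral against \<open>\<nu> x\<close>.\<close>
  have lim_eq: "apply_bcontfun f x = of_real (\<integral>y. z y \<partial>\<nu> x)"
    if "compactly_conv (of_real_cb z) f" "continuous_on UNIV z" "bounded (range z)" for f z x
    using LIMSEQ_unique[OF compactly_conv_pairing_s[OF that(1), of "dirac x", unfolded pairing_dirac] \<nu>(3)[OF that(2,3), of x]] .
  define p where "p j x = (\<integral>y. v j y \<partial>\<nu> x)" for j x
  define q where "q j x = (\<integral>y. - w j y \<partial>\<nu> x)" for j x
  define k where "k x = (\<integral>y. u y \<partial>\<nu> x)" for x
  have gp: "apply_bcontfun (g j) x = of_real (p j x)" for j x
    unfolding p_def by (rule lim_eq[OF g vc vb])
  have hq: "apply_bcontfun (h j) x = of_real (q j x)" for j x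
    unfolding q_def by (rule lim_eq[OF h wc wb])
  have pc: "continuous_on UNIV (p j)" and qc: "continuous_on UNIV (q j)" for j
    using continuous_on_Re[OF continuous_on_apply_bcontfun[of UNIV "g j"]]
      continuous_on_Re[OF continuous_on_apply_bcontfun[of UNIV "h j"]] by (simp_all add: gp hq)
  have int: "integrable (\<nu> x) z" if "continuous_on UNIV z" "\<And>y. \<bar>z y\<bar> \<le> B" for x and z :: "'a \<Rightarrow> real"
    by (rule integrable_bounded_borel[OF \<nu>(1,2) borel_measurable_continuous_onI[OF that(1)], where B = B])
       (use that(2) in simp)
  have pk: "p j x \<le> k x" and kq: "k x \<le> q j x" for j x
    unfolding p_def q_def k_def using v(3) w(3)
    by (auto intro!: integral_mono int vc wc vB wB u(1) B simp del: Bochner_Integration.integral_minus simp: le_minus_iff minus_le_iff)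
  have pmono: "p i x \<le> p j x" and qmono: "q j x \<le> q i x" if "i \<le> j" for i j x
    unfolding p_def q_def using v(4)[OF that] w(4)[OF that]
    by (auto intro!: integral_mono int vc wc vB wB simp del: Bochner_Integration.integral_minus)
  have plim: "(\<lambda>j. p j x) \<longlonglongrightarrow> k x" for x
    unfolding p_def k_def
    by (rule integral_dominated_convergence[where w = "\<lambda>_. B"])
       (use int[OF vc vB] int[OF u(1) B] vB v(5) \<nu>(1) in
         \<open>auto dest: borel_measurable_integrable simp: finite_measure.integrable_const\<close>)
  have qlim: "(\<lambda>j. q j x) \<longlonglongrightarrow> k x" for x
    unfolding q_def k_def
  proof (rule integral_dominated_convergence[where w = "\<lambda>_. B"])
    have "(\<lambda>j. - w j y) \<longlonglongrightarrow> u y" for y using tendsto_minus[OF w(5)[of y]] by simp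
    thus "AE y in \<nu> x. (\<lambda>j. - w j y) \<longlonglongrightarrow> u y" by simp
    show "u \<in> borel_measurable (\<nu> x)" "\<And>j. (\<lambda>y. - w j y) \<in> borel_measurable (\<nu> x)"
      by (intro borel_measurable_integrable int[OF u(1) B] int[OF wc wB])+
    show "AE y in \<nu> x. norm (- w j y) \<le> B" for j using wB[of j] by simp
  qed (use \<nu>(1) in \<open>simp add: finite_measure.integrable_const\<close>)
  \<comment> \<open>The sets for Dini's argument: open because \<open>p j\<close> and
    \<open>q j\<close> are continuous, increasing in \<open>j\<close>, and covering because both
    limits are \<open>k\<close>.\<close>
  define U where "U e j = {x. q j x - p j x < e}" for e j
  have Uo: "open (U e j)" for e j
    unfolding U_def by (intro open_Collect_less continuous_intros pc qc)
  have Umono: "U e i \<subseteq> U e j" if "i \<le> j" for i j e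
    using pmono[OF that] qmono[OF that] unfolding U_def by (smt (verit) mem_Collect_eq subsetI)
  have Ucover: "\<exists>j. x \<in> U e j" if "e > 0" for x e
  proof -
    have "(\<lambda>j. q j x - p j x) \<longlonglongrightarrow> k x - k x" by (intro tendsto_diff plim qlim)
    hence "\<forall>\<^sub>F j in sequentially. q j x - p j x < e" using that by (intro order_tendstoD(2)) auto
    thus ?thesis by (auto simp: U_def eventually_sequentially)
  qed
  have kc: "continuous_on UNIV k"
    unfolding continuous_on_eq_continuous_at[OF open_UNIV] continuous_at
  proof (intro ballI tendstoI)
    fix x and e :: real assume "e > 0"
    hence e: "e / 3 > 0" by simp
    \<comment> \<open>At \<open>x\<close> and near it, \<open>k\<close> is enclosed between
      \<open>p j\<close> and \<open>q j\<close> with gap below \<open>e / 3\<close>; the last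
      \<open>e / 3\<close> is the variation of \<open>p j\<close>.\<close>
    obtain j where j: "x \<in> U (e / 3) j" using Ucover[OF e] by blast
    have "(p j \<longlongrightarrow> p j x) (at x)"
      using pc[of j] by (simp add: continuous_on_eq_continuous_at continuous_at)
    from tendstoD[OF this e] have 1: "\<forall>\<^sub>F y in at x. dist (p j y) (p j x) < e / 3" .
    have 2: "\<forall>\<^sub>F y in at x. y \<in> U (e / 3) j" using Uo j by (rule topological_tendstoD[OF tendsto_ident_at])
    from 1 2 show "\<forall>\<^sub>F y in at x. dist (k y) (k x) < e"
    proof eventually_elim
      case (elim y)
      have "q j y - p j y < e / 3" "q j x - p j x < e / 3" using elim(2) j by (simp_all add: U_def)
      moreover have "\<bar>p j y - p j x\<bar> < e / 3" using elim(1) by (simp add: dist_real_def)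
      ultimately show ?case
        unfolding dist_real_def using pk[of j x] kq[of x j] pk[of j y] kq[of y j] by linarith
    qed
  qed
  obtain C where C: "C > 0" "\<And>a f. a \<in> \<Lambda> \<Longrightarrow> norm (A a f) \<le> C * norm f" by (rule A_bounded) blast
  have kb: "bounded (range k)"
  proof (rule boundedI)
    fix r assume "r \<in> range k"
    then obtain x where x: "r = k x" by blast
    have "norm (apply_bcontfun (A (s n) (of_real_cb u)) x) \<le> C * norm (of_real_cb u)" for n
      using norm_bounded[of "A (s n) (of_real_cb u)" x] C(2)[OF s_in] by (rule order_trans)
    hence "norm (of_real (k x) :: complex) \<le> C * norm (of_real_cb u)"
      unfolding k_def by (intro LIMSEQ_le_const2[OF tendsto_norm[OF \<nu>(3)[OF u]]]) auto
    thus "norm r \<le> C * norm (of_real_cb u)" by (simp add: x)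
  qed
  have "compactly_conv (of_real_cb u) (of_real_cb k)"
    unfolding compactly_conv_def
  proof (intro allI impI)
    fix K :: "'a set" and e :: real assume K: "compact K" "e > 0"
    hence e: "e / 2 > 0" by simp
    have "K \<subseteq> (\<Union>j. U (e / 2) j)" using Ucover[OF e] by blast
    then obtain J where J: "finite J" "K \<subseteq> (\<Union>j\<in>J. U (e / 2) j)"
      using compactE_image[OF K(1), of UNIV "U (e / 2)"] Uo by (metis UNIV_I)
    \<comment> \<open>The inserted 0 keeps the maximum meaningful when \<open>J\<close> is
      empty.\<close>
    define j where "j = Max (insert 0 J)"
    have "U (e / 2) i \<subseteq> U (e / 2) j" if "i \<in> J" for i
      using J(1) that by (intro Umono) (simp add: j_def)
    hence Kj: "K \<subseteq> U (e / 2) j" using J(2) by blast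
    from eventually_in_index compactly_convD[OF g K(1) e, of j] compactly_convD[OF h K(1) e, of j]
    show "\<forall>\<^sub>F a in tails. \<forall>x\<in>K. norm (apply_bcontfun (A a (of_real_cb u)) x - apply_bcontfun (of_real_cb k) x) < e"
    proof eventually_elim
      case (elim a)
      show ?case
      proof
        fix x assume x: "x \<in> K"
        let ?Re = "\<lambda>z. Re (apply_bcontfun (A a (of_real_cb z)) x)"
        have le: "?Re (v j) \<le> ?Re u" "?Re u \<le> ?Re (\<lambda>y. - w j y)" "Im (apply_bcontfun (A a (of_real_cb u)) x) = 0"
          using A_of_real_cb_mono[OF elim(1) vc vb u v(3), of j x]
            A_of_real_cb_mono[OF elim(1) u wc wb, of j x] w(3) by (auto simp: le_minus_iff)
        have "\<bar>?Re (v j) - p j x\<bar> < e / 2"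
          using abs_Re_le_cmod[of "apply_bcontfun (A a (of_real_cb (v j))) x - apply_bcontfun (g j) x"]
            elim(2) x by (fastforce simp: gp)
        moreover have "\<bar>?Re (\<lambda>y. - w j y) - q j x\<bar> < e / 2"
          using abs_Re_le_cmod[of "apply_bcontfun (A a (of_real_cb (\<lambda>y. - w j y))) x - apply_bcontfun (h j) x"]
            elim(3) x by (fastforce simp: hq)
        moreover have "q j x - p j x < e / 2" using Kj x by (auto simp: U_def)
        \<comment> \<open>One half of \<open>e\<close> is the error of the averages of the bounds,
          the other the gap between \<open>p j\<close> and \<open>q j\<close>, which enclose
          \<open>k\<close>.\<close>
        ultimately have "\<bar>?Re u - k x\<bar> < e"
          using le(1,2) pk[of j x] kq[of x j] by linarith
        moreover have "apply_bcontfun (A a (of_real_cb u)) x - apply_bcontfun (of_real_cb k) x = of_real (?Re u - k x)"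
          using le(3) by (simp add: apply_of_real_cb[OF kc kb] complex_eq_iff)
        ultimately show "norm (apply_bcontfun (A a (of_real_cb u)) x - apply_bcontfun (of_real_cb k) x) < e"
          by (simp only: norm_of_real)
      qed
    qed
  qed
  thus ?thesis ..
qed

lemma compactly_conv_exists: "\<exists>g. compactly_conv f g"
proof -
  note f = bcontfun_Re_Im[of f]
  show ?thesis
    using compactly_conv_of_real_cb[OF f(1,2)] compactly_conv_of_real_cb[OF f(3,4)]
      compactly_conv_combine f(5) by metis
qed

text \<open>The net of pairings converges by \<open>compactly_conv_exists\<close>; its limit is the
  pairing with a measure because along \<open>s\<close> it is integration against
  \<open>\<nu>\<close>.\<close>

lemma adjoint_limit_pos:
  assumes m: "nonneg_cmeas m"
  shows "\<exists>n. \<forall>f. ((\<lambda>a. pairing (A a f) m) \<longlongrightarrow> pairing f n) tails"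
proof -
  obtain \<nu> where \<nu>: "finite_measure \<nu>" "sets \<nu> = sets borel"
    "\<forall>u. continuous_on UNIV u \<longrightarrow> bounded (range u) \<longrightarrow>
      (\<lambda>n. pairing (A (s n) (of_real_cb u)) m) \<longlonglongrightarrow> of_real (\<integral>x. u x \<partial>\<nu>)"
    by (rule limit_measure[OF m])
  have "((\<lambda>a. pairing (A a f) m) \<longlongrightarrow> pairing f (of_measure \<nu>)) tails" for f
  proof -
    obtain g where g: "compactly_conv f g" using compactly_conv_exists by blast
    have real: "(\<lambda>n. pairing (A (s n) (of_real_cb u)) m) \<longlonglongrightarrow> pairing (of_real_cb u) (of_measure \<nu>)"
      if "continuous_on UNIV u" "bounded (range u)" for u
      using \<nu>(3) that by (simp add: pairing_of_measure[OF \<nu>(1,2)] apply_of_real_cb)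
    note f = bcontfun_Re_Im[of f]
    let ?u = "of_real_cb (\<lambda>x. Re (apply_bcontfun f x))" and ?v = "of_real_cb (\<lambda>x. Im (apply_bcontfun f x))"
    have split: "pairing (A (s n) f) m = pairing (A (s n) ?u) m + \<i> * pairing (A (s n) ?v) m" for n
      by (subst f(5)) (simp add: sigma_operators_add[OF A_op[OF s_in]] sigma_operators_scale[OF A_op[OF s_in]]
          pairing_add_left pairing_scale_left)
    have "(\<lambda>n. pairing (A (s n) f) m) \<longlonglongrightarrow>
        pairing ?u (of_measure \<nu>) + \<i> * pairing ?v (of_measure \<nu>)"
      unfolding split by (intro tendsto_intros real f(1-4))
    also have "pairing ?u (of_measure \<nu>) + \<i> * pairing ?v (of_measure \<nu>) = pairing f (of_measure \<nu>)"
      by (subst (3) f(5)) (simp add: pairing_add_left pairing_scale_left)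
    finally have "pairing g m = pairing f (of_measure \<nu>)"
      using LIMSEQ_unique compactly_conv_pairing_s[OF g] by blast
    thus ?thesis using compactly_conv_pairing[OF g, of m] by simp
  qed
  thus ?thesis by blast
qed

lemma adjoint_limit: "\<exists>n. \<forall>f. ((\<lambda>a. pairing (A a f) m) \<longlongrightarrow> pairing f n) tails"
proof -
  have "\<exists>n. \<forall>f. ((\<lambda>a. pairing (A a f) (of_measure (jordan_part m k))) \<longlongrightarrow> pairing f n) tails" for k
    by (rule adjoint_limit_pos[OF pos_of_measure]) simp_all
  then obtain n where n: "\<And>k f. ((\<lambda>a. pairing (A a f) (of_measure (jordan_part m k))) \<longlongrightarrow> pairing f (n k)) tails"
    by metis
  have sum: "pairing f (\<Sum>k<4. scale_cmeas (\<i> ^ k) (l k)) = (\<Sum>k<4. \<i> ^ k * pairing f (l k))"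
    for f and l :: "nat \<Rightarrow> 'a cmeas"
  proof -
    have "pairing f (sum l F) = (\<Sum>k\<in>F. pairing f (l k))" for l and F :: "nat set"
      by (induction F rule: infinite_finite_induct) (auto simp: pairing_add_right)
    thus ?thesis by (simp add: pairing_scale_right)
  qed
  have "((\<lambda>a. pairing (A a f) m) \<longlongrightarrow> pairing f (\<Sum>k<4. scale_cmeas (\<i> ^ k) (n k))) tails" for f
  proof -
    have "pairing h m = (\<Sum>k<4. \<i> ^ k * pairing h (of_measure (jordan_part m k)))" for h
      by (subst cmeas_decomposition) (rule sum)
    thus ?thesis unfolding sum by (simp only:) (intro tendsto_intros n)
  qed
  thus ?thesis by blast
qed

lemma weakly_ergodic_strict_limit:
  "weakly_ergodic \<Lambda> le A \<and>
    (\<forall>f. limitin strict_topology (\<lambda>a. A a f) (ergodic_projection \<Lambda> le A f) tails)"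
proof
  have w: "limitin sigma_fun (\<lambda>a. A a f) g tails" if "compactly_conv f g" for f g
    unfolding limitin_weak_topology using compactly_conv_pairing[OF that] by blast
  show "weakly_ergodic \<Lambda> le A"
    unfolding weakly_ergodic_def
  proof (intro conjI allI)
    show "\<exists>g. limitin sigma_fun (\<lambda>a. A a f) g tails" for f
      using compactly_conv_exists[of f] w by blast
    fix m
    obtain n where n: "\<And>f. ((\<lambda>a. pairing (A a f) m) \<longlongrightarrow> pairing f n) tails" using adjoint_limit by blast
    have "((\<lambda>a. pairing f (S' (A a) m)) \<longlongrightarrow> pairing f n) tails" for f
    proof (rule Lim_transform_eventually[OF n])
      show "\<forall>\<^sub>F a in tails. pairing (A a f) m = pairing f (S' (A a) m)"
        using eventually_in_index by eventually_elim (simp add: pairing_A')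
    qed
    thus "\<exists>n. limitin sigma_meas (\<lambda>a. S' (A a) m) n tails"
      unfolding limitin_weak_topology by blast
  qed
  show "\<forall>f. limitin strict_topology (\<lambda>a. A a f) (ergodic_projection \<Lambda> le A f) tails"
  proof
    fix f
    obtain g where g: "compactly_conv f g" using compactly_conv_exists by blast
    have "ergodic_projection \<Lambda> le A f = g"
      unfolding ergodic_projection_def
    proof (rule the_equality)
      fix h assume "limitin sigma_fun (\<lambda>a. A a f) h tails"
      hence "pairing h m = pairing g m" for m
        using w[OF g] tendsto_unique[OF tails_nontrivial] unfolding limitin_weak_topology by blast
      thus "h = g" by (rule bcontfun_eq_pairingI)
    qed (rule w[OF g])
    thus "limitin strict_topology (\<lambda>a. A a f) (ergodic_projection \<Lambda> le A f) tails"
      using g by (simp add: limitin_strict_iff)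
  qed
qed

end

theorem theorem5p7:
  fixes \<S> :: "(('a::polish_space \<Rightarrow>\<^sub>C complex) \<Rightarrow> ('a \<Rightarrow>\<^sub>C complex)) set"
    and \<Lambda> :: "'i set" and le :: "'i \<Rightarrow> 'i \<Rightarrow> bool"
    and A :: "'i \<Rightarrow> ('a \<Rightarrow>\<^sub>C complex) \<Rightarrow> ('a \<Rightarrow>\<^sub>C complex)"
  assumes "markovian_average_scheme \<S> \<Lambda> le A"
    and "\<forall>f\<in>Lip_b. net_clusters strict_topology \<Lambda> le (\<lambda>a. A a f)"
    and "\<exists>s :: nat \<Rightarrow> 'i. (\<forall>n. s n \<in> \<Lambda>) \<and> (\<forall>n. le (s n) (s (Suc n))) \<and> (\<forall>a\<in>\<Lambda>. \<exists>n. le a (s n))"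
  shows
    "let assertion_i = weakly_ergodic \<Lambda> le A \<and>
           (\<forall>f. limitin strict_topology (\<lambda>a. A a f) (ergodic_projection \<Lambda> le A f) (net_filter \<Lambda> le));
         assertion_ii = (\<forall>x. \<exists>m. net_cluster_point sigma_meas \<Lambda> le (\<lambda>a. sigma_adjoint (A a) (dirac x)) m);
         assertion_iii = separates_fix \<S>;
         assertion_iv = is_direct_sum (fix_space (sigma_adjoint ` \<S>))
           (sigma_meas closure_of (module.span scale_cmeas (rg_diff (sigma_adjoint ` \<S>))))
     in (assertion_i \<longleftrightarrow> assertion_ii) \<and> (assertion_ii \<longleftrightarrow> assertion_iii) \<and>
        (assertion_iii \<longleftrightarrow> assertion_iv)"
proof -
  interpret polish_average_scheme \<S> \<Lambda> le A
    by (intro polish_average_scheme.intro assms(1))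
  define i where "i \<longleftrightarrow> weakly_ergodic \<Lambda> le A \<and>
    (\<forall>f. limitin strict_topology (\<lambda>a. A a f) (ergodic_projection \<Lambda> le A f) tails)"
  define ii where "ii \<longleftrightarrow> (\<forall>x. \<exists>m. net_cluster_point sigma_meas \<Lambda> le (\<lambda>a. S' (A a) (dirac x)) m)"
  define iv where "iv \<longleftrightarrow> is_direct_sum (fix_space (S' ` \<S>))
    (sigma_meas closure_of (module.span scale_cmeas (rg_diff (S' ` \<S>))))"
  have "i \<Longrightarrow> ii"
    unfolding i_def ii_def weakly_ergodic_def
    by (meson limitin_imp_net_cluster_point[OF directed])
  moreover have "ii \<Longrightarrow> separates_fix \<S>"
    unfolding ii_def by (rule cluster_imp_separates)
  \<comment> \<open>Closes the circle (i), (ii), (iii), to which (iv) is attached by (i) to (iv) to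
    (iii). The clustering on \<open>Lip_b\<close> and the cofinal sequence enter here.\<close>
  moreover have "i" if sep: "separates_fix \<S>"
  proof -
    obtain s :: "nat \<Rightarrow> 'i" where s: "\<forall>n. s n \<in> \<Lambda>" "\<forall>n. le (s n) (s (Suc n))" "\<forall>a\<in>\<Lambda>. \<exists>n. le a (s n)"
      using assms(3) by blast
    interpret lipschitz_convergent_scheme \<S> \<Lambda> le A s
    proof
      show "\<exists>g. compactly_conv f g" if "f \<in> Lip_b" for f
        using separates_imp_strict_limit[OF sep] assms(2) that by (simp add: limitin_strict_iff)
    qed (use s in auto)
    show ?thesis unfolding i_def by (rule weakly_ergodic_strict_limit)
  qed
  moreover have "i \<Longrightarrow> iv"
    unfolding i_def iv_def using weakly_ergodic_imp_direct_sum by blast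
  moreover have "iv \<Longrightarrow> separates_fix \<S>"
    unfolding iv_def by (rule direct_sum_imp_separates)
  ultimately have "(i \<longleftrightarrow> ii) \<and> (ii \<longleftrightarrow> separates_fix \<S>) \<and> (separates_fix \<S> \<longleftrightarrow> iv)" by blast
  thus ?thesis unfolding Let_def i_def ii_def iv_def .
qed

end
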